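(* Let $B\subseteq A$ be a subring pair of finite dimensional (unital associative) algebras over a field $k$, with $1_B=1_A$. (1) If $B^e$ has finite representation type, then $d(B,A)\le 1+2n_{B^e}$. (2) If $A^e$ has finite representation type, then $d(B,A)\le 2n_{A^e}$. (3) If $A\otimes_k B^{\rm op}$ has finite representation type, then $d(B,A)\le 2n_{A\otimes B^{\rm op}}$.
   Context: For a $k$-algebra $B$, $B^e=B\otimes_k B^{\rm op}$. For a finite dimensional algebra $\Lambda$, $n_\Lambda$ denotes the cardinal number of isomorphism classes of indecomposable finitely generated $\Lambda$-modules; $\Lambda$ has finite representation type if $n_\Lambda<\infty$. Depth: for modules over a ring, $M\mid N$ means $N\cong M\oplus M'$ for some module $M'$, and $M\sim N$ (H-equivalent) means there are natural numbers $r,s\ge 1$ with $N\mid rM$ and $M\mid sN$, where $rM=M\oplus\cdots\oplus M$ ($r$ times). For a unital subring $B\subseteq A$ with $1_B=1_A$, put $C_0(A,B)=B$ (as a $B$-$B$-bimodule) and $C_m(A,B)=A\otimes_B\cdots\otimes_B A$ ($m$ factors $A$) for $m\ge1$, with its natural $A$-$A$-bimodule structure $a(a_1\otimes\cdots\otimes a_m)a'=aa_1\otimes\cdots\otimes a_ma'$ and its restrictions to $A$-$B$-, $B$-$A$-, $B$-$B$-bimodules. The subring $B\subseteq A$ has depth $2m+1$ ($m\ge0$) if $C_{m+1}(A,B)\sim C_m(A,B)$ as $B$-$B$-bimodules; right (resp. left) depth $2m$ ($m\ge1$) if $C_{m+1}(A,B)\sim C_m(A,B)$ as $A$-$B$-bimodules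 (resp. $B$-$A$-bimodules); depth $2m$ if it has both left and right depth $2m$. Left or right depth $2m$ implies depth $2m+1$, and depth $2m+1$ implies depth $2m+2$. The minimum depth $d(B,A)$ is the least $k\ge 1$ such that $k$ is odd and $B\subseteq A$ has depth $k$, or $k$ is even and $B\subseteq A$ has left or right depth $k$; $d(B,A)=\infty$ if there is no such $k$. *)

theory Defs
  imports "HOL-Algebra.Algebra" "HOL-Library.Extended_Nat"
begin

section \<open>Modules over a not necessarily commutative ring\<close>

text \<open>The library locale \<open>module\<close> requires a commutative ring of scalars, so left modules are
  introduced separately, on the same record type.\<close>

locale left_module = R?: ring R + M?: abelian_group M
  for R :: "('r, 'x) ring_scheme" (structure) and M :: "('r, 'm, 'y) module_scheme" (structure) +
  assumes smult_closed [simp, intro]: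
      "\<lbrakk>a \<in> carrier R; x \<in> carrier M\<rbrakk> \<Longrightarrow> a \<odot>\<^bsub>M\<^esub> x \<in> carrier M"
    and smult_l_distr:
      "\<lbrakk>a \<in> carrier R; b \<in> carrier R; x \<in> carrier M\<rbrakk> \<Longrightarrow>
        (a \<oplus> b) \<odot>\<^bsub>M\<^esub> x = a \<odot>\<^bsub>M\<^esub> x \<oplus>\<^bsub>M\<^esub> b \<odot>\<^bsub>M\<^esub> x"
    and smult_r_distr:
      "\<lbrakk>a \<in> carrier R; x \<in> carrier M; y \<in> carrier M\<rbrakk> \<Longrightarrow>
        a \<odot>\<^bsub>M\<^esub> (x \<oplus>\<^bsub>M\<^esub> y) = a \<odot>\<^bsub>M\<^esub> x \<oplus>\<^bsub>M\<^esub> a \<odot>\<^bsub>M\<^esub> y"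
    and smult_assoc1:
      "\<lbrakk>a \<in> carrier R; b \<in> carrier R; x \<in> carrier M\<rbrakk> \<Longrightarrow>
        (a \<otimes> b) \<odot>\<^bsub>M\<^esub> x = a \<odot>\<^bsub>M\<^esub> (b \<odot>\<^bsub>M\<^esub> x)"
    and smult_one [simp]:
      "x \<in> carrier M \<Longrightarrow> \<one> \<odot>\<^bsub>M\<^esub> x = x"

definition fin_gen :: "('r, 'x) ring_scheme \<Rightarrow> ('r, 'm, 'y) module_scheme \<Rightarrow> bool" where
  "fin_gen R M \<longleftrightarrow> (\<exists>S. finite S \<and> S \<subseteq> carrier M \<and>
     (\<forall>x \<in> carrier M. \<exists>c \<in> S \<rightarrow> carrier R. x = (\<Oplus>\<^bsub>M\<^esub>s\<in>S. c s \<odot>\<^bsub>M\<^esub> s)))"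

definition module_iso ::
  "('r, 'x) ring_scheme \<Rightarrow> ('r, 'm, 'y) module_scheme \<Rightarrow> ('r, 'n, 'z) module_scheme \<Rightarrow> bool" where
  "module_iso R M N \<longleftrightarrow> (\<exists>h. bij_betw h (carrier M) (carrier N) \<and>
     (\<forall>x \<in> carrier M. \<forall>y \<in> carrier M. h (x \<oplus>\<^bsub>M\<^esub> y) = h x \<oplus>\<^bsub>N\<^esub> h y) \<and>
     (\<forall>a \<in> carrier R. \<forall>x \<in> carrier M. h (a \<odot>\<^bsub>M\<^esub> x) = a \<odot>\<^bsub>N\<^esub> h x))"

definition indecomposable :: "('r, 'x) ring_scheme \<Rightarrow> ('r, 'm, 'y) module_scheme \<Rightarrow> bool" where
  "indecomposable R M \<longleftrightarrow> carrier M \<noteq> {\<zero>\<^bsub>M\<^esub>} \<and>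
     (\<forall>U V. submodule U R M \<longrightarrow> submodule V R M \<longrightarrow>
        U \<inter> V = {\<zero>\<^bsub>M\<^esub>} \<longrightarrow> U <+>\<^bsub>M\<^esub> V = carrier M \<longrightarrow> U = {\<zero>\<^bsub>M\<^esub>} \<or> V = {\<zero>\<^bsub>M\<^esub>})"

text \<open>A set of isomorphism classes needs one fixed type for the underlying sets of modules.
  Subsets of \<open>(nat \<Rightarrow> 'r) set\<close> suffice for finitely generated modules over a ring with elements
  in \<open>'r\<close>; see \<open>fin_gen_representable\<close> below.\<close>

definition indec_modules :: "('r, 'x) ring_scheme \<Rightarrow> ('r, (nat \<Rightarrow> 'r) set) module set" where
  "indec_modules R = {M. left_module R M \<and> fin_gen R M \<and> indecomposable R M}"

definition indec_classes :: "('r, 'x) ring_scheme \<Rightarrow> ('r, (nat \<Rightarrow> 'r) set) module set set" where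
  "indec_classes R =
     indec_modules R // {(M, N). M \<in> indec_modules R \<and> N \<in> indec_modules R \<and> module_iso R M N}"

definition num_indec :: "('r, 'x) ring_scheme \<Rightarrow> enat" where
  "num_indec R = (if finite (indec_classes R) then enat (card (indec_classes R)) else \<infinity>)"

definition finite_rep_type :: "('r, 'x) ring_scheme \<Rightarrow> bool" where
  "finite_rep_type R \<longleftrightarrow> num_indec R < \<infinity>"

lemma abelian_group_transport:
  fixes M :: "('m, 'y) ring_scheme" and N :: "('n, 'z) ring_scheme"
  assumes "abelian_group M" and bij: "bij_betw h (carrier M) (carrier N)"
    and zero: "h \<zero>\<^bsub>M\<^esub> = \<zero>\<^bsub>N\<^esub>"
    and add: "\<And>x y. x \<in> carrier M \<Longrightarrow> y \<in> carrier M \<Longrightarrow> h (x \<oplus>\<^bsub>M\<^esub> y) = h x \<oplus>\<^bsub>N\<^esub> h y"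
  shows "abelian_group N"
proof -
  interpret M: abelian_group M by fact
  have im: "carrier N = h ` carrier M" using bij by (simp add: bij_betw_def)
  show ?thesis
  proof (rule abelian_groupI)
    fix x assume "x \<in> carrier N"
    then obtain u where u: "u \<in> carrier M" "x = h u" using im by auto
    have "h (\<ominus>\<^bsub>M\<^esub> u) \<oplus>\<^bsub>N\<^esub> x = \<zero>\<^bsub>N\<^esub>"
      using u by (simp flip: add add: zero M.l_neg)
    then show "\<exists>y\<in>carrier N. y \<oplus>\<^bsub>N\<^esub> x = \<zero>\<^bsub>N\<^esub>" using im u by auto
  qed (auto simp: im M.a_ac simp flip: add zero)
qed

lemma fin_gen_representable:
  fixes N :: "('r, 'm, 'y) module_scheme"
  assumes "left_module R N" and "fin_gen R N"
  shows "\<exists>M :: ('r, (nat \<Rightarrow> 'r) set) module. left_module R M \<and> module_iso R N M"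
proof -
  interpret N: left_module R N by fact
  obtain S where S: "finite S" "S \<subseteq> carrier N"
    and gen: "\<And>x. x \<in> carrier N \<Longrightarrow> \<exists>c \<in> S \<rightarrow> carrier R. x = (\<Oplus>\<^bsub>N\<^esub>s\<in>S. c s \<odot>\<^bsub>N\<^esub> s)"
    using assms(2) unfolding fin_gen_def by blast
  obtain e :: "'m \<Rightarrow> nat" where e: "inj_on e S"
    using S(1) finite_imp_inj_to_nat_seg by blast
  define h where "h x = {c. (\<Oplus>\<^bsub>N\<^esub>s\<in>S. c (e s) \<odot>\<^bsub>N\<^esub> s) = x}" for x
  have inj: "inj_on h (carrier N)"
  proof (rule inj_onI)
    fix x y assume x: "x \<in> carrier N" and "y \<in> carrier N" and eq: "h x = h y"
    obtain c where c: "c \<in> S \<rightarrow> carrier R" "x = (\<Oplus>\<^bsub>N\<^esub>s\<in>S. c s \<odot>\<^bsub>N\<^esub> s)" using gen[OF x] by blast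
    have "(\<Oplus>\<^bsub>N\<^esub>s\<in>S. c (the_inv_into S e (e s)) \<odot>\<^bsub>N\<^esub> s) = (\<Oplus>\<^bsub>N\<^esub>s\<in>S. c s \<odot>\<^bsub>N\<^esub> s)"
      using S c(1) e by (intro N.M.finsum_cong') (auto simp: the_inv_into_f_f)
    then have "c \<circ> the_inv_into S e \<in> h x" using c(2) by (simp add: h_def)
    then show "x = y" using eq by (auto simp: h_def)
  qed
  define g where "g = the_inv_into (carrier N) h"
  have g: "g (h x) = x" if "x \<in> carrier N" for x
    using that inj by (simp add: g_def the_inv_into_f_f)
  define M :: "('r, (nat \<Rightarrow> 'r) set) module" where
    "M = \<lparr>carrier = h ` carrier N, monoid.mult = undefined, one = undefined, ring.zero = h \<zero>\<^bsub>N\<^esub>,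
      ring.add = (\<lambda>u v. h (g u \<oplus>\<^bsub>N\<^esub> g v)), smult = (\<lambda>a u. h (a \<odot>\<^bsub>N\<^esub> g u))\<rparr>"
  have bij: "bij_betw h (carrier N) (carrier M)" using inj by (simp add: M_def bij_betw_def)
  have "abelian_group M"
    by (rule abelian_group_transport[OF N.M.abelian_group_axioms bij]) (simp_all add: M_def g)
  then have "left_module R M"
    by (intro left_module.intro left_module_axioms.intro N.R.ring_axioms)
       (auto simp: M_def g N.smult_l_distr N.smult_r_distr N.smult_assoc1)
  moreover have "module_iso R N M"
    unfolding module_iso_def by (rule exI[of _ h]) (use bij in \<open>auto simp: M_def g\<close>)
  ultimately show ?thesis by blast
qed


section \<open>Finite dimensional algebras and their tensor products\<close>

text \<open>The library locale \<open>algebra\<close> is restricted to commutative algebras.  The zero algebra is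
  allowed.\<close>

locale fin_dim_algebra = field K + A?: ring A + module K A
  for K :: "('k, 'x) ring_scheme" (structure) and A :: "('k, 'a, 'y) module_scheme" (structure) +
  assumes smult_mult_left:
      "\<lbrakk>c \<in> carrier K; x \<in> carrier A; y \<in> carrier A\<rbrakk> \<Longrightarrow>
        (c \<odot>\<^bsub>A\<^esub> x) \<otimes>\<^bsub>A\<^esub> y = c \<odot>\<^bsub>A\<^esub> (x \<otimes>\<^bsub>A\<^esub> y)"
    and smult_mult_right:
      "\<lbrakk>c \<in> carrier K; x \<in> carrier A; y \<in> carrier A\<rbrakk> \<Longrightarrow>
        x \<otimes>\<^bsub>A\<^esub> (c \<odot>\<^bsub>A\<^esub> y) = c \<odot>\<^bsub>A\<^esub> (x \<otimes>\<^bsub>A\<^esub> y)"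
    and finite_dimensional: "fin_gen K A"

definition opp :: "('k, 'a) module \<Rightarrow> ('k, 'a) module" where
  "opp A = A\<lparr>mult := \<lambda>x y. y \<otimes>\<^bsub>A\<^esub> x\<rparr>"

text \<open>Tensor products are presented as the free abelian group on tuples modulo the balancing
  relations.  An additive map \<open>f\<close> between free abelian groups induces \<open>coset_map G H f\<close> on cosets
  of the subgroup \<open>H\<close>.\<close>

definition coset_map :: "('b, 'x) monoid_scheme \<Rightarrow> 'b set \<Rightarrow> ('c \<Rightarrow> 'b) \<Rightarrow> 'c set \<Rightarrow> 'b set" where
  "coset_map G H f U = (\<Union>x\<in>U. H #>\<^bsub>G\<^esub> f x)"

definition tensor_rels ::
  "('k, 'x) ring_scheme \<Rightarrow> ('k, 'a) module \<Rightarrow> ('k, 'b) module \<Rightarrow> ('a \<times> 'b \<Rightarrow>\<^sub>0 int) set" where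
  "tensor_rels K A B =
     {frag_of (x \<oplus>\<^bsub>A\<^esub> x', y) - frag_of (x, y) - frag_of (x', y) | x x' y.
        x \<in> carrier A \<and> x' \<in> carrier A \<and> y \<in> carrier B} \<union>
     {frag_of (x, y \<oplus>\<^bsub>B\<^esub> y') - frag_of (x, y) - frag_of (x, y') | x y y'.
        x \<in> carrier A \<and> y \<in> carrier B \<and> y' \<in> carrier B} \<union>
     {frag_of (c \<odot>\<^bsub>A\<^esub> x, y) - frag_of (x, c \<odot>\<^bsub>B\<^esub> y) | c x y.
        c \<in> carrier K \<and> x \<in> carrier A \<and> y \<in> carrier B}"

definition tensor_algebra ::
  "('k, 'x) ring_scheme \<Rightarrow> ('k, 'a) module \<Rightarrow> ('k, 'b) module \<Rightarrow> ('k, ('a \<times> 'b \<Rightarrow>\<^sub>0 int) set) module"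
  where
  "tensor_algebra K A B =
    (let G = free_Abelian_group (carrier A \<times> carrier B);
         H = generate G (tensor_rels K A B)
     in \<lparr>carrier = rcosets\<^bsub>G\<^esub> H,
         monoid.mult = (\<lambda>U V. \<Union>u\<in>U. coset_map G H
            (frag_extend (\<lambda>(x', y'). frag_extend (\<lambda>(x, y). frag_of (x \<otimes>\<^bsub>A\<^esub> x', y \<otimes>\<^bsub>B\<^esub> y')) u)) V),
         one = H #>\<^bsub>G\<^esub> frag_of (\<one>\<^bsub>A\<^esub>, \<one>\<^bsub>B\<^esub>),
         ring.zero = H,
         ring.add = (\<lambda>U V. U <#>\<^bsub>G\<^esub> V),
         smult = (\<lambda>c. coset_map G H (frag_extend (\<lambda>(x, y). frag_of (c \<odot>\<^bsub>A\<^esub> x, y))))\<rparr>)"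


section \<open>Bimodules and H-equivalence\<close>

record ('r, 's, 'm) bimodule = "('r, 'm) module" +
  rsmult :: "['m, 's] \<Rightarrow> 'm"  (infixl \<open>\<odot>r\<index>\<close> 70)

text \<open>The fields \<open>mult\<close> and \<open>one\<close>, inherited from the ring record, play no role in a bimodule.\<close>

locale bimodule = left_module R M + S?: ring S
  for R :: "('r, 'x) ring_scheme" (structure) and S :: "('s, 'y) ring_scheme" (structure)
    and M :: "('r, 's, 'm) bimodule" (structure) +
  assumes rsmult_closed:
      "\<lbrakk>x \<in> carrier M; a \<in> carrier S\<rbrakk> \<Longrightarrow> x \<odot>r\<^bsub>M\<^esub> a \<in> carrier M"
    and rsmult_r_distr:
      "\<lbrakk>x \<in> carrier M; a \<in> carrier S; b \<in> carrier S\<rbrakk> \<Longrightarrow>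
        x \<odot>r\<^bsub>M\<^esub> (a \<oplus>\<^bsub>S\<^esub> b) = x \<odot>r\<^bsub>M\<^esub> a \<oplus>\<^bsub>M\<^esub> x \<odot>r\<^bsub>M\<^esub> b"
    and rsmult_l_distr:
      "\<lbrakk>x \<in> carrier M; y \<in> carrier M; a \<in> carrier S\<rbrakk> \<Longrightarrow>
        (x \<oplus>\<^bsub>M\<^esub> y) \<odot>r\<^bsub>M\<^esub> a = x \<odot>r\<^bsub>M\<^esub> a \<oplus>\<^bsub>M\<^esub> y \<odot>r\<^bsub>M\<^esub> a"
    and rsmult_assoc:
      "\<lbrakk>x \<in> carrier M; a \<in> carrier S; b \<in> carrier S\<rbrakk> \<Longrightarrow>
        x \<odot>r\<^bsub>M\<^esub> (a \<otimes>\<^bsub>S\<^esub> b) = (x \<odot>r\<^bsub>M\<^esub> a) \<odot>r\<^bsub>M\<^esub> b"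
    and rsmult_one:
      "x \<in> carrier M \<Longrightarrow> x \<odot>r\<^bsub>M\<^esub> \<one>\<^bsub>S\<^esub> = x"
    and smult_rsmult:
      "\<lbrakk>r \<in> carrier R; x \<in> carrier M; b \<in> carrier S\<rbrakk> \<Longrightarrow>
        (r \<odot>\<^bsub>M\<^esub> x) \<odot>r\<^bsub>M\<^esub> b = r \<odot>\<^bsub>M\<^esub> (x \<odot>r\<^bsub>M\<^esub> b)"

text \<open>Restriction of the actions to subrings is expressed by the ring arguments \<open>R\<close> and \<open>S\<close>; the
  bimodule record itself is unchanged.\<close>

definition bimodule_iso ::
  "('r, 'x) ring_scheme \<Rightarrow> ('s, 'y) ring_scheme \<Rightarrow>
   ('r, 's, 'm) bimodule \<Rightarrow> ('r, 's, 'n) bimodule \<Rightarrow> bool" where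
  "bimodule_iso R S M N \<longleftrightarrow> (\<exists>h. bij_betw h (carrier M) (carrier N) \<and>
     (\<forall>x \<in> carrier M. \<forall>y \<in> carrier M. h (x \<oplus>\<^bsub>M\<^esub> y) = h x \<oplus>\<^bsub>N\<^esub> h y) \<and>
     (\<forall>a \<in> carrier R. \<forall>x \<in> carrier M. h (a \<odot>\<^bsub>M\<^esub> x) = a \<odot>\<^bsub>N\<^esub> h x) \<and>
     (\<forall>a \<in> carrier S. \<forall>x \<in> carrier M. h (x \<odot>r\<^bsub>M\<^esub> a) = h x \<odot>r\<^bsub>N\<^esub> a))"

definition bimodule_sum ::
  "('r, 's, 'm) bimodule \<Rightarrow> ('r, 's, 'n) bimodule \<Rightarrow> ('r, 's, 'm \<times> 'n) bimodule" where
  "bimodule_sum M N =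
     \<lparr>carrier = carrier M \<times> carrier N, monoid.mult = undefined, one = undefined,
      ring.zero = (\<zero>\<^bsub>M\<^esub>, \<zero>\<^bsub>N\<^esub>),
      ring.add = (\<lambda>(x, y) (x', y'). (x \<oplus>\<^bsub>M\<^esub> x', y \<oplus>\<^bsub>N\<^esub> y')),
      smult = (\<lambda>a (x, y). (a \<odot>\<^bsub>M\<^esub> x, a \<odot>\<^bsub>N\<^esub> y)),
      rsmult = (\<lambda>(x, y) a. (x \<odot>r\<^bsub>M\<^esub> a, y \<odot>r\<^bsub>N\<^esub> a))\<rparr>"

definition bimodule_power ::
  "nat \<Rightarrow> ('r, 's, 'm) bimodule \<Rightarrow> ('r, 's, nat \<Rightarrow> 'm) bimodule" where
  "bimodule_power n M =
     \<lparr>carrier = {..<n} \<rightarrow>\<^sub>E carrier M, monoid.mult = undefined, one = undefined,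
      ring.zero = (\<lambda>i\<in>{..<n}. \<zero>\<^bsub>M\<^esub>),
      ring.add = (\<lambda>f g. \<lambda>i\<in>{..<n}. f i \<oplus>\<^bsub>M\<^esub> g i),
      smult = (\<lambda>a f. \<lambda>i\<in>{..<n}. a \<odot>\<^bsub>M\<^esub> f i),
      rsmult = (\<lambda>f a. \<lambda>i\<in>{..<n}. f i \<odot>r\<^bsub>M\<^esub> a)\<rparr>"

text \<open>\<open>bimodule_divides R S M N\<close> is the relation \<open>M | N\<close>: \<open>N\<close> is isomorphic to a direct sum of \<open>M\<close>
  and some \<open>M'\<close>.  The quantifier over \<open>M'\<close> ranges over bimodules whose elements have the same type
  as those of \<open>N\<close>; by \<open>bimodule_dividesI\<close> below this is no restriction.\<close>

definition bimodule_divides ::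
  "('r, 'x) ring_scheme \<Rightarrow> ('s, 'y) ring_scheme \<Rightarrow>
   ('r, 's, 'm) bimodule \<Rightarrow> ('r, 's, 'n) bimodule \<Rightarrow> bool" where
  "bimodule_divides R S M N \<longleftrightarrow>
     (\<exists>M' :: ('r, 's, 'n) bimodule. bimodule R S M' \<and> bimodule_iso R S N (bimodule_sum M M'))"

lemma bimodule_dividesI:
  fixes N :: "('r, 's, 'n) bimodule" and M' :: "('r, 's, 'p) bimodule"
  assumes "abelian_group M" and "bimodule R S M'" and "bimodule_iso R S N (bimodule_sum M M')"
  shows "bimodule_divides R S M N"
proof -
  interpret M: abelian_group M by fact
  interpret M': bimodule R S M' by fact
  obtain f where f: "bij_betw f (carrier N) (carrier M \<times> carrier M')"
    and fadd: "\<forall>x \<in> carrier N. \<forall>y \<in> carrier N. f (x \<oplus>\<^bsub>N\<^esub> y) = f x \<oplus>\<^bsub>bimodule_sum M M'\<^esub> f y"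
    and fl: "\<forall>a \<in> carrier R. \<forall>x \<in> carrier N. f (a \<odot>\<^bsub>N\<^esub> x) = a \<odot>\<^bsub>bimodule_sum M M'\<^esub> f x"
    and fr: "\<forall>a \<in> carrier S. \<forall>x \<in> carrier N. f (x \<odot>r\<^bsub>N\<^esub> a) = f x \<odot>r\<^bsub>bimodule_sum M M'\<^esub> a"
    using assms(3) unfolding bimodule_iso_def by (auto simp: bimodule_sum_def)
  define h where "h y = the_inv_into (carrier N) f (\<zero>\<^bsub>M\<^esub>, y)" for y
  have fh: "f (h y) = (\<zero>\<^bsub>M\<^esub>, y)" if "y \<in> carrier M'" for y
    using that f unfolding h_def by (intro f_the_inv_into_f_bij_betw[OF f]) auto
  have inj: "inj_on h (carrier M')"
    using fh by (metis inj_onI snd_conv)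
  define g where "g = the_inv_into (carrier M') h"
  have g: "g (h x) = x" if "x \<in> carrier M'" for x
    using that inj by (simp add: g_def the_inv_into_f_f)
  define L :: "('r, 's, 'n) bimodule" where
    "L = \<lparr>carrier = h ` carrier M', monoid.mult = undefined, one = undefined, ring.zero = h \<zero>\<^bsub>M'\<^esub>,
      ring.add = (\<lambda>u v. h (g u \<oplus>\<^bsub>M'\<^esub> g v)), smult = (\<lambda>a u. h (a \<odot>\<^bsub>M'\<^esub> g u)),
      rsmult = (\<lambda>u a. h (g u \<odot>r\<^bsub>M'\<^esub> a))\<rparr>"
  have bij: "bij_betw h (carrier M') (carrier L)" using inj by (simp add: L_def bij_betw_def)
  have "abelian_group L"
    by (rule abelian_group_transport[OF M'.M.abelian_group_axioms bij]) (simp_all add: L_def g)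
  then have "left_module R L"
    by (intro left_module.intro left_module_axioms.intro M'.R.ring_axioms)
       (auto simp: L_def g M'.smult_l_distr M'.smult_r_distr M'.smult_assoc1)
  then have "bimodule R S L"
    by (intro bimodule.intro bimodule_axioms.intro M'.S.ring_axioms)
       (auto simp: L_def g M'.rsmult_closed M'.rsmult_r_distr M'.rsmult_l_distr M'.rsmult_assoc
          M'.rsmult_one M'.smult_rsmult)
  moreover have "bimodule_iso R S N (bimodule_sum M L)"
  proof -
    let ?k = "map_prod id h"
    have "bij_betw ?k (carrier M \<times> carrier M') (carrier M \<times> carrier L)"
      using bij by (intro bij_betw_map_prod) auto
    then have bk: "bij_betw (?k \<circ> f) (carrier N) (carrier (bimodule_sum M L))"
      using f by (auto simp: bimodule_sum_def intro: bij_betw_trans)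
    have fc: "fst (f x) \<in> carrier M" "snd (f x) \<in> carrier M'" if "x \<in> carrier N" for x
      using bij_betwE[OF f] that by (auto simp: mem_Times_iff)
    show ?thesis
      unfolding bimodule_iso_def
      by (rule exI[of _ "?k \<circ> f"])
         (use bk fc in \<open>auto simp: fadd fl fr bimodule_sum_def L_def g split_beta\<close>)
  qed
  ultimately show ?thesis unfolding bimodule_divides_def by blast
qed

definition H_equivalent ::
  "('r, 'x) ring_scheme \<Rightarrow> ('s, 'y) ring_scheme \<Rightarrow>
   ('r, 's, 'm) bimodule \<Rightarrow> ('r, 's, 'n) bimodule \<Rightarrow> bool" where
  "H_equivalent R S M N \<longleftrightarrow>
     (\<exists>r s. r \<ge> 1 \<and> s \<ge> 1 \<and>
        bimodule_divides R S N (bimodule_power r M) \<and>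
        bimodule_divides R S M (bimodule_power s N))"


section \<open>Depth of a subring\<close>

text \<open>The tensor product of \<open>m\<close> copies of \<open>A\<close> over the subring \<open>B\<close> is generated by the lists
  of length \<open>m\<close>, subject to additivity in each place and \<open>B\<close>-balancing between neighbours.\<close>

definition tensor_power_rels ::
  "('a, 'x) ring_scheme \<Rightarrow> 'a set \<Rightarrow> nat \<Rightarrow> ('a list \<Rightarrow>\<^sub>0 int) set" where
  "tensor_power_rels A B m =
     {frag_of (us @ [x \<oplus>\<^bsub>A\<^esub> y] @ vs) - frag_of (us @ [x] @ vs) - frag_of (us @ [y] @ vs) | us x y vs.
        set us \<subseteq> carrier A \<and> x \<in> carrier A \<and> y \<in> carrier A \<and> set vs \<subseteq> carrier A \<and>
        length us + 1 + length vs = m} \<union>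
     {frag_of (us @ [x \<otimes>\<^bsub>A\<^esub> b, y] @ vs) - frag_of (us @ [x, b \<otimes>\<^bsub>A\<^esub> y] @ vs) | us x b y vs.
        set us \<subseteq> carrier A \<and> x \<in> carrier A \<and> b \<in> B \<and> y \<in> carrier A \<and> set vs \<subseteq> carrier A \<and>
        length us + 2 + length vs = m}"

text \<open>The bimodule \<open>C\<^sub>m(A,B)\<close> for \<open>m \<ge> 1\<close>.\<close>

definition tensor_power ::
  "('a, 'x) ring_scheme \<Rightarrow> 'a set \<Rightarrow> nat \<Rightarrow> ('a, 'a, ('a list \<Rightarrow>\<^sub>0 int) set) bimodule" where
  "tensor_power A B m =
    (let G = free_Abelian_group {xs. set xs \<subseteq> carrier A \<and> length xs = m};
         H = generate G (tensor_power_rels A B m)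
     in \<lparr>carrier = rcosets\<^bsub>G\<^esub> H, monoid.mult = undefined, one = undefined,
         ring.zero = H,
         ring.add = (\<lambda>U V. U <#>\<^bsub>G\<^esub> V),
         smult = (\<lambda>a. coset_map G H (frag_extend (\<lambda>xs. frag_of ((a \<otimes>\<^bsub>A\<^esub> hd xs) # tl xs)))),
         rsmult = (\<lambda>U a. coset_map G H
            (frag_extend (\<lambda>xs. frag_of (butlast xs @ [last xs \<otimes>\<^bsub>A\<^esub> a]))) U)\<rparr>)"

text \<open>The bimodule \<open>C\<^sub>0(A,B) = B\<close>.\<close>

definition base_bimodule :: "('a, 'x) ring_scheme \<Rightarrow> 'a set \<Rightarrow> ('a, 'a, 'a) bimodule" where
  "base_bimodule A B =
     \<lparr>carrier = B, monoid.mult = monoid.mult A, one = \<one>\<^bsub>A\<^esub>, ring.zero = \<zero>\<^bsub>A\<^esub>, ring.add = ring.add A,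
      smult = monoid.mult A, rsmult = monoid.mult A\<rparr>"

text \<open>Depth \<open>2m + 1\<close>.  The case \<open>m = 0\<close> is separate only because the elements of \<open>C\<^sub>0\<close> and of
  \<open>C\<^sub>m\<close> for \<open>m \<ge> 1\<close> have different types.\<close>

definition odd_depth :: "('k, 'a) module \<Rightarrow> 'a set \<Rightarrow> nat \<Rightarrow> bool" where
  "odd_depth A B m \<longleftrightarrow>
     (if m = 0
      then H_equivalent (A\<lparr>carrier := B\<rparr>) (A\<lparr>carrier := B\<rparr>) (tensor_power A B 1) (base_bimodule A B)
      else H_equivalent (A\<lparr>carrier := B\<rparr>) (A\<lparr>carrier := B\<rparr>)
             (tensor_power A B (m + 1)) (tensor_power A B m))"

text \<open>Right and left depth \<open>2m\<close>, for \<open>m \<ge> 1\<close>.\<close>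

definition right_even_depth :: "('k, 'a) module \<Rightarrow> 'a set \<Rightarrow> nat \<Rightarrow> bool" where
  "right_even_depth A B m \<longleftrightarrow>
     H_equivalent A (A\<lparr>carrier := B\<rparr>) (tensor_power A B (m + 1)) (tensor_power A B m)"

definition left_even_depth :: "('k, 'a) module \<Rightarrow> 'a set \<Rightarrow> nat \<Rightarrow> bool" where
  "left_even_depth A B m \<longleftrightarrow>
     H_equivalent (A\<lparr>carrier := B\<rparr>) A (tensor_power A B (m + 1)) (tensor_power A B m)"

text \<open>The minimum depth \<open>d(B,A)\<close>; the infimum of the empty set in \<open>enat\<close> is \<open>\<infinity>\<close>.\<close>

definition min_depth :: "'a set \<Rightarrow> ('k, 'a) module \<Rightarrow> enat" where
  "min_depth B A =
     Inf (enat ` ({2 * m + 1 | m. odd_depth A B m} \<union>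
                  {2 * m | m. m \<ge> 1 \<and> (left_even_depth A B m \<or> right_even_depth A B m)}))"

end

(*
  Write T_m for the m-fold tensor power and n for the number of indecomposable modules over the
  relevant enveloping algebra.  Decompose T_1, ..., T_{n+1} into indecomposable modules.  The classes
  that occur in T_1, ..., T_m form an ascending chain of nonempty subsets of an n-element set, so for
  some m <= n the module T_{m+1} is a direct summand of a finite direct sum of copies of T_1, ..., T_m;
  neither uniqueness of decompositions nor T_m | T_{m+1} is needed for this.  As A-B-bimodules,
  T_1 | T_2 | ... | T_m, because insertion of 1 behind the first factor is split by multiplication.
  After restriction to A-B-bimodules (or B-B-bimodules), T_{m+1} is therefore a summand of a multiple
  of T_m and conversely.  For A^e the restriction makes up for the fact that T_1 need not divide T_2
  as an A-A-bimodule.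
*)
theory Submission
  imports Defs
begin

section \<open>Sums of composites\<close>

text \<open>Two obstacles shape the proof. First, a direct sum of modules has elements of a new type
  for each list of summands, while the modules that are compared have to share one type. Being a
  summand is therefore expressed inside the endomorphisms of M: the identity of M is a finite sum of
  composites M -> N -> M. Such an expression survives a change of scalars, since the maps remain the
  same functions; this is how a relation over an enveloping algebra becomes one over smaller rings.
  A genuine power of a bimodule is formed only at the end, where H-equivalence asks for it. Second,
  splitting into indecomposables has to stop. The number of generators over the enveloping algebra
  gives no descent, since a proper summand of a cyclic module is again cyclic. What drops is the
  number of generators over the copy of k inside the algebra, so that copy is carried along as a set
  of scalars.\<close>

definition add_hom :: "('m, 'y) ring_scheme \<Rightarrow> ('n, 'z) ring_scheme \<Rightarrow> ('m \<Rightarrow> 'n) \<Rightarrow> bool" where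
  "add_hom M N f \<longleftrightarrow> f \<in> carrier M \<rightarrow> carrier N \<and>
     (\<forall>x \<in> carrier M. \<forall>y \<in> carrier M. f (x \<oplus>\<^bsub>M\<^esub> y) = f x \<oplus>\<^bsub>N\<^esub> f y)"

definition lin_hom ::
  "('r, 'x) ring_scheme \<Rightarrow> ('r, 'm, 'y) module_scheme \<Rightarrow> ('r, 'n, 'z) module_scheme \<Rightarrow>
   ('m \<Rightarrow> 'n) \<Rightarrow> bool" where
  "lin_hom R M N f \<longleftrightarrow> add_hom M N f \<and>
     (\<forall>a \<in> carrier R. \<forall>x \<in> carrier M. f (a \<odot>\<^bsub>M\<^esub> x) = a \<odot>\<^bsub>N\<^esub> f x)"

definition bi_hom ::
  "('r, 'x) ring_scheme \<Rightarrow> ('s, 'w) ring_scheme \<Rightarrow> ('r, 's, 'm) bimodule \<Rightarrow> ('r, 's, 'n) bimodule \<Rightarrow>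
   ('m \<Rightarrow> 'n) \<Rightarrow> bool" where
  "bi_hom R S M N f \<longleftrightarrow> lin_hom R M N f \<and>
     (\<forall>a \<in> carrier S. \<forall>x \<in> carrier M. f (x \<odot>r\<^bsub>M\<^esub> a) = f x \<odot>r\<^bsub>N\<^esub> a)"

lemma add_hom_closed: "add_hom M N f \<Longrightarrow> x \<in> carrier M \<Longrightarrow> f x \<in> carrier N"
  by (auto simp: add_hom_def)

lemma add_hom_add:
  "add_hom M N f \<Longrightarrow> x \<in> carrier M \<Longrightarrow> y \<in> carrier M \<Longrightarrow> f (x \<oplus>\<^bsub>M\<^esub> y) = f x \<oplus>\<^bsub>N\<^esub> f y"
  by (auto simp: add_hom_def)

lemma add_hom_zero:
  assumes "abelian_group M" "abelian_group N" "add_hom M N f"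
  shows "f \<zero>\<^bsub>M\<^esub> = \<zero>\<^bsub>N\<^esub>"
proof -
  interpret M: abelian_group M by fact
  interpret N: abelian_group N by fact
  have "f \<zero>\<^bsub>M\<^esub> \<in> carrier N" using add_hom_closed[OF assms(3)] by simp
  moreover have "f \<zero>\<^bsub>M\<^esub> \<oplus>\<^bsub>N\<^esub> f \<zero>\<^bsub>M\<^esub> = f \<zero>\<^bsub>M\<^esub> \<oplus>\<^bsub>N\<^esub> \<zero>\<^bsub>N\<^esub>"
    using add_hom_add[OF assms(3), of "\<zero>\<^bsub>M\<^esub>" "\<zero>\<^bsub>M\<^esub>"] calculation by simp
  ultimately show ?thesis using N.add.l_cancel by blast
qed

lemma add_hom_minus:
  assumes "abelian_group M" "abelian_group N" "add_hom M N f" and x: "x \<in> carrier M"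
  shows "f (\<ominus>\<^bsub>M\<^esub> x) = \<ominus>\<^bsub>N\<^esub> f x"
proof -
  interpret M: abelian_group M by fact
  interpret N: abelian_group N by fact
  note cl = add_hom_closed[OF assms(3)]
  have "f (\<ominus>\<^bsub>M\<^esub> x) \<oplus>\<^bsub>N\<^esub> f x = \<zero>\<^bsub>N\<^esub>"
    using add_hom_add[OF assms(3), of "\<ominus>\<^bsub>M\<^esub> x" x] x add_hom_zero[OF assms(1-3)] by (simp add: M.l_neg)
  then show ?thesis using N.minus_equality cl x by (metis M.a_inv_closed)
qed

lemma add_hom_comp: "add_hom M N f \<Longrightarrow> add_hom N P g \<Longrightarrow> add_hom M P (\<lambda>x. g (f x))"
  by (auto simp: add_hom_def Pi_iff)

lemma lin_hom_comp: "lin_hom R M N f \<Longrightarrow> lin_hom R N P g \<Longrightarrow> lin_hom R M P (\<lambda>x. g (f x))"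
  by (auto simp: lin_hom_def add_hom_def Pi_iff)

lemma bi_hom_comp: "bi_hom R S M N f \<Longrightarrow> bi_hom R S N P g \<Longrightarrow> bi_hom R S M P (\<lambda>x. g (f x))"
  by (auto simp: bi_hom_def lin_hom_def add_hom_def Pi_iff)

lemma bi_hom_mono:
  "bi_hom R S M N f \<Longrightarrow> carrier R' \<subseteq> carrier R \<Longrightarrow> carrier S' \<subseteq> carrier S \<Longrightarrow> bi_hom R' S' M N f"
  by (auto simp: bi_hom_def lin_hom_def)

text \<open>These are the endomorphisms of M that factor through a finite direct sum of members of
  \<open>NN\<close>. The morphism predicate \<open>H\<close> is a parameter, so that one notion
  serves linear maps as well as bimodule maps.\<close>

inductive comp_sum ::
  "(('m, 'y) ring_scheme \<Rightarrow> ('m, 'y) ring_scheme \<Rightarrow> ('m \<Rightarrow> 'm) \<Rightarrow> bool) \<Rightarrow> ('m, 'y) ring_scheme \<Rightarrow>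
   ('m, 'y) ring_scheme set \<Rightarrow> ('m \<Rightarrow> 'm) \<Rightarrow> bool"
  for H M NN where
  zero: "comp_sum H M NN (\<lambda>x. \<zero>\<^bsub>M\<^esub>)"
| step: "comp_sum H M NN u \<Longrightarrow> N \<in> NN \<Longrightarrow> H M N f \<Longrightarrow> H N M g \<Longrightarrow>
    comp_sum H M NN (\<lambda>x. u x \<oplus>\<^bsub>M\<^esub> g (f x))"

text \<open>\<open>in_add H M NN\<close> says that \<open>M\<close> is a direct summand of a finite direct sum of members of \<open>NN\<close>;
  the direct sum itself, whose elements would have another type, is avoided.\<close>

definition in_add ::
  "(('m, 'y) ring_scheme \<Rightarrow> ('m, 'y) ring_scheme \<Rightarrow> ('m \<Rightarrow> 'm) \<Rightarrow> bool) \<Rightarrow> ('m, 'y) ring_scheme \<Rightarrow>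
   ('m, 'y) ring_scheme set \<Rightarrow> bool" where
  "in_add H M NN \<longleftrightarrow> (\<exists>u. comp_sum H M NN u \<and> (\<forall>x \<in> carrier M. u x = x))"

text \<open>An interface that lets the calculus of summands be proved once and then used for left
  modules with \<open>lin_hom\<close> and for bimodules with \<open>bi_hom\<close>.\<close>

locale additive_homs =
  fixes Ob :: "('m, 'y) ring_scheme \<Rightarrow> bool"
    and H :: "('m, 'y) ring_scheme \<Rightarrow> ('m, 'y) ring_scheme \<Rightarrow> ('m \<Rightarrow> 'm) \<Rightarrow> bool"
  assumes ob: "Ob M \<Longrightarrow> abelian_group M"
    and hom_add: "H M N f \<Longrightarrow> add_hom M N f"
    and hom_comp: "H M N f \<Longrightarrow> H N P g \<Longrightarrow> H M P (\<lambda>x. g (f x))"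
begin

lemma hom_closed: "H M N f \<Longrightarrow> x \<in> carrier M \<Longrightarrow> f x \<in> carrier N"
  by (rule add_hom_closed[OF hom_add])

lemma comp_sum_closed:
  assumes "Ob M" "comp_sum H M NN u" "x \<in> carrier M"
  shows "u x \<in> carrier M"
proof -
  interpret M: abelian_group M using ob assms(1) .
  show ?thesis using assms(2)
  proof induction
    case (step u N f g)
    then show ?case using hom_closed[OF step(4) hom_closed[OF step(3) assms(3)]] by simp
  qed simp
qed

lemma comp_sum_add:
  assumes "Ob M" "comp_sum H M NN u" "comp_sum H M NN v"
  shows "\<exists>w. comp_sum H M NN w \<and> (\<forall>x \<in> carrier M. w x = u x \<oplus>\<^bsub>M\<^esub> v x)"
proof -
  interpret M: abelian_group M using ob assms(1) .
  show ?thesis using assms(3)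
  proof induction
    case zero
    then show ?case using assms(2) comp_sum_closed[OF assms(1,2)] by (intro exI[of _ u]) simp
  next
    case (step v N f g)
    then obtain w where w: "comp_sum H M NN w" "\<forall>x\<in>carrier M. w x = u x \<oplus>\<^bsub>M\<^esub> v x" by auto
    show ?case
    proof (intro exI conjI ballI)
      show "comp_sum H M NN (\<lambda>x. w x \<oplus>\<^bsub>M\<^esub> g (f x))" using comp_sum.step[OF w(1)] step by blast
      fix x assume x: "x \<in> carrier M"
      have "u x \<in> carrier M" "v x \<in> carrier M" "g (f x) \<in> carrier M"
        using comp_sum_closed[OF assms(1,2) x] comp_sum_closed[OF assms(1) step(1) x]
          hom_closed[OF step(4) hom_closed[OF step(3) x]] by auto
      then show "w x \<oplus>\<^bsub>M\<^esub> g (f x) = u x \<oplus>\<^bsub>M\<^esub> (v x \<oplus>\<^bsub>M\<^esub> g (f x))"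
        using w x by (simp add: M.a_assoc)
    qed
  qed
qed

text \<open>The outer maps are absorbed: a composite N -> P -> N becomes M -> N -> P -> N -> M,
  whose two halves are morphisms M -> P and P -> M.\<close>

lemma comp_sum_conj:
  assumes M: "Ob M" and N: "Ob N" and f: "H M N f" and g: "H N M g" and "comp_sum H N PP v"
  shows "\<exists>w. comp_sum H M PP w \<and> (\<forall>x \<in> carrier M. w x = g (v (f x)))"
  using assms(5)
proof induction
  case zero
  then show ?case using comp_sum.zero[of H M PP] add_hom_zero[OF ob[OF N] ob[OF M] hom_add[OF g]] by metis
next
  case (step v P p q)
  then obtain w where w: "comp_sum H M PP w" "\<forall>x\<in>carrier M. w x = g (v (f x))" by auto
  show ?case
  proof (intro exI conjI ballI)
    show "comp_sum H M PP (\<lambda>x. w x \<oplus>\<^bsub>M\<^esub> g (q (p (f x))))"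
      by (rule comp_sum.step[OF w(1) step(2)]) (rule hom_comp[OF f step(3)] hom_comp[OF step(4) g])+
    fix x assume x: "x \<in> carrier M"
    have fx: "f x \<in> carrier N" by (rule hom_closed[OF f x])
    moreover have "v (f x) \<in> carrier N" by (rule comp_sum_closed[OF N step(1) fx])
    moreover have "q (p (f x)) \<in> carrier N" by (rule hom_closed[OF step(4) hom_closed[OF step(3) fx]])
    ultimately show "w x \<oplus>\<^bsub>M\<^esub> g (q (p (f x))) = g (v (f x) \<oplus>\<^bsub>N\<^esub> q (p (f x)))"
      using add_hom_add[OF hom_add[OF g]] w(2) x by simp
  qed
qed

text \<open>In each composite \<open>g (f x)\<close> of the sum that gives the identity of M, the
  identity of the middle module N is inserted and replaced by its own sum through
  \<open>PP\<close>.\<close>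

lemma in_add_trans:
  assumes M: "Ob M" and NN: "\<And>N. N \<in> NN \<Longrightarrow> Ob N" and MN: "in_add H M NN"
    and NP: "\<And>N. N \<in> NN \<Longrightarrow> in_add H N PP"
  shows "in_add H M PP"
proof -
  obtain u where u: "comp_sum H M NN u" "\<forall>x \<in> carrier M. u x = x" using MN by (auto simp: in_add_def)
  have "\<exists>w. comp_sum H M PP w \<and> (\<forall>x \<in> carrier M. w x = u x)" using u(1)
  proof induction
    case zero
    then show ?case using comp_sum.zero by blast
  next
    case (step u N f g)
    then obtain w where w: "comp_sum H M PP w" "\<forall>x\<in>carrier M. w x = u x" by auto
    obtain v where v: "comp_sum H N PP v" "\<forall>x \<in> carrier N. v x = x"
      using NP step(2) by (auto simp: in_add_def)
    obtain z where z: "comp_sum H M PP z" "\<forall>x \<in> carrier M. z x = g (v (f x))"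
      using comp_sum_conj[OF M NN[OF step(2)] step(3,4) v(1)] by blast
    obtain y where y: "comp_sum H M PP y" "\<forall>x \<in> carrier M. y x = w x \<oplus>\<^bsub>M\<^esub> z x"
      using comp_sum_add[OF M w(1) z(1)] by blast
    have "g (v (f x)) = g (f x)" if "x \<in> carrier M" for x
      using v(2) hom_closed[OF step(3) that] by simp
    then show ?case using y w z by auto
  qed
  then show ?thesis using u(2) by (auto simp: in_add_def)
qed

lemma in_add_retract:
  assumes "Ob M" "N \<in> NN" "H M N f" "H N M g" "\<And>x. x \<in> carrier M \<Longrightarrow> g (f x) = x"
  shows "in_add H M NN"
proof -
  interpret M: abelian_group M using ob assms(1) .
  have "comp_sum H M NN (\<lambda>x. \<zero>\<^bsub>M\<^esub> \<oplus>\<^bsub>M\<^esub> g (f x))"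
    by (rule comp_sum.step[OF comp_sum.zero assms(2-4)])
  then show ?thesis unfolding in_add_def using assms(5) by force
qed

end

text \<open>The very same function is kept; only the category in which its pieces are morphisms
  changes. This one rule covers the passage from modules over the enveloping algebra to bimodules,
  the restriction of scalars, and the enlargement of \<open>NN\<close>.\<close>

lemma in_add_map:
  assumes "in_add H M' NN'" and "carrier M' = carrier M" "ring.add M' = ring.add M" "ring.zero M' = ring.zero M"
    and "\<And>N'. N' \<in> NN' \<Longrightarrow> \<exists>N \<in> NN. (\<forall>f. H M' N' f \<longrightarrow> L M N f) \<and> (\<forall>f. H N' M' f \<longrightarrow> L N M f)"
  shows "in_add L M NN"
proof -
  obtain u where u: "comp_sum H M' NN' u" "\<forall>x \<in> carrier M. u x = x"
    using assms(1,2) by (auto simp: in_add_def)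
  have "comp_sum L M NN u" using u(1)
  proof induction
    case zero
    then show ?case using comp_sum.zero[of L M NN] assms(4) by simp
  next
    case (step u N' f g)
    then obtain N where "N \<in> NN" "L M N f" "L N M g" using assms(5)[of N'] by metis
    then show ?case using comp_sum.step[of L M NN u] step assms(3) by simp
  qed
  then show ?thesis using u(2) by (auto simp: in_add_def)
qed

lemma in_add_mono: "in_add H M NN \<Longrightarrow> NN \<subseteq> PP \<Longrightarrow> in_add H M PP"
  by (rule in_add_map[where H = H and NN' = NN]) auto

lemma additive_homs_lin: "additive_homs (left_module R) (lin_hom R)"
proof (rule additive_homs.intro)
  show "lin_hom R M P (\<lambda>x. g (f x))" if "lin_hom R M N f" "lin_hom R N P g" for M N P f g
    using that by (rule lin_hom_comp)
qed (simp_all add: left_module_def lin_hom_def)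

lemma additive_homs_bi: "additive_homs (bimodule R S) (bi_hom R S)"
proof (rule additive_homs.intro)
  show "bi_hom R S M P (\<lambda>x. g (f x))" if "bi_hom R S M N f" "bi_hom R S N P g" for M N P f g
    using that by (rule bi_hom_comp)
qed (simp_all add: bimodule_def left_module_def bi_hom_def lin_hom_def)

section \<open>Decomposition into indecomposable modules\<close>

context left_module
begin

lemma smult_l_zero [simp]: "x \<in> carrier M \<Longrightarrow> \<zero> \<odot>\<^bsub>M\<^esub> x = \<zero>\<^bsub>M\<^esub>"
  using smult_l_distr[of \<zero> \<zero> x] by (metis M.add.l_cancel_one R.add.l_one R.zero_closed smult_closed)

lemma smult_r_zero [simp]: "a \<in> carrier R \<Longrightarrow> a \<odot>\<^bsub>M\<^esub> \<zero>\<^bsub>M\<^esub> = \<zero>\<^bsub>M\<^esub>"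
  using smult_r_distr[of a "\<zero>\<^bsub>M\<^esub>" "\<zero>\<^bsub>M\<^esub>"]
  by (metis M.add.l_cancel_one M.add.l_one M.zero_closed smult_closed)

lemma smult_l_minus: "a \<in> carrier R \<Longrightarrow> x \<in> carrier M \<Longrightarrow> (\<ominus> a) \<odot>\<^bsub>M\<^esub> x = \<ominus>\<^bsub>M\<^esub> (a \<odot>\<^bsub>M\<^esub> x)"
  using smult_l_distr[of "\<ominus> a" a x] by (simp add: R.l_neg M.minus_equality)

lemma finsum_smult:
  assumes "finite S" "a \<in> carrier R" "f \<in> S \<rightarrow> carrier M"
  shows "a \<odot>\<^bsub>M\<^esub> (\<Oplus>\<^bsub>M\<^esub>s\<in>S. f s) = (\<Oplus>\<^bsub>M\<^esub>s\<in>S. a \<odot>\<^bsub>M\<^esub> f s)"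
  using assms(1,3)
proof (induction S)
  case empty
  then show ?case using assms(2) by simp
next
  case (insert s S)
  then have "(\<lambda>s. a \<odot>\<^bsub>M\<^esub> f s) \<in> S \<rightarrow> carrier M" "f \<in> S \<rightarrow> carrier M" "f s \<in> carrier M"
    using assms(2) by auto
  with insert show ?case using assms(2) by (simp add: smult_r_distr)
qed

lemma submoduleI:
  assumes "U \<subseteq> carrier M" "\<zero>\<^bsub>M\<^esub> \<in> U" "\<And>x y. x \<in> U \<Longrightarrow> y \<in> U \<Longrightarrow> x \<oplus>\<^bsub>M\<^esub> y \<in> U"
    "\<And>a x. a \<in> carrier R \<Longrightarrow> x \<in> U \<Longrightarrow> a \<odot>\<^bsub>M\<^esub> x \<in> U"
  shows "submodule U R M"
proof -
  \<comment> \<open>Closure under negation comes from multiplication by -1.\<close>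
  have "inv\<^bsub>add_monoid M\<^esub> x \<in> U" if "x \<in> U" for x
  proof -
    have "x \<in> carrier M" using assms(1) that by auto
    then have "(\<ominus> \<one>) \<odot>\<^bsub>M\<^esub> x = inv\<^bsub>add_monoid M\<^esub> x" using smult_l_minus[of \<one> x] by (simp add: a_inv_def[of M])
    then show ?thesis using assms(4)[of "\<ominus> \<one>" x] that by simp
  qed
  then show ?thesis
    using assms by (intro submodule.intro subgroup.intro submodule_axioms.intro) auto
qed

lemma submoduleD:
  assumes "submodule U R M"
  shows "U \<subseteq> carrier M" "\<zero>\<^bsub>M\<^esub> \<in> U" "x \<in> U \<Longrightarrow> y \<in> U \<Longrightarrow> x \<oplus>\<^bsub>M\<^esub> y \<in> U"
    "x \<in> U \<Longrightarrow> \<ominus>\<^bsub>M\<^esub> x \<in> U" "a \<in> carrier R \<Longrightarrow> x \<in> U \<Longrightarrow> a \<odot>\<^bsub>M\<^esub> x \<in> U"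
proof -
  interpret submodule U R M by fact
  show "U \<subseteq> carrier M" "\<zero>\<^bsub>M\<^esub> \<in> U" "x \<in> U \<Longrightarrow> y \<in> U \<Longrightarrow> x \<oplus>\<^bsub>M\<^esub> y \<in> U"
    "x \<in> U \<Longrightarrow> \<ominus>\<^bsub>M\<^esub> x \<in> U" "a \<in> carrier R \<Longrightarrow> x \<in> U \<Longrightarrow> a \<odot>\<^bsub>M\<^esub> x \<in> U"
    using subset one_closed m_closed m_inv_closed smult_closed by (auto simp: a_inv_def)
qed

text \<open>A submodule is M with a smaller carrier and so keeps the type of M; decompositions never
  leave that type.\<close>

lemma submodule_left_module:
  assumes "submodule U R M"
  shows "left_module R (M\<lparr>carrier := U\<rparr>)"
proof -
  note U = submoduleD[OF assms]
  have "abelian_group (M\<lparr>carrier := U\<rparr>)"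
  proof (rule abelian_groupI)
    fix x assume "x \<in> carrier (M\<lparr>carrier := U\<rparr>)"
    then show "\<exists>y\<in>carrier (M\<lparr>carrier := U\<rparr>). y \<oplus>\<^bsub>M\<lparr>carrier := U\<rparr>\<^esub> x = \<zero>\<^bsub>M\<lparr>carrier := U\<rparr>\<^esub>"
      using U(1,4) M.l_neg by (intro bexI[of _ "\<ominus>\<^bsub>M\<^esub> x"]) auto
  qed (use U in \<open>auto intro: M.a_assoc M.a_comm subsetD[OF U(1)]\<close>)
  then show ?thesis
    using U by (intro left_module.intro left_module_axioms.intro R.ring_axioms)
      (auto simp: subset_iff smult_l_distr smult_r_distr smult_assoc1)
qed

end

text \<open>The span is taken over a set \<open>F\<close> of scalars only, which will be a copy of the ground field.\<close>

inductive_set fspan :: "'r set \<Rightarrow> ('r, 'm, 'y) module_scheme \<Rightarrow> 'm set \<Rightarrow> 'm set" for F M S where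
  zero: "\<zero>\<^bsub>M\<^esub> \<in> fspan F M S"
| gen: "s \<in> S \<Longrightarrow> s \<in> fspan F M S"
| add: "x \<in> fspan F M S \<Longrightarrow> y \<in> fspan F M S \<Longrightarrow> x \<oplus>\<^bsub>M\<^esub> y \<in> fspan F M S"
| smult: "c \<in> F \<Longrightarrow> x \<in> fspan F M S \<Longrightarrow> c \<odot>\<^bsub>M\<^esub> x \<in> fspan F M S"

text \<open>A division ring inside R, or {0} if R is the zero ring: the unit may equal zero, because
  the copy of K in an enveloping algebra collapses when that algebra is zero.\<close>

definition division_subset :: "('r, 'x) ring_scheme \<Rightarrow> 'r set \<Rightarrow> bool" where
  "division_subset R F \<longleftrightarrow> F \<subseteq> carrier R \<and> \<zero>\<^bsub>R\<^esub> \<in> F \<and> \<one>\<^bsub>R\<^esub> \<in> F \<and>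
     (\<forall>a\<in>F. \<forall>b\<in>F. a \<oplus>\<^bsub>R\<^esub> b \<in> F \<and> a \<otimes>\<^bsub>R\<^esub> b \<in> F) \<and> (\<forall>a\<in>F. \<ominus>\<^bsub>R\<^esub> a \<in> F) \<and>
     (\<forall>a\<in>F. a \<noteq> \<zero>\<^bsub>R\<^esub> \<longrightarrow> (\<exists>b\<in>F. b \<otimes>\<^bsub>R\<^esub> a = \<one>\<^bsub>R\<^esub>))"

lemma fspan_least:
  assumes "x \<in> fspan F M S" "S \<subseteq> fspan F M T"
  shows "x \<in> fspan F M T"
  using assms(1) by induction (use assms(2) in \<open>auto intro: fspan.intros\<close>)

lemma fspan_mono: "S \<subseteq> T \<Longrightarrow> fspan F M S \<subseteq> fspan F M T"
  using fspan_least fspan.gen by (metis subset_iff)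

lemma (in left_module) fspan_closed:
  assumes "x \<in> fspan F M S" "S \<subseteq> carrier M" "F \<subseteq> carrier R"
  shows "x \<in> carrier M"
  using assms(1) by induction (use assms in auto)

lemma fspan_image:
  assumes M: "left_module R M" and N: "left_module R N" and h: "lin_hom R M N h"
    and F: "F \<subseteq> carrier R" and S: "S \<subseteq> carrier M" and x: "x \<in> fspan F M S"
  shows "h x \<in> fspan F N (h ` S)"
proof -
  interpret M: left_module R M by fact
  interpret N: left_module R N by fact
  have h': "add_hom M N h" using h by (simp add: lin_hom_def)
  show ?thesis using x
  proof induction
    case zero
    then show ?case
      using add_hom_zero[OF M.M.abelian_group_axioms N.M.abelian_group_axioms h'] fspan.zero by metis
  next
    case (add x y)
    then show ?case using M.fspan_closed[OF _ S F] add_hom_add[OF h'] by (metis fspan.add)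
  next
    case (smult c x)
    moreover have "h (c \<odot>\<^bsub>M\<^esub> x) = c \<odot>\<^bsub>N\<^esub> h x"
      using smult M.fspan_closed[OF _ S F] F h by (auto simp: lin_hom_def)
    ultimately show ?case by (metis fspan.smult)
  qed (auto intro: fspan.gen)
qed

text \<open>Sums and products of elements of F stay in F, so all multiples of \<open>s\<close> that
  occur in x collect into a single one.\<close>

lemma (in left_module) fspan_insertE:
  assumes "x \<in> fspan F M (insert s T)" and s: "s \<in> carrier M" and T: "T \<subseteq> carrier M"
    and F: "division_subset R F"
  shows "\<exists>c \<in> F. \<exists>w \<in> fspan F M T. x = c \<odot>\<^bsub>M\<^esub> s \<oplus>\<^bsub>M\<^esub> w"
  using assms(1)
proof induction
  case zero
  show ?case using F s fspan.zero[of M F T] by (intro bexI[of _ \<zero>] bexI[of _ "\<zero>\<^bsub>M\<^esub>"]) (auto simp: division_subset_def)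
next
  case (gen t)
  show ?case
  proof (cases "t = s")
    case True
    then show ?thesis using F s fspan.zero[of M F T]
      by (intro bexI[of _ \<one>] bexI[of _ "\<zero>\<^bsub>M\<^esub>"]) (auto simp: division_subset_def)
  next
    case False
    then have "t \<in> T" using gen by simp
    then show ?thesis using F s T fspan.gen[of t T F M]
      by (intro bexI[of _ \<zero>] bexI[of _ t]) (auto simp: division_subset_def)
  qed
next
  case (add x y)
  then obtain c d v w where cd: "c \<in> F" "d \<in> F" "v \<in> fspan F M T" "w \<in> fspan F M T"
    "x = c \<odot>\<^bsub>M\<^esub> s \<oplus>\<^bsub>M\<^esub> v" "y = d \<odot>\<^bsub>M\<^esub> s \<oplus>\<^bsub>M\<^esub> w" by blast
  have "c \<in> carrier R" "d \<in> carrier R" "v \<in> carrier M" "w \<in> carrier M"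
    using cd F T fspan_closed by (auto simp: division_subset_def)
  then have "x \<oplus>\<^bsub>M\<^esub> y = (c \<oplus> d) \<odot>\<^bsub>M\<^esub> s \<oplus>\<^bsub>M\<^esub> (v \<oplus>\<^bsub>M\<^esub> w)"
    using cd s by (simp add: smult_l_distr M.a_ac)
  then show ?case using cd F fspan.add[of v F M T w] by (auto simp: division_subset_def)
next
  case (smult d x)
  then obtain c v where cd: "c \<in> F" "v \<in> fspan F M T" "x = c \<odot>\<^bsub>M\<^esub> s \<oplus>\<^bsub>M\<^esub> v" by blast
  have "c \<in> carrier R" "d \<in> carrier R" "v \<in> carrier M"
    using cd F T fspan_closed smult by (auto simp: division_subset_def)
  then have "d \<odot>\<^bsub>M\<^esub> x = (d \<otimes> c) \<odot>\<^bsub>M\<^esub> s \<oplus>\<^bsub>M\<^esub> d \<odot>\<^bsub>M\<^esub> v"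
    using cd s by (simp add: smult_r_distr smult_assoc1)
  then show ?case using cd F smult fspan.smult[of d F v M T] by (auto simp: division_subset_def)
qed

text \<open>Replaces a dimension count: passing to a proper direct summand lowers the number of generators.\<close>

lemma fspan_drop:
  assumes M: "left_module R M" and N: "left_module R N" and p: "lin_hom R M N p"
    and F: "division_subset R F"
    and "finite S" "S \<subseteq> carrier M" "v \<in> fspan F M S" "v \<noteq> \<zero>\<^bsub>M\<^esub>" "p v = \<zero>\<^bsub>N\<^esub>"
  shows "\<exists>s \<in> S. p s \<in> fspan F N (p ` (S - {s}))"
  using assms(5-)
proof (induction S)
  case empty
  interpret M: left_module R M by fact
  \<comment> \<open>The span of the empty set is zero, which contradicts the choice of v.\<close>
  have "v = \<zero>\<^bsub>M\<^esub>" using empty(2)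
    by induction (use F in \<open>auto simp: division_subset_def subset_iff\<close>)
  then show ?case using empty by simp
next
  case (insert s T)
  interpret M: left_module R M by fact
  interpret N: left_module R N by fact
  have FR: "F \<subseteq> carrier R" using F by (simp add: division_subset_def)
  have sT: "s \<in> carrier M" "T \<subseteq> carrier M" using insert by auto
  obtain c w where cw: "c \<in> F" "w \<in> fspan F M T" "v = c \<odot>\<^bsub>M\<^esub> s \<oplus>\<^bsub>M\<^esub> w"
    using M.fspan_insertE[OF insert(5) sT F] by blast
  have w: "w \<in> carrier M" using M.fspan_closed[OF cw(2) sT(2) FR] .
  show ?case
  proof (cases "c = \<zero>\<^bsub>R\<^esub>")
    \<comment> \<open>The generator \<open>s\<close> does not enter v, so the induction hypothesis
      for T supplies the redundant generator.\<close>
    case True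
    then have "v = w" using cw w sT by simp
    then obtain t where t: "t \<in> T" "p t \<in> fspan F N (p ` (T - {t}))"
      using insert.IH[OF sT(2)] insert cw by auto
    then have "p t \<in> fspan F N (p ` (insert s T - {t}))"
      using fspan_mono[of "p ` (T - {t})" "p ` (insert s T - {t})" F N] by blast
    then show ?thesis using t by blast
  next
    case False
    \<comment> \<open>Now c is invertible in F. Applying p to v = c s + w gives p s = d (- p w),
      which lies in the span of the images of T.\<close>
    then obtain d where d: "d \<in> F" "d \<otimes>\<^bsub>R\<^esub> c = \<one>\<^bsub>R\<^esub>" using F cw(1) by (auto simp: division_subset_def)
    have cd: "c \<in> carrier R" "d \<in> carrier R" using FR cw(1) d(1) by auto
    have pc: "p x \<in> carrier N" if "x \<in> carrier M" for x
      using p that add_hom_closed by (auto simp: lin_hom_def)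
    have ps: "p (a \<odot>\<^bsub>M\<^esub> x) = a \<odot>\<^bsub>N\<^esub> p x" if "a \<in> carrier R" "x \<in> carrier M" for a x
      using p that by (auto simp: lin_hom_def)
    have "\<zero>\<^bsub>N\<^esub> = c \<odot>\<^bsub>N\<^esub> p s \<oplus>\<^bsub>N\<^esub> p w"
      using insert(7) cw(3) w sT cd p ps by (simp add: lin_hom_def add_hom_def)
    then have "\<ominus>\<^bsub>N\<^esub> (p w) = c \<odot>\<^bsub>N\<^esub> p s"
      using w sT cd pc N.M.minus_equality by (metis N.smult_closed)
    then have "d \<odot>\<^bsub>N\<^esub> (\<ominus>\<^bsub>N\<^esub> (p w)) = p s"
      using d cd sT pc by (metis N.smult_assoc1 N.smult_one)
    moreover have "\<ominus>\<^bsub>N\<^esub> (p w) = (\<ominus>\<^bsub>R\<^esub> \<one>\<^bsub>R\<^esub>) \<odot>\<^bsub>N\<^esub> p w"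
      using w pc by (simp add: N.smult_l_minus)
    moreover have "p w \<in> fspan F N (p ` T)" using fspan_image[OF M N p FR sT(2) cw(2)] .
    moreover have "\<ominus>\<^bsub>R\<^esub> \<one>\<^bsub>R\<^esub> \<in> F" using F by (auto simp: division_subset_def)
    ultimately have "p s \<in> fspan F N (p ` T)" using d(1) by (metis fspan.smult)
    moreover have "insert s T - {s} = T" using insert(2) by auto
    ultimately show ?thesis by auto
  qed
qed

text \<open>Finite dimension over F, the measure for decompositions. Finite generation over R gives
  no such measure: a proper summand of a module with one generator may still need one.\<close>

definition fspanned :: "('r, 'x) ring_scheme \<Rightarrow> 'r set \<Rightarrow> ('r, 'm, 'y) module_scheme \<Rightarrow> bool" where
  "fspanned R F M \<longleftrightarrow>
     left_module R M \<and> (\<exists>S. finite S \<and> S \<subseteq> carrier M \<and> carrier M \<subseteq> fspan F M S)"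

text \<open>The inductive span is rewritten as sums over the fixed finite set S with coefficients,
  the form that \<open>fin_gen\<close>, and hence \<open>fin_gen_representable\<close>,
  requires.\<close>

lemma fspanned_fin_gen:
  assumes "fspanned R F M" and F: "division_subset R F"
  shows "fin_gen R M"
proof -
  interpret left_module R M using assms by (simp add: fspanned_def)
  obtain S where S: "finite S" "S \<subseteq> carrier M" "carrier M \<subseteq> fspan F M S"
    using assms by (auto simp: fspanned_def)
  have "\<exists>c \<in> S \<rightarrow> carrier R. x = (\<Oplus>\<^bsub>M\<^esub>s\<in>S. c s \<odot>\<^bsub>M\<^esub> s)" if "x \<in> fspan F M S" for x
    using that
  proof induction
    case zero
    have "(\<Oplus>\<^bsub>M\<^esub>s\<in>S. \<zero>\<^bsub>R\<^esub> \<odot>\<^bsub>M\<^esub> s) = (\<Oplus>\<^bsub>M\<^esub>s\<in>S. \<zero>\<^bsub>M\<^esub>)" using S by (intro M.finsum_cong') auto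
    then show ?case by (intro bexI[of _ "\<lambda>_. \<zero>\<^bsub>R\<^esub>"]) auto
  next
    case (gen s)
    have "(\<Oplus>\<^bsub>M\<^esub>t\<in>S. (if s = t then \<one>\<^bsub>R\<^esub> else \<zero>\<^bsub>R\<^esub>) \<odot>\<^bsub>M\<^esub> t) = (\<Oplus>\<^bsub>M\<^esub>t\<in>S. if s = t then t else \<zero>\<^bsub>M\<^esub>)"
      using S by (intro M.finsum_cong') auto
    also have "\<dots> = s" using S gen by (intro M.add.finprod_singleton) auto
    finally show ?case by (intro bexI[of _ "\<lambda>t. if s = t then \<one>\<^bsub>R\<^esub> else \<zero>\<^bsub>R\<^esub>"]) auto
  next
    case (add x y)
    then obtain c d where cd: "c \<in> S \<rightarrow> carrier R" "d \<in> S \<rightarrow> carrier R"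
      "x = (\<Oplus>\<^bsub>M\<^esub>s\<in>S. c s \<odot>\<^bsub>M\<^esub> s)" "y = (\<Oplus>\<^bsub>M\<^esub>s\<in>S. d s \<odot>\<^bsub>M\<^esub> s)" by blast
    have "x \<oplus>\<^bsub>M\<^esub> y = (\<Oplus>\<^bsub>M\<^esub>s\<in>S. c s \<odot>\<^bsub>M\<^esub> s \<oplus>\<^bsub>M\<^esub> d s \<odot>\<^bsub>M\<^esub> s)"
      unfolding cd by (rule M.finsum_addf[symmetric]) (use cd S in auto)
    also have "\<dots> = (\<Oplus>\<^bsub>M\<^esub>s\<in>S. (c s \<oplus>\<^bsub>R\<^esub> d s) \<odot>\<^bsub>M\<^esub> s)"
      using S cd by (intro M.finsum_cong') (auto simp: smult_l_distr Pi_iff subset_iff)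
    finally show ?case using cd by (intro bexI[of _ "\<lambda>s. c s \<oplus>\<^bsub>R\<^esub> d s"]) auto
  next
    case (smult a x)
    then obtain c where c: "c \<in> S \<rightarrow> carrier R" "x = (\<Oplus>\<^bsub>M\<^esub>s\<in>S. c s \<odot>\<^bsub>M\<^esub> s)" by blast
    have a: "a \<in> carrier R" using smult F by (auto simp: division_subset_def)
    have "a \<odot>\<^bsub>M\<^esub> x = (\<Oplus>\<^bsub>M\<^esub>s\<in>S. a \<odot>\<^bsub>M\<^esub> (c s \<odot>\<^bsub>M\<^esub> s))"
      unfolding c using S a c by (intro finsum_smult) auto
    also have "\<dots> = (\<Oplus>\<^bsub>M\<^esub>s\<in>S. (a \<otimes>\<^bsub>R\<^esub> c s) \<odot>\<^bsub>M\<^esub> s)"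
      using S c a by (intro M.finsum_cong') (auto simp: smult_assoc1 Pi_iff subset_iff)
    finally show ?case using c a by (intro bexI[of _ "\<lambda>s. a \<otimes>\<^bsub>R\<^esub> c s"]) auto
  qed
  then show ?thesis using S unfolding fin_gen_def by blast
qed

section \<open>Isomorphisms of left modules\<close>

lemma module_iso_iff: "module_iso R M N \<longleftrightarrow> (\<exists>h. lin_hom R M N h \<and> bij_betw h (carrier M) (carrier N))"
  by (auto simp: module_iso_def lin_hom_def add_hom_def dest: bij_betwE)

lemma lin_hom_inv:
  assumes M: "left_module R M" and h: "lin_hom R M N h" and bij: "bij_betw h (carrier M) (carrier N)"
  shows "lin_hom R N M (the_inv_into (carrier M) h)"
    "bij_betw (the_inv_into (carrier M) h) (carrier N) (carrier M)"
proof -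
  interpret M: left_module R M by fact
  let ?g = "the_inv_into (carrier M) h"
  show b: "bij_betw ?g (carrier N) (carrier M)" using bij by (rule bij_betw_the_inv_into)
  have inj: "inj_on h (carrier M)" using bij by (simp add: bij_betw_def)
  have gh: "?g (h x) = x" if "x \<in> carrier M" for x using that inj by (simp add: the_inv_into_f_f)
  have N: "\<exists>x \<in> carrier M. y = h x" if "y \<in> carrier N" for y using that bij by (auto simp: bij_betw_def)
  have "?g (x \<oplus>\<^bsub>N\<^esub> y) = ?g x \<oplus>\<^bsub>M\<^esub> ?g y" if xy: "x \<in> carrier N" "y \<in> carrier N" for x y
  proof -
    obtain u v where "u \<in> carrier M" "v \<in> carrier M" "x = h u" "y = h v" using N[OF xy(1)] N[OF xy(2)] by blast
    then show ?thesis using h gh[of "u \<oplus>\<^bsub>M\<^esub> v"] gh by (simp add: lin_hom_def add_hom_def)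
  qed
  moreover have "?g (a \<odot>\<^bsub>N\<^esub> x) = a \<odot>\<^bsub>M\<^esub> ?g x" if xy: "x \<in> carrier N" "a \<in> carrier R" for x a
  proof -
    obtain u where "u \<in> carrier M" "x = h u" using N[OF xy(1)] by blast
    then show ?thesis using h gh[of "a \<odot>\<^bsub>M\<^esub> u"] gh xy by (simp add: lin_hom_def)
  qed
  ultimately show "lin_hom R N M ?g" using b by (auto simp: lin_hom_def add_hom_def dest: bij_betwE)
qed

lemma module_iso_sym:
  assumes "left_module R M" "module_iso R M N"
  shows "module_iso R N M"
proof -
  obtain h where "lin_hom R M N h" "bij_betw h (carrier M) (carrier N)"
    using assms(2) by (auto simp: module_iso_iff)
  from lin_hom_inv[OF assms(1) this] show ?thesis by (auto simp: module_iso_iff)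
qed

lemma module_iso_trans:
  assumes "module_iso R M N" "module_iso R N P"
  shows "module_iso R M P"
proof -
  obtain h where h: "lin_hom R M N h" "bij_betw h (carrier M) (carrier N)"
    using assms(1) by (auto simp: module_iso_iff)
  obtain k where k: "lin_hom R N P k" "bij_betw k (carrier N) (carrier P)"
    using assms(2) by (auto simp: module_iso_iff)
  have "bij_betw (\<lambda>x. k (h x)) (carrier M) (carrier P)"
    using bij_betw_trans[OF h(2) k(2)] by (simp add: comp_def)
  then show ?thesis using lin_hom_comp[OF h(1) k(1)] unfolding module_iso_iff by blast
qed

lemma fspanned_iso:
  assumes "fspanned R F M" "left_module R N" "module_iso R M N" "F \<subseteq> carrier R"
  shows "fspanned R F N"
proof -
  obtain S where S: "finite S" "S \<subseteq> carrier M" "carrier M \<subseteq> fspan F M S" and M: "left_module R M"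
    using assms by (auto simp: fspanned_def)
  obtain h where h: "lin_hom R M N h" "bij_betw h (carrier M) (carrier N)"
    using assms by (auto simp: module_iso_iff)
  have "carrier N \<subseteq> fspan F N (h ` S)"
    using h(2) S(3) fspan_image[OF M assms(2) h(1) assms(4) S(2)] by (force simp: bij_betw_def)
  moreover have "h ` S \<subseteq> carrier N" using S h(2) by (auto simp: bij_betw_def)
  ultimately show ?thesis using S assms by (auto simp: fspanned_def)
qed

text \<open>A decomposition of N pulls back along the isomorphism: the preimages of complementary
  submodules are complementary in M, and by surjectivity a submodule with zero preimage is
  zero.\<close>

lemma indecomposable_iso:
  assumes M: "left_module R M" and N: "left_module R N" and iso: "module_iso R M N"
    and ind: "indecomposable R M"
  shows "indecomposable R N"
proof -
  interpret M: left_module R M by fact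
  interpret N: left_module R N by fact
  obtain h where h: "lin_hom R M N h" "bij_betw h (carrier M) (carrier N)"
    using iso by (auto simp: module_iso_iff)
  have h0: "h \<zero>\<^bsub>M\<^esub> = \<zero>\<^bsub>N\<^esub>"
    using h(1) add_hom_zero[OF M.M.abelian_group_axioms N.M.abelian_group_axioms] by (simp add: lin_hom_def)
  have ha: "h (x \<oplus>\<^bsub>M\<^esub> y) = h x \<oplus>\<^bsub>N\<^esub> h y" if "x \<in> carrier M" "y \<in> carrier M" for x y
    using h that by (simp add: lin_hom_def add_hom_def)
  have hs: "h (a \<odot>\<^bsub>M\<^esub> x) = a \<odot>\<^bsub>N\<^esub> h x" if "x \<in> carrier M" "a \<in> carrier R" for x a
    using h that by (simp add: lin_hom_def)
  have inj: "x = y" if "h x = h y" "x \<in> carrier M" "y \<in> carrier M" for x y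
    using that h(2) by (auto simp: bij_betw_def inj_on_def)
  have surj: "carrier N = h ` carrier M" using h(2) by (simp add: bij_betw_def)
  let ?P = "\<lambda>U. {x \<in> carrier M. h x \<in> U}"
  have sub: "submodule (?P U) R M" if "submodule U R N" for U
    using N.submoduleD[OF that] by (intro M.submoduleI) (auto simp: h0 ha hs)
  have triv: "U = {\<zero>\<^bsub>N\<^esub>}" if U: "submodule U R N" and "?P U = {\<zero>\<^bsub>M\<^esub>}" for U
  proof -
    have "y = \<zero>\<^bsub>N\<^esub>" if "y \<in> U" for y
    proof -
      obtain x where x: "x \<in> carrier M" "y = h x" using \<open>y \<in> U\<close> N.submoduleD(1)[OF U] surj by auto
      then have "x \<in> ?P U" using \<open>y \<in> U\<close> by simp
      then show ?thesis using \<open>?P U = {\<zero>\<^bsub>M\<^esub>}\<close> x h0 by simp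
    qed
    then show ?thesis using N.submoduleD(2)[OF U] by blast
  qed
  show ?thesis
    unfolding indecomposable_def
  proof (intro conjI allI impI)
    show "carrier N \<noteq> {\<zero>\<^bsub>N\<^esub>}"
    proof
      assume "carrier N = {\<zero>\<^bsub>N\<^esub>}"
      then have "x = \<zero>\<^bsub>M\<^esub>" if "x \<in> carrier M" for x
      proof -
        have "h x \<in> {\<zero>\<^bsub>N\<^esub>}" using surj that \<open>carrier N = {\<zero>\<^bsub>N\<^esub>}\<close> by blast
        then show ?thesis using inj[OF _ that M.zero_closed] h0 by simp
      qed
      then have "carrier M = {\<zero>\<^bsub>M\<^esub>}" by blast
      then show False using ind by (simp add: indecomposable_def)
    qed
  next
    fix U V assume U: "submodule U R N" and V: "submodule V R N"
      and int: "U \<inter> V = {\<zero>\<^bsub>N\<^esub>}" and sum: "U <+>\<^bsub>N\<^esub> V = carrier N"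
    have "?P U \<inter> ?P V = {\<zero>\<^bsub>M\<^esub>}"
    proof -
      have "x = \<zero>\<^bsub>M\<^esub>" if "x \<in> carrier M" "h x \<in> U" "h x \<in> V" for x
        using int that inj[of x "\<zero>\<^bsub>M\<^esub>"] h0 by auto
      moreover have "\<zero>\<^bsub>M\<^esub> \<in> ?P U \<inter> ?P V"
        using h0 N.submoduleD(2)[OF U] N.submoduleD(2)[OF V] by simp
      ultimately show ?thesis by blast
    qed
    moreover have "?P U <+>\<^bsub>M\<^esub> ?P V = carrier M"
    proof
      show "?P U <+>\<^bsub>M\<^esub> ?P V \<subseteq> carrier M" by (auto simp: set_add_def')
      show "carrier M \<subseteq> ?P U <+>\<^bsub>M\<^esub> ?P V"
      proof
        fix x assume x: "x \<in> carrier M"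
        then have "h x \<in> U <+>\<^bsub>N\<^esub> V" using surj sum by auto
        then obtain u v where uv: "u \<in> U" "v \<in> V" "h x = u \<oplus>\<^bsub>N\<^esub> v" by (auto simp: set_add_def')
        then have "u \<in> h ` carrier M" "v \<in> h ` carrier M"
          using N.submoduleD(1)[OF U] N.submoduleD(1)[OF V] surj by auto
        then obtain y z where yz: "y \<in> carrier M" "z \<in> carrier M" "u = h y" "v = h z" by blast
        then have "x = y \<oplus>\<^bsub>M\<^esub> z" using inj x uv ha by simp
        then show "x \<in> ?P U <+>\<^bsub>M\<^esub> ?P V" using yz uv by (auto simp: set_add_def')
      qed
    qed
    ultimately have "?P U = {\<zero>\<^bsub>M\<^esub>} \<or> ?P V = {\<zero>\<^bsub>M\<^esub>}"
      using ind sub[OF U] sub[OF V] by (simp add: indecomposable_def)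
    then show "U = {\<zero>\<^bsub>N\<^esub>} \<or> V = {\<zero>\<^bsub>N\<^esub>}" using triv U V by blast
  qed
qed

text \<open>A nonzero v in the kernel of the surjection p yields a linear relation that makes the
  image of one generator redundant. Applied to the two projections of a proper decomposition, this
  drives the induction in \<open>fspanned_decomp\<close>.\<close>

lemma fspan_smaller:
  assumes M: "left_module R M" and N: "left_module R N" and p: "lin_hom R M N p"
    and F: "division_subset R F" and S: "finite S" "S \<subseteq> carrier M" "carrier M \<subseteq> fspan F M S"
    and v: "v \<in> carrier M" "v \<noteq> \<zero>\<^bsub>M\<^esub>" "p v = \<zero>\<^bsub>N\<^esub>" and surj: "carrier N \<subseteq> p ` carrier M"
  shows "\<exists>T. finite T \<and> T \<subseteq> carrier N \<and> carrier N \<subseteq> fspan F N T \<and> card T < card S"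
proof -
  have FR: "F \<subseteq> carrier R" using F by (simp add: division_subset_def)
  obtain s where s: "s \<in> S" "p s \<in> fspan F N (p ` (S - {s}))"
    using fspan_drop[OF M N p F S(1,2) _ v(2,3)] v(1) S(3) by blast
  let ?T = "p ` (S - {s})"
  have pS: "p ` S \<subseteq> fspan F N ?T"
  proof
    fix y assume "y \<in> p ` S"
    then have "y = p s \<or> y \<in> ?T" by auto
    then show "y \<in> fspan F N ?T" using s(2) fspan.gen[of y ?T F N] by auto
  qed
  have "carrier N \<subseteq> fspan F N ?T"
  proof
    fix y assume "y \<in> carrier N"
    then obtain x where "x \<in> carrier M" "y = p x" using surj by auto
    then have "y \<in> fspan F N (p ` S)" using fspan_image[OF M N p FR S(2)] S(3) by auto
    then show "y \<in> fspan F N ?T" by (rule fspan_least[OF _ pS])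
  qed
  moreover have "?T \<subseteq> carrier N" using S p by (auto simp: lin_hom_def add_hom_def)
  moreover have "card ?T < card S"
    by (rule le_less_trans[OF card_image_le[OF finite_Diff[OF S(1)]] card_Diff1_less[OF S(1) s(1)]])
  moreover have "finite ?T" using S(1) by simp
  ultimately show ?thesis by (intro exI[of _ ?T] conjI)
qed

section \<open>Decompositions into indecomposable summands\<close>

lemma direct_sum_projections:
  assumes M: "left_module R M" and U: "submodule U R M" and V: "submodule V R M"
    and int: "U \<inter> V = {\<zero>\<^bsub>M\<^esub>}" and sum: "U <+>\<^bsub>M\<^esub> V = carrier M"
  obtains p q where "lin_hom R M (M\<lparr>carrier := U\<rparr>) p" "lin_hom R M (M\<lparr>carrier := V\<rparr>) q"
    "\<And>x. x \<in> carrier M \<Longrightarrow> x = p x \<oplus>\<^bsub>M\<^esub> q x"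
    "\<And>u. u \<in> U \<Longrightarrow> p u = u" "\<And>u. u \<in> U \<Longrightarrow> q u = \<zero>\<^bsub>M\<^esub>"
    "\<And>v. v \<in> V \<Longrightarrow> p v = \<zero>\<^bsub>M\<^esub>" "\<And>v. v \<in> V \<Longrightarrow> q v = v"
proof -
  interpret M: left_module R M by fact
  note U' = M.submoduleD[OF U] and V' = M.submoduleD[OF V]
  have "\<exists>u \<in> U. \<exists>v \<in> V. x = u \<oplus>\<^bsub>M\<^esub> v" if "x \<in> carrier M" for x
    using that sum[symmetric] by (auto simp: set_add_def')
  then obtain p q where pq: "\<And>x. x \<in> carrier M \<Longrightarrow> p x \<in> U \<and> q x \<in> V \<and> x = p x \<oplus>\<^bsub>M\<^esub> q x"
    by metis
  have uniq: "u = u' \<and> v = v'" if "u \<in> U" "u' \<in> U" "v \<in> V" "v' \<in> V" and eq: "u \<oplus>\<^bsub>M\<^esub> v = u' \<oplus>\<^bsub>M\<^esub> v'"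
    for u u' v v'
  proof -
    have c: "u \<in> carrier M" "u' \<in> carrier M" "v \<in> carrier M" "v' \<in> carrier M"
      using that U'(1) V'(1) by auto
    \<comment> \<open>The difference u - u' equals v' - v and so lies in both U and V.\<close>
    have "u \<oplus>\<^bsub>M\<^esub> \<ominus>\<^bsub>M\<^esub> u' = (u \<oplus>\<^bsub>M\<^esub> v) \<oplus>\<^bsub>M\<^esub> (\<ominus>\<^bsub>M\<^esub> v \<oplus>\<^bsub>M\<^esub> \<ominus>\<^bsub>M\<^esub> u')"
      using c by (simp add: M.a_assoc M.r_neg1 M.r_neg2)
    also have "\<dots> = (u' \<oplus>\<^bsub>M\<^esub> \<ominus>\<^bsub>M\<^esub> u') \<oplus>\<^bsub>M\<^esub> (v' \<oplus>\<^bsub>M\<^esub> \<ominus>\<^bsub>M\<^esub> v)"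
      unfolding eq using c M.a_inv_closed by (simp only: M.a_ac M.a_closed)
    also have "\<dots> = v' \<oplus>\<^bsub>M\<^esub> \<ominus>\<^bsub>M\<^esub> v" using c by (simp add: M.r_neg)
    finally have e: "u \<oplus>\<^bsub>M\<^esub> \<ominus>\<^bsub>M\<^esub> u' = v' \<oplus>\<^bsub>M\<^esub> \<ominus>\<^bsub>M\<^esub> v" .
    moreover have "u \<oplus>\<^bsub>M\<^esub> \<ominus>\<^bsub>M\<^esub> u' \<in> U" using that U'(3,4) by blast
    moreover have "v' \<oplus>\<^bsub>M\<^esub> \<ominus>\<^bsub>M\<^esub> v \<in> V" using that V'(3,4) by blast
    ultimately have "u \<oplus>\<^bsub>M\<^esub> \<ominus>\<^bsub>M\<^esub> u' = \<zero>\<^bsub>M\<^esub>" using int by auto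
    then have "u = u'" using c by (metis M.minus_equality M.minus_minus M.a_inv_closed)
    then show ?thesis using eq c by simp
  qed
  have pqI: "p x = u" "q x = v" if "x = u \<oplus>\<^bsub>M\<^esub> v" "u \<in> U" "v \<in> V" for x u v
  proof -
    have "x \<in> carrier M" using that U'(1) V'(1) by auto
    then show "p x = u" "q x = v" using uniq[of "p x" u "q x" v] pq[of x] that by simp_all
  qed
  have pU: "p x \<in> U" and qV: "q x \<in> V" if "x \<in> carrier M" for x
    using pq[OF that] by simp_all
  have c: "p x \<in> carrier M" "q x \<in> carrier M" if "x \<in> carrier M" for x
    using pU[OF that] qV[OF that] U'(1) V'(1) by auto
  have add: "p (x \<oplus>\<^bsub>M\<^esub> y) = p x \<oplus>\<^bsub>M\<^esub> p y" "q (x \<oplus>\<^bsub>M\<^esub> y) = q x \<oplus>\<^bsub>M\<^esub> q y"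
    if xy: "x \<in> carrier M" "y \<in> carrier M" for x y
  proof -
    have "x \<oplus>\<^bsub>M\<^esub> y = (p x \<oplus>\<^bsub>M\<^esub> q x) \<oplus>\<^bsub>M\<^esub> (p y \<oplus>\<^bsub>M\<^esub> q y)"
      using pq[OF xy(1)] pq[OF xy(2)] by argo
    also have "\<dots> = (p x \<oplus>\<^bsub>M\<^esub> p y) \<oplus>\<^bsub>M\<^esub> (q x \<oplus>\<^bsub>M\<^esub> q y)"
      using c[OF xy(1)] c[OF xy(2)] by (simp add: M.a_ac)
    finally show "p (x \<oplus>\<^bsub>M\<^esub> y) = p x \<oplus>\<^bsub>M\<^esub> p y" "q (x \<oplus>\<^bsub>M\<^esub> y) = q x \<oplus>\<^bsub>M\<^esub> q y"
      using pqI[of "x \<oplus>\<^bsub>M\<^esub> y"] U'(3)[of "p x" "p y"] V'(3)[of "q x" "q y"] pU[OF xy(1)] pU[OF xy(2)]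
        qV[OF xy(1)] qV[OF xy(2)] by simp_all
  qed
  have smult: "p (a \<odot>\<^bsub>M\<^esub> x) = a \<odot>\<^bsub>M\<^esub> p x" "q (a \<odot>\<^bsub>M\<^esub> x) = a \<odot>\<^bsub>M\<^esub> q x"
    if ax: "a \<in> carrier R" "x \<in> carrier M" for a x
  proof -
    have "a \<odot>\<^bsub>M\<^esub> x = a \<odot>\<^bsub>M\<^esub> (p x \<oplus>\<^bsub>M\<^esub> q x)" using pq[OF ax(2)] by argo
    also have "\<dots> = a \<odot>\<^bsub>M\<^esub> p x \<oplus>\<^bsub>M\<^esub> a \<odot>\<^bsub>M\<^esub> q x"
      using c[OF ax(2)] ax by (simp add: M.smult_r_distr)
    finally show "p (a \<odot>\<^bsub>M\<^esub> x) = a \<odot>\<^bsub>M\<^esub> p x" "q (a \<odot>\<^bsub>M\<^esub> x) = a \<odot>\<^bsub>M\<^esub> q x"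
      using pqI[of "a \<odot>\<^bsub>M\<^esub> x"] U'(5)[OF ax(1), of "p x"] V'(5)[OF ax(1), of "q x"] pU[OF ax(2)] qV[OF ax(2)]
      by simp_all
  qed
  show thesis
  proof
    show "lin_hom R M (M\<lparr>carrier := U\<rparr>) p" "lin_hom R M (M\<lparr>carrier := V\<rparr>) q"
      using pU qV add smult by (auto simp: lin_hom_def add_hom_def)
    show "x = p x \<oplus>\<^bsub>M\<^esub> q x" if "x \<in> carrier M" for x using pq that by blast
    show "p u = u" "q u = \<zero>\<^bsub>M\<^esub>" if "u \<in> U" for u
      using pqI[of u u "\<zero>\<^bsub>M\<^esub>"] that V'(2) U'(1) by auto
    show "p v = \<zero>\<^bsub>M\<^esub>" "q v = v" if "v \<in> V" for v
      using pqI[of v "\<zero>\<^bsub>M\<^esub>" v] that U'(2) V'(1) by auto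
  qed
qed

text \<open>Induction on the size of a spanning set over F. The last clause, which leads from a
  summand U back to M, is recorded for the chain argument: there an indecomposable summand is
  exchanged for an isomorphic one of an earlier module, and from the latter one has to return to
  that module.\<close>

lemma fspanned_decomp:
  assumes F: "division_subset R F" and M: "fspanned R F M"
  shows "\<exists>UU. finite UU \<and> in_add (lin_hom R) M UU \<and>
    (\<forall>U \<in> UU. fspanned R F U \<and> indecomposable R U \<and> in_add (lin_hom R) U {M})"
proof -
  interpret H: additive_homs "left_module R" "lin_hom R" by (rule additive_homs_lin)
  obtain S where "left_module R M" "finite S" "S \<subseteq> carrier M" "carrier M \<subseteq> fspan F M S"
    using M by (auto simp: fspanned_def)
  then show ?thesis
  proof (induction "card S" arbitrary: M S rule: less_induct)
    case less
    note M = \<open>left_module R M\<close>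
    interpret M: left_module R M by fact
    have id: "lin_hom R M M (\<lambda>x. x)" by (auto simp: lin_hom_def add_hom_def)
    consider "carrier M = {\<zero>\<^bsub>M\<^esub>}" | "indecomposable R M"
      | "carrier M \<noteq> {\<zero>\<^bsub>M\<^esub>}" "\<not> indecomposable R M" by blast
    then show ?case
    proof cases
      \<comment> \<open>A zero module is the empty sum: its identity is the zero map.\<close>
      case 1
      then have "in_add (lin_hom R) M {}"
        unfolding in_add_def
        by (intro exI[of _ "\<lambda>x. \<zero>\<^bsub>M\<^esub>"]) (auto intro: comp_sum.zero)
      then show ?thesis by blast
    next
      case 2
      have "in_add (lin_hom R) M {M}" by (rule H.in_add_retract[OF M _ id id]) auto
      then show ?thesis using 2 less by (intro exI[of _ "{M}"]) (auto simp: fspanned_def)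
    next
      case 3
      then obtain U V where UV: "submodule U R M" "submodule V R M" "U \<inter> V = {\<zero>\<^bsub>M\<^esub>}"
        "U <+>\<^bsub>M\<^esub> V = carrier M" "U \<noteq> {\<zero>\<^bsub>M\<^esub>}" "V \<noteq> {\<zero>\<^bsub>M\<^esub>}"
        by (auto simp: indecomposable_def)
      let ?U = "M\<lparr>carrier := U\<rparr>" and ?V = "M\<lparr>carrier := V\<rparr>"
      have mU: "left_module R ?U" and mV: "left_module R ?V"
        using M.submodule_left_module UV by blast+
      obtain p q where p: "lin_hom R M ?U p" and q: "lin_hom R M ?V q"
        and pq: "\<And>x. x \<in> carrier M \<Longrightarrow> x = p x \<oplus>\<^bsub>M\<^esub> q x"
        and pu: "\<And>u. u \<in> U \<Longrightarrow> p u = u" and qu: "\<And>u. u \<in> U \<Longrightarrow> q u = \<zero>\<^bsub>M\<^esub>"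
        and pv: "\<And>v. v \<in> V \<Longrightarrow> p v = \<zero>\<^bsub>M\<^esub>" and qv: "\<And>v. v \<in> V \<Longrightarrow> q v = v"
        using direct_sum_projections[OF M UV(1-4)] by blast
      have sub: "U \<subseteq> carrier M" "V \<subseteq> carrier M" "\<zero>\<^bsub>M\<^esub> \<in> U" "\<zero>\<^bsub>M\<^esub> \<in> V"
        using M.submoduleD UV(1,2) by blast+
      obtain u v where uv: "u \<in> U" "u \<noteq> \<zero>\<^bsub>M\<^esub>" "v \<in> V" "v \<noteq> \<zero>\<^bsub>M\<^esub>" using UV(5,6) sub by blast
      have sU: "carrier ?U \<subseteq> p ` carrier M" using pu sub(1) by force
      have sV: "carrier ?V \<subseteq> q ` carrier M" using qv sub(2) by force
      \<comment> \<open>The projection onto U kills the nonzero element v of V, so U needs fewer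
        generators than M. Below, u plays the same role for the projection onto V.\<close>
      have "\<exists>T. finite T \<and> T \<subseteq> carrier ?U \<and> carrier ?U \<subseteq> fspan F ?U T \<and> card T < card S"
        by (rule fspan_smaller[OF M mU p F less(3-5), of v]) (use uv sub pv sU in auto)
      then obtain T where "finite T" "T \<subseteq> carrier ?U" "carrier ?U \<subseteq> fspan F ?U T" "card T < card S"
        by blast
      from less(1)[OF this(4) mU this(1-3)] obtain UU where UU: "finite UU" "in_add (lin_hom R) ?U UU"
        "\<forall>W \<in> UU. fspanned R F W \<and> indecomposable R W \<and> in_add (lin_hom R) W {?U}" by auto
      have "\<exists>T. finite T \<and> T \<subseteq> carrier ?V \<and> carrier ?V \<subseteq> fspan F ?V T \<and> card T < card S"
        by (rule fspan_smaller[OF M mV q F less(3-5), of u]) (use uv sub qu sV in auto)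
      then obtain T where "finite T" "T \<subseteq> carrier ?V" "carrier ?V \<subseteq> fspan F ?V T" "card T < card S"
        by blast
      from less(1)[OF this(4) mV this(1-3)] obtain VV where VV: "finite VV" "in_add (lin_hom R) ?V VV"
        "\<forall>W \<in> VV. fspanned R F W \<and> indecomposable R W \<and> in_add (lin_hom R) W {?V}" by auto
      have iU: "lin_hom R ?U M (\<lambda>x. x)" and iV: "lin_hom R ?V M (\<lambda>x. x)"
        using sub by (auto simp: lin_hom_def add_hom_def)
      have inU: "in_add (lin_hom R) ?U {M}" by (rule H.in_add_retract[OF mU _ iU p]) (auto simp: pu)
      have inV: "in_add (lin_hom R) ?V {M}" by (rule H.in_add_retract[OF mV _ iV q]) (auto simp: qv)
      \<comment> \<open>The identity of M is p + q; the leading zero is the empty sum from which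
        \<open>comp_sum\<close> starts.\<close>
      have "comp_sum (lin_hom R) M {?U, ?V} (\<lambda>x. \<zero>\<^bsub>M\<^esub> \<oplus>\<^bsub>M\<^esub> p x \<oplus>\<^bsub>M\<^esub> q x)"
        using comp_sum.step[where u = "\<lambda>x. \<zero>\<^bsub>M\<^esub> \<oplus>\<^bsub>M\<^esub> p x" and f = q and g = "\<lambda>x. x",
            OF comp_sum.step[where u = "\<lambda>x. \<zero>\<^bsub>M\<^esub>" and f = p and g = "\<lambda>x. x", OF comp_sum.zero _ p iU] _ q iV]
        by simp
      moreover have "\<zero>\<^bsub>M\<^esub> \<oplus>\<^bsub>M\<^esub> p x \<oplus>\<^bsub>M\<^esub> q x = x" if "x \<in> carrier M" for x
      proof -
        have "p x \<in> carrier M" using p that sub(1) by (auto simp: lin_hom_def add_hom_def)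
        then show ?thesis using pq[OF that] by simp
      qed
      ultimately have "in_add (lin_hom R) M {?U, ?V}" unfolding in_add_def by blast
      moreover have "in_add (lin_hom R) ?U (UU \<union> VV)" "in_add (lin_hom R) ?V (UU \<union> VV)"
        using in_add_mono[OF UU(2)] in_add_mono[OF VV(2)] by auto
      ultimately have "in_add (lin_hom R) M (UU \<union> VV)"
        using H.in_add_trans[OF M, of "{?U, ?V}" "UU \<union> VV"] mU mV by blast
      moreover have "in_add (lin_hom R) W {M}" if "W \<in> UU \<union> VV" for W
      proof -
        have "left_module R W" using that UU(3) VV(3) by (auto simp: fspanned_def)
        moreover have "in_add (lin_hom R) W {?U} \<or> in_add (lin_hom R) W {?V}" using that UU(3) VV(3) by blast
        ultimately show ?thesis
          using H.in_add_trans[of W "{?U}" "{M}"] H.in_add_trans[of W "{?V}" "{M}"] mU mV inU inV by blast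
      qed
      ultimately show ?thesis using UU VV by (intro exI[of _ "UU \<union> VV"]) auto
    qed
  qed
qed

text \<open>The member of \<open>indec_classes R\<close> that describes U. As U may live in any
  type, its copies in the fixed type of \<open>indec_modules\<close> are collected instead of U
  itself.\<close>

definition indec_class ::
  "('r, 'x) ring_scheme \<Rightarrow> ('r, 'm, 'y) module_scheme \<Rightarrow> ('r, (nat \<Rightarrow> 'r) set) module set" where
  "indec_class R U = {N \<in> indec_modules R. module_iso R U N}"

text \<open>A copy of U in the fixed type exists by \<open>fin_gen_representable\<close>. That the
  copy is again finitely generated and indecomposable is transported along the isomorphism.\<close>

lemma indec_class_in:
  fixes R :: "('r, 'x) ring_scheme" and U :: "('r, 'm, 'y) module_scheme"
  assumes F: "division_subset R F" and U: "fspanned R F U" "indecomposable R U"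
  shows "indec_class R U \<in> indec_classes R" "indec_class R U \<noteq> {}"
proof -
  have mU: "left_module R U" using U by (simp add: fspanned_def)
  obtain N :: "('r, (nat \<Rightarrow> 'r) set) module" where N: "left_module R N" "module_iso R U N"
    using fin_gen_representable[OF mU fspanned_fin_gen[OF U(1) F]] by blast
  have "fspanned R F N" using fspanned_iso[OF U(1) N] F by (simp add: division_subset_def)
  then have N': "N \<in> indec_modules R"
    using N fspanned_fin_gen[OF _ F] indecomposable_iso[OF mU N U(2)] by (auto simp: indec_modules_def)
  then show "indec_class R U \<noteq> {}" using N by (auto simp: indec_class_def)
  have "indec_class R U =
    {(M, N). M \<in> indec_modules R \<and> N \<in> indec_modules R \<and> module_iso R M N} `` {N}"
    using N N' module_iso_trans module_iso_sym[OF mU N(2)] by (auto simp: indec_class_def dest: module_iso_trans)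
  then show "indec_class R U \<in> indec_classes R"
    unfolding indec_classes_def quotient_def using N' by blast
qed

text \<open>U and V are compared through a common representative in the fixed type, which exists
  because the class is nonempty.\<close>

lemma indec_class_eqD:
  fixes R :: "('r, 'x) ring_scheme" and U V :: "('r, 'm, 'y) module_scheme"
  assumes "left_module R U" "left_module R V" "indec_class R U = indec_class R V" "indec_class R U \<noteq> {}"
  shows "module_iso R U V"
proof -
  obtain N :: "('r, (nat \<Rightarrow> 'r) set) module"
    where "module_iso R U N" "module_iso R V N" "left_module R N"
  proof -
    obtain N where "N \<in> indec_class R U" using assms(4) by blast
    moreover from this have "N \<in> indec_class R V" using assms(3) by simp
    ultimately show ?thesis using that[of N] by (simp add: indec_class_def indec_modules_def)
  qed
  then show ?thesis using module_iso_sym[OF assms(2)] module_iso_trans by blast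
qed

text \<open>The sets of isomorphism classes occurring in \<open>T 0, \<dots>, T m\<close> form an ascending chain of nonempty
  subsets of a set with \<open>n\<close> elements, so that the chain is stationary at some \<open>m < n\<close>.\<close>

lemma in_add_chain:
  fixes T :: "nat \<Rightarrow> ('r, 'm, 'y) module_scheme"
  assumes F: "division_subset R F" and T: "\<And>i. fspanned R F (T i)"
    and nz: "carrier (T 0) \<noteq> {\<zero>\<^bsub>T 0\<^esub>}" and fin: "finite (indec_classes R)"
  shows "\<exists>m < card (indec_classes R). in_add (lin_hom R) (T (Suc m)) (T ` {..m})"
proof -
  interpret H: additive_homs "left_module R" "lin_hom R" by (rule additive_homs_lin)
  have "\<forall>i. \<exists>UU. finite UU \<and> in_add (lin_hom R) (T i) UU \<and>
    (\<forall>U \<in> UU. fspanned R F U \<and> indecomposable R U \<and> in_add (lin_hom R) U {T i})"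
    using fspanned_decomp[OF F T] by blast
  then obtain UU where inUU: "\<And>i. in_add (lin_hom R) (T i) (UU i)"
    and UU: "\<And>i U. U \<in> UU i \<Longrightarrow> fspanned R F U \<and> indecomposable R U \<and> in_add (lin_hom R) U {T i}"
    by metis
  have mod: "left_module R U" if "fspanned R F U" for U :: "('r, 'm, 'y) module_scheme"
    using that by (simp add: fspanned_def)
  define D where "D m = (\<Union>i\<le>m. indec_class R ` UU i)" for m
  have Dsub: "D m \<subseteq> indec_classes R" for m
    unfolding D_def using UU indec_class_in[OF F] by blast
  \<comment> \<open>Without summands the identity of \<open>T 0\<close> would be the zero map. This
    nonempty start is what yields m < n below, and not only m \<le> n.\<close>
  have "UU 0 \<noteq> {}"
  proof
    assume "UU 0 = {}"
    then obtain u where u: "comp_sum (lin_hom R) (T 0) {} u" "\<forall>x \<in> carrier (T 0). u x = x"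
      using inUU[of 0] by (auto simp: in_add_def)
    interpret T0: left_module R "T 0" using T mod by blast
    from u(1) have "u = (\<lambda>x. \<zero>\<^bsub>T 0\<^esub>)" by cases auto
    then have "carrier (T 0) \<subseteq> {\<zero>\<^bsub>T 0\<^esub>}" using u(2) by auto
    then show False using nz by auto
  qed
  then have D0: "D 0 \<noteq> {}" by (auto simp: D_def)
  have "\<exists>m < card (indec_classes R). D (Suc m) = D m"
  proof (rule ccontr)
    assume "\<not> ?thesis"
    then have neq: "D m \<noteq> D (Suc m)" if "m < card (indec_classes R)" for m using that by metis
    \<comment> \<open>If no step before n were stationary, each would add a class to the one or more
      classes of \<open>D 0\<close>, so that \<open>D n\<close> would have more than n
      elements.\<close>
    have "m < card (D m)" if "m \<le> card (indec_classes R)" for m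
      using that
    proof (induction m)
      case 0
      then show ?case using D0 finite_subset[OF Dsub fin] by (simp add: card_gt_0_iff)
    next
      case (Suc m)
      have "D m \<subseteq> D (Suc m)" unfolding D_def by (rule UN_mono) auto
      then have "D m \<subset> D (Suc m)" using neq[of m] Suc(2) by auto
      then have "card (D m) < card (D (Suc m))" using finite_subset[OF Dsub fin] psubset_card_mono by blast
      then show ?case using Suc by simp
    qed
    then show False using card_mono[OF fin Dsub] by (meson leD order_refl)
  qed
  then obtain m where m: "m < card (indec_classes R)" "D (Suc m) = D m" by blast
  \<comment> \<open>The class of U has already occurred, so U is isomorphic to some V in
    \<open>UU i\<close> with i \<le> m; the last clause of \<open>fspanned_decomp\<close> leads from
    V to \<open>T i\<close>.\<close>
  have "in_add (lin_hom R) U (T ` {..m})" if U: "U \<in> UU (Suc m)" for U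
  proof -
    have "indec_class R U \<in> D m" unfolding m(2)[symmetric] using U by (auto simp: D_def)
    then obtain i V where V: "i \<le> m" "V \<in> UU i" "indec_class R U = indec_class R V"
      by (auto simp: D_def)
    have mU: "left_module R U" and mV: "left_module R V" using UU U V mod by blast+
    have "module_iso R U V" using indec_class_eqD[OF mU mV V(3)] indec_class_in[OF F] UU U by blast
    then obtain h where h: "lin_hom R U V h" "bij_betw h (carrier U) (carrier V)"
      by (auto simp: module_iso_iff)
    have "in_add (lin_hom R) U {V}"
      by (rule H.in_add_retract[OF mU _ h(1) lin_hom_inv(1)[OF mU h]])
        (use h(2) in \<open>auto simp: bij_betw_def the_inv_into_f_f\<close>)
    then have "in_add (lin_hom R) U {T i}"
      using H.in_add_trans[OF mU, of "{V}" "{T i}"] mV UU[OF V(2)] by blast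
    then show ?thesis by (rule in_add_mono) (use V in auto)
  qed
  then have "in_add (lin_hom R) (T (Suc m)) (T ` {..m})"
    using H.in_add_trans[OF mod[OF T] _ inUU] UU mod by blast
  then show ?thesis using m by blast
qed

section \<open>Presented abelian groups\<close>

lemma add_homI:
  "\<lbrakk>\<And>x. x \<in> carrier M \<Longrightarrow> f x \<in> carrier N;
    \<And>x y. x \<in> carrier M \<Longrightarrow> y \<in> carrier M \<Longrightarrow> f (x \<oplus>\<^bsub>M\<^esub> y) = f x \<oplus>\<^bsub>N\<^esub> f y\<rbrakk> \<Longrightarrow> add_hom M N f"
  by (auto simp: add_hom_def)

lemma (in abelian_group) minus_eq_zero_iff:
  assumes "x \<in> carrier G" "y \<in> carrier G"
  shows "x \<ominus> y = \<zero> \<longleftrightarrow> x = y"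
proof
  assume "x \<ominus> y = \<zero>"
  then have "\<ominus> (\<ominus> y) = x"
    using assms by (intro minus_equality) (simp_all add: a_minus_def)
  then show "x = y" using assms by simp
qed (use assms in \<open>simp add: a_minus_def r_neg\<close>)

text \<open>The common part of the two tensor constructions. Only the additive structure of M is
  prescribed, so that M can be the tensor algebra with its product or a tensor power with its two
  actions.\<close>

locale presented_group =
  fixes Q :: "'g set" and Rl :: "('g \<Rightarrow>\<^sub>0 int) set" and M :: "(('g \<Rightarrow>\<^sub>0 int) set, 'y) ring_scheme"
  assumes rels: "\<And>r. r \<in> Rl \<Longrightarrow> Poly_Mapping.keys r \<subseteq> Q"
    and car_eq: "carrier M = rcosets\<^bsub>free_Abelian_group Q\<^esub> (generate (free_Abelian_group Q) Rl)"
    and zero_eq: "ring.zero M = generate (free_Abelian_group Q) Rl"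
    and add_eq: "\<And>U V. U \<oplus>\<^bsub>M\<^esub> V = U <#>\<^bsub>free_Abelian_group Q\<^esub> V"
begin

abbreviation "G \<equiv> free_Abelian_group Q"
abbreviation "H \<equiv> generate G Rl"

definition cls :: "('g \<Rightarrow>\<^sub>0 int) \<Rightarrow> ('g \<Rightarrow>\<^sub>0 int) set" where
  "cls u = H #>\<^bsub>G\<^esub> u"

text \<open>In both instances these are the pure tensors.\<close>

definition gen :: "'g \<Rightarrow> ('g \<Rightarrow>\<^sub>0 int) set" where
  "gen k = cls (frag_of k)"

lemma H_subgroup: "subgroup H G"
  by (rule group.generate_is_subgroup) (use rels in auto)

lemma H_keys: "h \<in> H \<Longrightarrow> Poly_Mapping.keys h \<subseteq> Q"
  using subgroup.mem_carrier[OF H_subgroup] by simp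

lemma H_zero: "0 \<in> H"
  using subgroup.one_closed[OF H_subgroup] by simp

lemma H_add: "u \<in> H \<Longrightarrow> v \<in> H \<Longrightarrow> u + v \<in> H"
  using subgroup.m_closed[OF H_subgroup] by simp

lemma H_uminus: "u \<in> H \<Longrightarrow> - u \<in> H"
  using subgroup.m_inv_closed[OF H_subgroup] H_keys by (metis inv_free_Abelian_group)

lemma H_diff: "u \<in> H \<Longrightarrow> v \<in> H \<Longrightarrow> u - v \<in> H"
  using H_add[OF _ H_uminus, of u v] by simp

lemma H_rel: "r \<in> Rl \<Longrightarrow> r \<in> H"
  by (rule generate.incl)

text \<open>This is congruence modulo H. Addition in the free abelian group is the ordinary addition
  of finitely supported functions, so this description, \<open>cls_eq\<close> and
  \<open>cls_add\<close> need no condition on the keys.\<close>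

lemma mem_cls: "x \<in> cls u \<longleftrightarrow> x - u \<in> H"
proof
  assume "x \<in> cls u"
  then obtain h where "h \<in> H" "x = h + u" by (auto simp: cls_def r_coset_def)
  then show "x - u \<in> H" by simp
next
  assume "x - u \<in> H"
  then have "\<exists>h \<in> H. x = h + u" by (intro bexI[of _ "x - u"]) simp
  then show "x \<in> cls u" by (auto simp: cls_def r_coset_def)
qed

lemma cls_eq: "cls u = cls v \<longleftrightarrow> u - v \<in> H"
proof
  assume "cls u = cls v"
  moreover have "u \<in> cls u" by (simp add: mem_cls H_zero)
  ultimately have "u \<in> cls v" by simp
  then show "u - v \<in> H" by (simp add: mem_cls)
next
  assume uv: "u - v \<in> H"
  have "x - u \<in> H \<longleftrightarrow> x - v \<in> H" for x
  proof
    assume "x - u \<in> H"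
    from H_add[OF this uv] show "x - v \<in> H" by simp
  next
    assume "x - v \<in> H"
    from H_diff[OF this uv] show "x - u \<in> H" by simp
  qed
  then show "cls u = cls v" by (intro Set.set_eqI) (simp add: mem_cls)
qed

lemma cls_zero: "cls 0 = \<zero>\<^bsub>M\<^esub>"
  unfolding zero_eq by (intro Set.set_eqI) (simp add: mem_cls)

lemma carE:
  assumes "U \<in> carrier M"
  obtains u where "Poly_Mapping.keys u \<subseteq> Q" "U = cls u"
  using assms unfolding car_eq RCOSETS_def cls_def by auto

lemma cls_closed: "Poly_Mapping.keys u \<subseteq> Q \<Longrightarrow> cls u \<in> carrier M"
  unfolding car_eq RCOSETS_def cls_def by auto

lemma gen_closed: "k \<in> Q \<Longrightarrow> gen k \<in> carrier M"
  unfolding gen_def by (rule cls_closed) simp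

lemma cls_add: "cls u \<oplus>\<^bsub>M\<^esub> cls v = cls (u + v)"
proof (intro Set.set_eqI iffI)
  fix z assume "z \<in> cls u \<oplus>\<^bsub>M\<^esub> cls v"
  then obtain x y where "x \<in> cls u" "y \<in> cls v" "z = x + y" by (auto simp: add_eq set_mult_def)
  then show "z \<in> cls (u + v)" using H_add[of "x - u" "y - v"] by (simp add: mem_cls algebra_simps)
next
  fix z assume "z \<in> cls (u + v)"
  then have "z - v \<in> cls u" by (simp add: mem_cls algebra_simps)
  moreover have "v \<in> cls v" by (simp add: mem_cls H_zero)
  moreover have "z = (z - v) + v" by simp
  ultimately show "z \<in> cls u \<oplus>\<^bsub>M\<^esub> cls v" unfolding add_eq set_mult_def mult_free_Abelian_group by blast
qed

lemma abelian: "abelian_group M"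
proof (rule abelian_groupI)
  fix U assume "U \<in> carrier M"
  then obtain u where u: "Poly_Mapping.keys u \<subseteq> Q" "U = cls u" by (rule carE)
  then show "\<zero>\<^bsub>M\<^esub> \<oplus>\<^bsub>M\<^esub> U = U" by (simp add: cls_add flip: cls_zero)
  have "cls (- u) \<oplus>\<^bsub>M\<^esub> U = \<zero>\<^bsub>M\<^esub>" using u by (simp add: cls_add flip: cls_zero)
  moreover have "cls (- u) \<in> carrier M" using u by (intro cls_closed) simp
  ultimately show "\<exists>y\<in>carrier M. y \<oplus>\<^bsub>M\<^esub> U = \<zero>\<^bsub>M\<^esub>" by blast
next
  fix U V assume "U \<in> carrier M" "V \<in> carrier M"
  then obtain u v where uv: "Poly_Mapping.keys u \<subseteq> Q" "U = cls u" "Poly_Mapping.keys v \<subseteq> Q" "V = cls v"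
    by (metis carE)
  have "Poly_Mapping.keys (u + v) \<subseteq> Q" using uv keys_add[of u v] by blast
  then show "U \<oplus>\<^bsub>M\<^esub> V \<in> carrier M" using uv by (simp add: cls_add cls_closed)
  show "U \<oplus>\<^bsub>M\<^esub> V = V \<oplus>\<^bsub>M\<^esub> U" using uv by (simp add: cls_add add.commute)
next
  fix U V W assume "U \<in> carrier M" "V \<in> carrier M" "W \<in> carrier M"
  then obtain u v w where "U = cls u" "V = cls v" "W = cls w" by (metis carE)
  then show "U \<oplus>\<^bsub>M\<^esub> V \<oplus>\<^bsub>M\<^esub> W = U \<oplus>\<^bsub>M\<^esub> (V \<oplus>\<^bsub>M\<^esub> W)" by (simp add: cls_add add.assoc)
next
  show "\<zero>\<^bsub>M\<^esub> \<in> carrier M" using cls_closed[of 0] by (simp add: cls_zero)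
qed

sublocale M: abelian_group M by (rule abelian)

lemma cls_diff: "Poly_Mapping.keys u \<subseteq> Q \<Longrightarrow> Poly_Mapping.keys v \<subseteq> Q \<Longrightarrow> cls (u - v) = cls u \<ominus>\<^bsub>M\<^esub> cls v"
proof -
  assume u: "Poly_Mapping.keys u \<subseteq> Q" and v: "Poly_Mapping.keys v \<subseteq> Q"
  have "cls (- v) \<oplus>\<^bsub>M\<^esub> cls v = \<zero>\<^bsub>M\<^esub>" by (simp add: cls_add cls_zero)
  moreover have "cls (- v) \<in> carrier M" using v by (intro cls_closed) simp
  ultimately have "\<ominus>\<^bsub>M\<^esub> cls v = cls (- v)" using M.minus_equality cls_closed[OF v] by blast
  then show ?thesis by (simp add: a_minus_def cls_add)
qed

text \<open>A free abelian group is generated by its basis under subtraction alone, hence the single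
  closure case \<open>diff\<close>.\<close>

lemma induct [consumes 1, case_names zero gen diff]:
  assumes "U \<in> carrier M" and "P \<zero>\<^bsub>M\<^esub>" and "\<And>k. k \<in> Q \<Longrightarrow> P (gen k)"
    and "\<And>U V. U \<in> carrier M \<Longrightarrow> V \<in> carrier M \<Longrightarrow> P U \<Longrightarrow> P V \<Longrightarrow> P (U \<ominus>\<^bsub>M\<^esub> V)"
  shows "P U"
proof -
  obtain u where u: "Poly_Mapping.keys u \<subseteq> Q" "U = cls u" using assms(1) by (rule carE)
  have "P (cls u)"
  proof (rule free_Abelian_group_induct[OF u(1)])
    show "P (cls 0)" using assms(2) by (simp add: cls_zero)
    show "P (cls (x - y))" if "Poly_Mapping.keys x \<subseteq> Q" "Poly_Mapping.keys y \<subseteq> Q" "P (cls x)" "P (cls y)"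
      for x y using assms(4) cls_closed that by (simp add: cls_diff)
    show "P (cls (frag_of a))" if "a \<in> Q" for a using assms(3)[OF that] by (simp add: gen_def)
  qed
  then show ?thesis using u by simp
qed

text \<open>Pure tensors generate. All ring and module axioms below are checked with this rule, one
  variable at a time.\<close>

lemma add_hom_eqI:
  assumes N: "abelian_group N" and f: "add_hom M N f" and g: "add_hom M N g"
    and "\<And>k. k \<in> Q \<Longrightarrow> f (gen k) = g (gen k)" and U: "U \<in> carrier M"
  shows "f U = g U"
proof -
  interpret N: abelian_group N by fact
  have hdiff: "h (U \<ominus>\<^bsub>M\<^esub> V) = h U \<ominus>\<^bsub>N\<^esub> h V" if "add_hom M N h" "U \<in> carrier M" "V \<in> carrier M" for h U V
    using that add_hom_add[OF that(1), of U "\<ominus>\<^bsub>M\<^esub> V"] add_hom_minus[OF abelian N that(1)]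
    by (simp add: a_minus_def)
  show ?thesis using U
  proof (induction U rule: induct)
    case zero
    then show ?case using add_hom_zero[OF abelian N f] add_hom_zero[OF abelian N g] by simp
  next
    case (diff U V)
    then show ?case using hdiff[OF f] hdiff[OF g] by simp
  qed (use assms in simp)
qed

text \<open>The universal property of a presented group. The extension of \<phi> to the free abelian
  group is known only through an existence theorem and has no name that a caller could use. The
  condition on relations is therefore stated for every h with the two properties from which the
  value at a relation can be computed.\<close>

lemma lift:
  assumes N: "abelian_group N" and \<phi>: "\<And>k. k \<in> Q \<Longrightarrow> \<phi> k \<in> carrier N"
    and rel: "\<And>h r. \<lbrakk>r \<in> Rl; \<And>u v. Poly_Mapping.keys u \<subseteq> Q \<Longrightarrow> Poly_Mapping.keys v \<subseteq> Q \<Longrightarrow>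
        h (u - v) = h u \<ominus>\<^bsub>N\<^esub> h v; \<And>k. k \<in> Q \<Longrightarrow> h (frag_of k) = \<phi> k\<rbrakk> \<Longrightarrow> h r = \<zero>\<^bsub>N\<^esub>"
  obtains f where "add_hom M N f" "\<And>k. k \<in> Q \<Longrightarrow> f (gen k) = \<phi> k"
proof -
  interpret N: abelian_group N by fact
  obtain h where h: "h \<in> hom G (add_monoid N)" and hg: "\<And>k. k \<in> Q \<Longrightarrow> h (frag_of k) = \<phi> k"
    using comm_group.free_Abelian_group_universal[OF N.a_comm_group, of \<phi> Q] \<phi> by auto
  have hc: "h u \<in> carrier N" if "Poly_Mapping.keys u \<subseteq> Q" for u
    using h that by (auto simp: hom_def)
  have hadd: "h (u + v) = h u \<oplus>\<^bsub>N\<^esub> h v" if "Poly_Mapping.keys u \<subseteq> Q" "Poly_Mapping.keys v \<subseteq> Q" for u v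
    using h that by (auto simp: hom_def)
  have hz: "h 0 = \<zero>\<^bsub>N\<^esub>"
  proof -
    have "h 0 = h 0 \<oplus>\<^bsub>N\<^esub> h 0" using hadd[of 0 0] by simp
    then show ?thesis using hc[of 0] N.add.l_cancel_one' by fastforce
  qed
  have hminus: "h (- u) = \<ominus>\<^bsub>N\<^esub> h u" if "Poly_Mapping.keys u \<subseteq> Q" for u
  proof -
    have "h (- u) \<oplus>\<^bsub>N\<^esub> h u = \<zero>\<^bsub>N\<^esub>" using hadd[of "- u" u] that hz by simp
    then show ?thesis using N.minus_equality hc that by (metis keys_minus)
  qed
  have hdiff: "h (u - v) = h u \<ominus>\<^bsub>N\<^esub> h v" if "Poly_Mapping.keys u \<subseteq> Q" "Poly_Mapping.keys v \<subseteq> Q" for u v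
    using hadd[of u "- v"] hminus[of v] that by (simp add: a_minus_def)
  have hr: "h r = \<zero>\<^bsub>N\<^esub>" if "r \<in> Rl" for r using rel[OF that hdiff hg] .
  have hH: "h u = \<zero>\<^bsub>N\<^esub>" if "u \<in> H" for u
    using that
  proof induction
    case one
    then show ?case using hz by simp
  next
    case (incl r)
    then show ?case by (rule hr)
  next
    case (inv r)
    then show ?case using hr hminus rels by simp
  next
    case (eng u v)
    then show ?case using hadd[of u v] H_keys by simp
  qed
  \<comment> \<open>The value is taken at some representative; any two differ by an element of H, on
    which h vanishes.\<close>
  define f where "f U = h (SOME u. Poly_Mapping.keys u \<subseteq> Q \<and> U = cls u)" for U
  have f: "f (cls u) = h u" if u: "Poly_Mapping.keys u \<subseteq> Q" for u
  proof -
    let ?v = "SOME v. Poly_Mapping.keys v \<subseteq> Q \<and> cls u = cls v"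
    have v: "Poly_Mapping.keys ?v \<subseteq> Q \<and> cls u = cls ?v" by (rule someI[of _ u]) (use u in simp)
    then have "u - ?v \<in> H" using cls_eq by blast
    then have "h u \<ominus>\<^bsub>N\<^esub> h ?v = \<zero>\<^bsub>N\<^esub>" using hH hdiff[of u ?v] u v by simp
    then have "h u = h ?v" using N.minus_eq_zero_iff hc u v by blast
    then show ?thesis by (simp add: f_def)
  qed
  show thesis
  proof
    show "f (gen k) = \<phi> k" if "k \<in> Q" for k using f[of "frag_of k"] hg that by (simp add: gen_def)
    show "add_hom M N f"
    proof (rule add_homI)
      fix U V assume "U \<in> carrier M" "V \<in> carrier M"
      then obtain u v where uv: "Poly_Mapping.keys u \<subseteq> Q" "U = cls u" "Poly_Mapping.keys v \<subseteq> Q" "V = cls v"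
        by (metis carE)
      have "Poly_Mapping.keys (u + v) \<subseteq> Q" using uv keys_add[of u v] by blast
      then show "f (U \<oplus>\<^bsub>M\<^esub> V) = f U \<oplus>\<^bsub>N\<^esub> f V" using uv by (simp add: cls_add f hadd)
    next
      fix U assume "U \<in> carrier M"
      then obtain u where "Poly_Mapping.keys u \<subseteq> Q" "U = cls u" by (rule carE)
      then show "f U \<in> carrier N" using f hc by simp
    qed
  qed
qed

section \<open>Maps induced on cosets\<close>

lemma frag_extend_keys:
  assumes "Poly_Mapping.keys u \<subseteq> Q" "\<And>k. k \<in> Q \<Longrightarrow> Poly_Mapping.keys (F k) \<subseteq> Q"
  shows "Poly_Mapping.keys (frag_extend F u) \<subseteq> Q"
  using keys_frag_extend[of F u] assms by blast

lemma frag_extend_H: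
  assumes "\<And>r. r \<in> Rl \<Longrightarrow> frag_extend F r \<in> H" and "u \<in> H"
  shows "frag_extend F u \<in> H"
  using assms(2)
proof induction
  case one
  then show ?case by (simp add: H_zero)
next
  case (inv r)
  then show ?case using assms(1) H_uminus rels by (simp add: frag_extend_minus)
next
  case (eng u v)
  then show ?case using H_add by (simp add: frag_extend_add)
qed (use assms in simp)

text \<open>\<open>coset_map\<close> forms a union over all representatives. Since the extension of
  F maps H into H, they all contribute the same coset, and it is enough to test this on the defining
  relations.\<close>

lemma coset_map_cls:
  assumes "\<And>r. r \<in> Rl \<Longrightarrow> frag_extend F r \<in> H"
  shows "coset_map G H (frag_extend F) (cls u) = cls (frag_extend F u)"
proof -
  have "cls (frag_extend F x) = cls (frag_extend F u)" if "x \<in> cls u" for x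
    using frag_extend_H[OF assms, of "x - u"] that by (simp add: mem_cls cls_eq frag_extend_diff)
  moreover have "u \<in> cls u" by (simp add: mem_cls H_zero)
  ultimately show ?thesis unfolding coset_map_def cls_def[symmetric] by blast
qed

lemma coset_map_hom:
  assumes "\<And>r. r \<in> Rl \<Longrightarrow> frag_extend F r \<in> H" and "\<And>k. k \<in> Q \<Longrightarrow> Poly_Mapping.keys (F k) \<subseteq> Q"
  shows "add_hom M M (coset_map G H (frag_extend F))"
    "k \<in> Q \<Longrightarrow> coset_map G H (frag_extend F) (gen k) = cls (F k)"
proof -
  show "add_hom M M (coset_map G H (frag_extend F))"
  proof (rule add_homI)
    fix U V assume "U \<in> carrier M" "V \<in> carrier M"
    then obtain u v where "U = cls u" "V = cls v" by (metis carE)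
    then show "coset_map G H (frag_extend F) (U \<oplus>\<^bsub>M\<^esub> V) =
        coset_map G H (frag_extend F) U \<oplus>\<^bsub>M\<^esub> coset_map G H (frag_extend F) V"
      by (simp add: cls_add coset_map_cls[OF assms(1)] frag_extend_add)
  next
    fix U assume "U \<in> carrier M"
    then obtain u where "Poly_Mapping.keys u \<subseteq> Q" "U = cls u" by (rule carE)
    then show "coset_map G H (frag_extend F) U \<in> carrier M"
      using coset_map_cls[OF assms(1)] cls_closed frag_extend_keys assms(2) by simp
  qed
  show "coset_map G H (frag_extend F) (gen k) = cls (F k)" if "k \<in> Q"
    using coset_map_cls[OF assms(1), of "frag_of k"] by (simp add: gen_def)
qed

end

section \<open>Tensor products of algebras\<close>

text \<open>The dimension hypothesis is dropped: it plays no role in forming \<open>opp\<close> and tensor products.\<close>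

locale algebra_over = K?: field K + A?: ring A + V?: module K A
  for K :: "('k, 'x) ring_scheme" and A :: "('k, 'a, 'y) module_scheme" +
  assumes smult_mult_left:
      "\<lbrakk>c \<in> carrier K; x \<in> carrier A; y \<in> carrier A\<rbrakk> \<Longrightarrow>
        (c \<odot>\<^bsub>A\<^esub> x) \<otimes>\<^bsub>A\<^esub> y = c \<odot>\<^bsub>A\<^esub> (x \<otimes>\<^bsub>A\<^esub> y)"
    and smult_mult_right:
      "\<lbrakk>c \<in> carrier K; x \<in> carrier A; y \<in> carrier A\<rbrakk> \<Longrightarrow>
        x \<otimes>\<^bsub>A\<^esub> (c \<odot>\<^bsub>A\<^esub> y) = c \<odot>\<^bsub>A\<^esub> (x \<otimes>\<^bsub>A\<^esub> y)"

lemma fin_dim_algebra_over: "fin_dim_algebra K A \<Longrightarrow> algebra_over K A"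
  by (simp add: fin_dim_algebra_def fin_dim_algebra_axioms_def algebra_over_def algebra_over_axioms_def)

lemma ring_opp:
  assumes "ring A"
  shows "ring (opp A)"
proof -
  interpret ring A by fact
  show ?thesis
  proof (rule ringI)
    show "abelian_group (opp A)"
      by (rule abelian_group_transport[OF abelian_group_axioms, of id]) (auto simp: opp_def)
    show "monoid (opp A)" by (rule monoidI) (auto simp: opp_def m_assoc)
  qed (auto simp: opp_def l_distr r_distr)
qed

lemma algebra_over_opp:
  assumes "algebra_over K A"
  shows "algebra_over K (opp A)"
proof -
  interpret algebra_over K A by fact
  interpret O: ring "opp A" by (rule ring_opp) (rule A.ring_axioms)
  have "cring K" using K.field_axioms by (simp add: field_def domain_def)
  then have "module K (opp A)"
    by (rule moduleI[OF _ O.abelian_group_axioms])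
      (simp_all add: opp_def V.smult_l_distr V.smult_r_distr V.smult_assoc1)
  then show ?thesis
    by (intro algebra_over.intro algebra_over_axioms.intro K.field_axioms O.ring_axioms)
      (auto simp: opp_def smult_mult_left smult_mult_right)
qed

lemma keys_frag_diff: "a \<in> Q \<Longrightarrow> b \<in> Q \<Longrightarrow> Poly_Mapping.keys (frag_of a - frag_of b) \<subseteq> Q"
  using keys_diff[of "frag_of a" "frag_of b"] by auto

lemma keys_frag_diff3:
  "a \<in> Q \<Longrightarrow> b \<in> Q \<Longrightarrow> c \<in> Q \<Longrightarrow> Poly_Mapping.keys (frag_of a - frag_of b - frag_of c) \<subseteq> Q"
  using keys_diff[of "frag_of a - frag_of b" "frag_of c"] keys_frag_diff[of a Q b] by auto

text \<open>Linearity in the map that is extended; it gives the linearity of \<open>bil\<close> in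
  its left argument.\<close>

lemma frag_extend_fun_diff: "frag_extend (\<lambda>k. F k - F' k) u = frag_extend F u - frag_extend F' u"
proof -
  have "Poly_Mapping.keys u \<subseteq> UNIV" by simp
  then show ?thesis by (induction u rule: frag_induction) (auto simp: frag_extend_diff)
qed

lemma tensor_relsE:
  assumes "r \<in> tensor_rels K A B"
  obtains x x' y where "r = frag_of (x \<oplus>\<^bsub>A\<^esub> x', y) - frag_of (x, y) - frag_of (x', y)"
      "x \<in> carrier A" "x' \<in> carrier A" "y \<in> carrier B"
  | x y y' where "r = frag_of (x, y \<oplus>\<^bsub>B\<^esub> y') - frag_of (x, y) - frag_of (x, y')"
      "x \<in> carrier A" "y \<in> carrier B" "y' \<in> carrier B"
  | c x y where "r = frag_of (c \<odot>\<^bsub>A\<^esub> x, y) - frag_of (x, c \<odot>\<^bsub>B\<^esub> y)"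
      "c \<in> carrier K" "x \<in> carrier A" "y \<in> carrier B"
  using assms unfolding tensor_rels_def by blast

lemma tensor_rels1:
  "\<lbrakk>x \<in> carrier A; x' \<in> carrier A; y \<in> carrier B\<rbrakk> \<Longrightarrow>
    frag_of (x \<oplus>\<^bsub>A\<^esub> x', y) - frag_of (x, y) - frag_of (x', y) \<in> tensor_rels K A B"
  unfolding tensor_rels_def by blast

lemma tensor_rels2:
  "\<lbrakk>x \<in> carrier A; y \<in> carrier B; y' \<in> carrier B\<rbrakk> \<Longrightarrow>
    frag_of (x, y \<oplus>\<^bsub>B\<^esub> y') - frag_of (x, y) - frag_of (x, y') \<in> tensor_rels K A B"
  unfolding tensor_rels_def by blast

lemma tensor_rels3:
  "\<lbrakk>c \<in> carrier K; x \<in> carrier A; y \<in> carrier B\<rbrakk> \<Longrightarrow>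
    frag_of (c \<odot>\<^bsub>A\<^esub> x, y) - frag_of (x, c \<odot>\<^bsub>B\<^esub> y) \<in> tensor_rels K A B"
  unfolding tensor_rels_def by blast

locale tensor_algebras = A: algebra_over K A + B: algebra_over K B
  for K :: "('k, 'x) ring_scheme" and A :: "('k, 'a) module" and B :: "('k, 'b) module"
begin

abbreviation "T \<equiv> tensor_algebra K A B"

sublocale presented_group "carrier A \<times> carrier B" "tensor_rels K A B" T
proof
  fix r assume "r \<in> tensor_rels K A B"
  then show "Poly_Mapping.keys r \<subseteq> carrier A \<times> carrier B"
  proof (cases rule: tensor_relsE)
    case (1 x x' y)
    then show ?thesis by (simp only:) (rule keys_frag_diff3, simp_all)
  next
    case (2 x y y')
    then show ?thesis by (simp only:) (rule keys_frag_diff3, simp_all)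
  next
    case (3 c x y)
    then show ?thesis by (simp only:) (rule keys_frag_diff, simp_all)
  qed
qed (simp_all add: tensor_algebra_def Let_def)

text \<open>The bilinear map on the free abelian group that underlies the product of T. The outer
  extension is over the right factor, as in \<open>tensor_algebra\<close>.\<close>

definition bil :: "('a \<times> 'b \<Rightarrow>\<^sub>0 int) \<Rightarrow> ('a \<times> 'b \<Rightarrow>\<^sub>0 int) \<Rightarrow> ('a \<times> 'b \<Rightarrow>\<^sub>0 int)" where
  "bil u v = frag_extend (\<lambda>(x', y'). frag_extend (\<lambda>(x, y). frag_of (x \<otimes>\<^bsub>A\<^esub> x', y \<otimes>\<^bsub>B\<^esub> y')) u) v"

lemma bil_of_of: "bil (frag_of (x, y)) (frag_of (x', y')) = frag_of (x \<otimes>\<^bsub>A\<^esub> x', y \<otimes>\<^bsub>B\<^esub> y')"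
  by (simp add: bil_def)

lemma bil_zero: "bil 0 v = 0" "bil u 0 = 0"
  by (auto simp: bil_def intro: frag_extend_eq_0)

lemma bil_diff: "bil (u - u') v = bil u v - bil u' v" "bil u (v - v') = bil u v - bil u v'"
proof -
  have "frag_extend (\<lambda>k. (case k of (x', y') \<Rightarrow> F x' y') - (case k of (x', y') \<Rightarrow> F' x' y')) v =
     frag_extend (\<lambda>(x', y'). F x' y') v - frag_extend (\<lambda>(x', y'). F' x' y') v"
    for F F' :: "'a \<Rightarrow> 'b \<Rightarrow> 'a \<times> 'b \<Rightarrow>\<^sub>0 int"
    by (rule frag_extend_fun_diff)
  then show "bil (u - u') v = bil u v - bil u' v"
    by (simp add: bil_def frag_extend_diff case_prod_unfold)
qed (simp add: bil_def frag_extend_diff)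

lemma bil_add: "bil (u + u') v = bil u v + bil u' v" "bil u (v + v') = bil u v + bil u v'"
  using bil_diff(1)[of "u + u'" u' v] bil_diff(2)[of u "v + v'" v'] by (simp_all add: algebra_simps)

lemma bil_keys:
  assumes "Poly_Mapping.keys u \<subseteq> carrier A \<times> carrier B" "Poly_Mapping.keys v \<subseteq> carrier A \<times> carrier B"
  shows "Poly_Mapping.keys (bil u v) \<subseteq> carrier A \<times> carrier B"
  unfolding bil_def
proof (rule frag_extend_keys[OF assms(2)])
  fix k assume "k \<in> carrier A \<times> carrier B"
  then obtain p q where k: "k = (p, q)" "p \<in> carrier A" "q \<in> carrier B" by auto
  then show "Poly_Mapping.keys (case k of (p, q) \<Rightarrow>
      frag_extend (\<lambda>(x, y). frag_of (x \<otimes>\<^bsub>A\<^esub> p, y \<otimes>\<^bsub>B\<^esub> q)) u) \<subseteq> carrier A \<times> carrier B"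
    using frag_extend_keys[OF assms(1), of "\<lambda>(x, y). frag_of (x \<otimes>\<^bsub>A\<^esub> p, y \<otimes>\<^bsub>B\<^esub> q)"] by auto
qed

text \<open>By linearity u may be taken to be a pure tensor, and a pure tensor times a relation is
  again a relation.\<close>

lemma bil_rel_right:
  assumes "Poly_Mapping.keys u \<subseteq> carrier A \<times> carrier B" and r: "r \<in> tensor_rels K A B"
  shows "bil u r \<in> H"
proof (rule free_Abelian_group_induct[OF assms(1)])
  fix k assume "k \<in> carrier A \<times> carrier B"
  then obtain p q where k: "k = (p, q)" "p \<in> carrier A" "q \<in> carrier B" by auto
  from r have "bil (frag_of k) r \<in> tensor_rels K A B"
  proof (cases rule: tensor_relsE)
    case (1 x x' y)
    then show ?thesis using k tensor_rels1[of "p \<otimes>\<^bsub>A\<^esub> x" A "p \<otimes>\<^bsub>A\<^esub> x'" "q \<otimes>\<^bsub>B\<^esub> y" B K]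
      by (simp add: bil_diff bil_of_of A.r_distr)
  next
    case (2 x y y')
    then show ?thesis using k tensor_rels2[of "p \<otimes>\<^bsub>A\<^esub> x" A "q \<otimes>\<^bsub>B\<^esub> y" B "q \<otimes>\<^bsub>B\<^esub> y'" K]
      by (simp add: bil_diff bil_of_of B.r_distr)
  next
    case (3 c x y)
    then show ?thesis using k tensor_rels3[of c K "p \<otimes>\<^bsub>A\<^esub> x" A "q \<otimes>\<^bsub>B\<^esub> y" B]
      by (simp add: bil_diff bil_of_of A.smult_mult_right B.smult_mult_right)
  qed
  then show "bil (frag_of k) r \<in> H" by (rule H_rel)
qed (auto simp: bil_zero bil_diff H_zero H_diff)

text \<open>All of H is treated here, not only the relations, because in the product the left
  argument runs through a whole coset. On the right, \<open>coset_map_cls\<close> makes the passage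
  from relations to H.\<close>

lemma bil_H_left:
  assumes "Poly_Mapping.keys v \<subseteq> carrier A \<times> carrier B" and h: "h \<in> H"
  shows "bil h v \<in> H"
proof (rule free_Abelian_group_induct[OF assms(1)])
  fix k assume "k \<in> carrier A \<times> carrier B"
  then obtain p q where k: "k = (p, q)" "p \<in> carrier A" "q \<in> carrier B" by auto
  have "bil r (frag_of k) \<in> tensor_rels K A B" if "r \<in> tensor_rels K A B" for r
    using that
  proof (cases rule: tensor_relsE)
    case (1 x x' y)
    then show ?thesis using k tensor_rels1[of "x \<otimes>\<^bsub>A\<^esub> p" A "x' \<otimes>\<^bsub>A\<^esub> p" "y \<otimes>\<^bsub>B\<^esub> q" B K]
      by (simp add: bil_diff bil_of_of A.l_distr)
  next
    case (2 x y y')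
    then show ?thesis using k tensor_rels2[of "x \<otimes>\<^bsub>A\<^esub> p" A "y \<otimes>\<^bsub>B\<^esub> q" B "y' \<otimes>\<^bsub>B\<^esub> q" K]
      by (simp add: bil_diff bil_of_of B.l_distr)
  next
    case (3 c x y)
    then show ?thesis using k tensor_rels3[of c K "x \<otimes>\<^bsub>A\<^esub> p" A "y \<otimes>\<^bsub>B\<^esub> q" B]
      by (simp add: bil_diff bil_of_of A.smult_mult_left B.smult_mult_left)
  qed
  moreover have "bil u (frag_of k) = frag_extend (\<lambda>(x, y). frag_of (x \<otimes>\<^bsub>A\<^esub> p, y \<otimes>\<^bsub>B\<^esub> q)) u" for u
    by (simp add: bil_def k)
  ultimately show "bil h (frag_of k) \<in> H" using frag_extend_H[OF H_rel h] by simp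
qed (auto simp: bil_zero bil_diff H_zero H_diff)

text \<open>The product is defined as a union over the representatives of the left factor; it is a
  single coset because every representative contributes the same one.\<close>

lemma mult_cls:
  assumes u: "Poly_Mapping.keys u \<subseteq> carrier A \<times> carrier B" and v: "Poly_Mapping.keys v \<subseteq> carrier A \<times> carrier B"
  shows "cls u \<otimes>\<^bsub>T\<^esub> cls v = cls (bil u v)"
proof -
  have "coset_map G H (\<lambda>v. bil w v) (cls v) = cls (bil u v)" if w: "w \<in> cls u" for w
  proof -
    have wu: "w - u \<in> H" using w by (simp add: mem_cls)
    \<comment> \<open>A representative w is supported on pairs of carrier elements, being the sum of
      u and an element of H.\<close>
    have "Poly_Mapping.keys ((w - u) + u) \<subseteq> carrier A \<times> carrier B"
      using keys_add[of "w - u" u] H_keys[OF wu] u by blast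
    then have kw: "Poly_Mapping.keys w \<subseteq> carrier A \<times> carrier B" by simp
    have "coset_map G H (\<lambda>v. bil w v) (cls v) = cls (bil w v)"
      unfolding bil_def
      by (rule coset_map_cls) (use bil_rel_right[OF kw] in \<open>simp add: bil_def\<close>)
    moreover have "bil w v - bil u v \<in> H" using bil_H_left[OF v wu] by (simp add: bil_diff)
    ultimately show ?thesis by (simp add: cls_eq)
  qed
  moreover have "u \<in> cls u" by (simp add: mem_cls H_zero)
  ultimately have "(\<Union>w\<in>cls u. coset_map G H (\<lambda>v. bil w v) (cls v)) = cls (bil u v)" by blast
  then show ?thesis by (simp add: tensor_algebra_def Let_def bil_def)
qed

lemma gen_mult:
  assumes "x \<in> carrier A" "y \<in> carrier B" "x' \<in> carrier A" "y' \<in> carrier B"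
  shows "gen (x, y) \<otimes>\<^bsub>T\<^esub> gen (x', y') = gen (x \<otimes>\<^bsub>A\<^esub> x', y \<otimes>\<^bsub>B\<^esub> y')"
  unfolding gen_def using assms by (subst mult_cls) (auto simp: bil_of_of)

lemma one_T: "\<one>\<^bsub>T\<^esub> = gen (\<one>\<^bsub>A\<^esub>, \<one>\<^bsub>B\<^esub>)"
  by (simp add: tensor_algebra_def Let_def gen_def cls_def)

lemma mult_hom_right:
  assumes "U \<in> carrier T"
  shows "add_hom T T (\<lambda>V. U \<otimes>\<^bsub>T\<^esub> V)"
proof (rule add_homI)
  obtain u where u: "Poly_Mapping.keys u \<subseteq> carrier A \<times> carrier B" "U = cls u" using assms by (rule carE)
  show "U \<otimes>\<^bsub>T\<^esub> V \<in> carrier T" if V: "V \<in> carrier T" for V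
  proof -
    obtain v where "Poly_Mapping.keys v \<subseteq> carrier A \<times> carrier B" "V = cls v" using V by (rule carE)
    then show ?thesis using u by (simp add: mult_cls cls_closed bil_keys)
  qed
  show "U \<otimes>\<^bsub>T\<^esub> (V \<oplus>\<^bsub>T\<^esub> W) = U \<otimes>\<^bsub>T\<^esub> V \<oplus>\<^bsub>T\<^esub> U \<otimes>\<^bsub>T\<^esub> W" if V: "V \<in> carrier T" and W: "W \<in> carrier T" for V W
  proof -
    obtain v where v: "Poly_Mapping.keys v \<subseteq> carrier A \<times> carrier B" "V = cls v" using V by (rule carE)
    obtain w where w: "Poly_Mapping.keys w \<subseteq> carrier A \<times> carrier B" "W = cls w" using W by (rule carE)
    have "Poly_Mapping.keys (v + w) \<subseteq> carrier A \<times> carrier B" using v w keys_add[of v w] by blast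
    then show ?thesis using u v w by (simp add: cls_add mult_cls bil_add)
  qed
qed

lemma mult_hom_left:
  assumes "U \<in> carrier T"
  shows "add_hom T T (\<lambda>V. V \<otimes>\<^bsub>T\<^esub> U)"
proof (rule add_homI)
  obtain u where u: "Poly_Mapping.keys u \<subseteq> carrier A \<times> carrier B" "U = cls u" using assms by (rule carE)
  show "V \<otimes>\<^bsub>T\<^esub> U \<in> carrier T" if V: "V \<in> carrier T" for V
    using add_hom_closed[OF mult_hom_right[OF V] assms] .
  show "(V \<oplus>\<^bsub>T\<^esub> W) \<otimes>\<^bsub>T\<^esub> U = V \<otimes>\<^bsub>T\<^esub> U \<oplus>\<^bsub>T\<^esub> W \<otimes>\<^bsub>T\<^esub> U" if V: "V \<in> carrier T" and W: "W \<in> carrier T" for V W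
  proof -
    obtain v where v: "Poly_Mapping.keys v \<subseteq> carrier A \<times> carrier B" "V = cls v" using V by (rule carE)
    obtain w where w: "Poly_Mapping.keys w \<subseteq> carrier A \<times> carrier B" "W = cls w" using W by (rule carE)
    have "Poly_Mapping.keys (v + w) \<subseteq> carrier A \<times> carrier B" using v w keys_add[of v w] by blast
    then show ?thesis using u v w by (simp add: cls_add mult_cls bil_add)
  qed
qed

lemma mult_closed: "U \<in> carrier T \<Longrightarrow> V \<in> carrier T \<Longrightarrow> U \<otimes>\<^bsub>T\<^esub> V \<in> carrier T"
  by (rule add_hom_closed[OF mult_hom_right])

text \<open>Both sides are additive in each variable, so W, V and U are replaced by pure tensors in
  turn, and associativity in A and B remains.\<close>

lemma mult_assoc:
  assumes U: "U \<in> carrier T" and V: "V \<in> carrier T" and W: "W \<in> carrier T"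
  shows "U \<otimes>\<^bsub>T\<^esub> V \<otimes>\<^bsub>T\<^esub> W = U \<otimes>\<^bsub>T\<^esub> (V \<otimes>\<^bsub>T\<^esub> W)"
proof -
  have 1: "gen k \<otimes>\<^bsub>T\<^esub> gen l \<otimes>\<^bsub>T\<^esub> W = gen k \<otimes>\<^bsub>T\<^esub> (gen l \<otimes>\<^bsub>T\<^esub> W)"
    if k: "k \<in> carrier A \<times> carrier B" and l: "l \<in> carrier A \<times> carrier B" for k l
  proof (rule add_hom_eqI[OF abelian _ _ _ W])
    show "add_hom T T (\<lambda>W. gen k \<otimes>\<^bsub>T\<^esub> gen l \<otimes>\<^bsub>T\<^esub> W)"
      by (intro mult_hom_right mult_closed gen_closed k l)
    show "add_hom T T (\<lambda>W. gen k \<otimes>\<^bsub>T\<^esub> (gen l \<otimes>\<^bsub>T\<^esub> W))"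
      by (intro add_hom_comp[OF mult_hom_right mult_hom_right] gen_closed k l)
    show "gen k \<otimes>\<^bsub>T\<^esub> gen l \<otimes>\<^bsub>T\<^esub> gen m = gen k \<otimes>\<^bsub>T\<^esub> (gen l \<otimes>\<^bsub>T\<^esub> gen m)"
      if "m \<in> carrier A \<times> carrier B" for m
      using k l that by (auto simp: gen_mult A.m_assoc B.m_assoc)
  qed
  have 2: "gen k \<otimes>\<^bsub>T\<^esub> V \<otimes>\<^bsub>T\<^esub> W = gen k \<otimes>\<^bsub>T\<^esub> (V \<otimes>\<^bsub>T\<^esub> W)" if k: "k \<in> carrier A \<times> carrier B" for k
  proof (rule add_hom_eqI[OF abelian _ _ _ V])
    show "add_hom T T (\<lambda>V. gen k \<otimes>\<^bsub>T\<^esub> V \<otimes>\<^bsub>T\<^esub> W)"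
      by (intro add_hom_comp[OF mult_hom_right mult_hom_left] gen_closed k W)
    show "add_hom T T (\<lambda>V. gen k \<otimes>\<^bsub>T\<^esub> (V \<otimes>\<^bsub>T\<^esub> W))"
      by (intro add_hom_comp[OF mult_hom_left mult_hom_right] gen_closed k W)
  qed (rule 1[OF k])
  show ?thesis
  proof (rule add_hom_eqI[OF abelian _ _ _ U])
    show "add_hom T T (\<lambda>U. U \<otimes>\<^bsub>T\<^esub> V \<otimes>\<^bsub>T\<^esub> W)"
      by (intro add_hom_comp[OF mult_hom_left mult_hom_left] V W)
    show "add_hom T T (\<lambda>U. U \<otimes>\<^bsub>T\<^esub> (V \<otimes>\<^bsub>T\<^esub> W))"
      by (intro mult_hom_left mult_closed V W)
  qed (rule 2)
qed

lemma ring_T: "ring T"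
proof (rule ringI[OF abelian])
  have one: "\<one>\<^bsub>T\<^esub> \<in> carrier T" unfolding one_T by (rule gen_closed) simp
  have id: "add_hom T T (\<lambda>U. U)" by (simp add: add_hom_def)
  show "monoid T"
  proof (rule monoidI)
    fix U assume U: "U \<in> carrier T"
    show "\<one>\<^bsub>T\<^esub> \<otimes>\<^bsub>T\<^esub> U = U"
      by (rule add_hom_eqI[OF abelian mult_hom_right[OF one] id _ U]) (auto simp: one_T gen_mult)
    show "U \<otimes>\<^bsub>T\<^esub> \<one>\<^bsub>T\<^esub> = U"
      by (rule add_hom_eqI[OF abelian mult_hom_left[OF one] id _ U]) (auto simp: one_T gen_mult)
  qed (fact one mult_closed mult_assoc)+
qed (rule add_hom_add[OF mult_hom_left] add_hom_add[OF mult_hom_right]; assumption)+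

lemma gen_add_left:
  "\<lbrakk>x \<in> carrier A; x' \<in> carrier A; y \<in> carrier B\<rbrakk> \<Longrightarrow> gen (x \<oplus>\<^bsub>A\<^esub> x', y) = gen (x, y) \<oplus>\<^bsub>T\<^esub> gen (x', y)"
proof -
  assume "x \<in> carrier A" "x' \<in> carrier A" "y \<in> carrier B"
  then have "frag_of (x \<oplus>\<^bsub>A\<^esub> x', y) - frag_of (x, y) - frag_of (x', y) \<in> H"
    by (intro H_rel tensor_rels1)
  then show ?thesis unfolding gen_def cls_add cls_eq by (simp add: diff_diff_eq)
qed

text \<open>The copy of K in T; it takes the place of F in \<open>fspanned\<close>.\<close>

definition scalars :: "('a \<times> 'b \<Rightarrow>\<^sub>0 int) set set" where
  "scalars = (\<lambda>c. gen (c \<odot>\<^bsub>A\<^esub> \<one>\<^bsub>A\<^esub>, \<one>\<^bsub>B\<^esub>)) ` carrier K"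

text \<open>The map from c to c1 \<otimes> 1 is a ring homomorphism defined on a field, so a nonzero
  value has a nonzero argument, and the inverse of the argument supplies the inverse of the
  value.\<close>

lemma division_subset_scalars: "division_subset T scalars"
proof -
  interpret T: ring T by (rule ring_T)
  let ?s = "\<lambda>c. gen (c \<odot>\<^bsub>A\<^esub> \<one>\<^bsub>A\<^esub>, \<one>\<^bsub>B\<^esub>)"
  have cl: "?s c \<in> carrier T" if "c \<in> carrier K" for c using that by (intro gen_closed) auto
  have add: "?s (c \<oplus>\<^bsub>K\<^esub> d) = ?s c \<oplus>\<^bsub>T\<^esub> ?s d" if "c \<in> carrier K" "d \<in> carrier K" for c d
    using that by (simp add: A.V.smult_l_distr gen_add_left)
  have mult: "?s (c \<otimes>\<^bsub>K\<^esub> d) = ?s c \<otimes>\<^bsub>T\<^esub> ?s d" if "c \<in> carrier K" "d \<in> carrier K" for c d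
    using that by (simp add: gen_mult A.smult_mult_left A.V.smult_assoc1)
  have one: "?s \<one>\<^bsub>K\<^esub> = \<one>\<^bsub>T\<^esub>" by (simp add: one_T)
  have zero: "?s \<zero>\<^bsub>K\<^esub> = \<zero>\<^bsub>T\<^esub>"
  proof -
    have "?s \<zero>\<^bsub>K\<^esub> \<oplus>\<^bsub>T\<^esub> ?s \<zero>\<^bsub>K\<^esub> = ?s \<zero>\<^bsub>K\<^esub> \<oplus>\<^bsub>T\<^esub> \<zero>\<^bsub>T\<^esub>"
      using add[of "\<zero>\<^bsub>K\<^esub>" "\<zero>\<^bsub>K\<^esub>"] cl[of "\<zero>\<^bsub>K\<^esub>"] by simp
    then show ?thesis using cl[of "\<zero>\<^bsub>K\<^esub>"] M.add.l_cancel by blast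
  qed
  have minus: "\<ominus>\<^bsub>T\<^esub> ?s c = ?s (\<ominus>\<^bsub>K\<^esub> c)" if "c \<in> carrier K" for c
    using that add[of "\<ominus>\<^bsub>K\<^esub> c" c] zero by (intro M.minus_equality cl) (auto simp: A.K.l_neg)
  have inv: "\<exists>d \<in> carrier K. ?s d \<otimes>\<^bsub>T\<^esub> ?s c = \<one>\<^bsub>T\<^esub>" if "c \<in> carrier K" "?s c \<noteq> \<zero>\<^bsub>T\<^esub>" for c
  proof -
    have "c \<noteq> \<zero>\<^bsub>K\<^esub>"
    proof
      assume "c = \<zero>\<^bsub>K\<^esub>"
      then have "?s c = \<zero>\<^bsub>T\<^esub>" using zero by (simp only:)
      then show False using that(2) by (rule notE[rotated])
    qed
    then have "c \<in> Units K" using that(1) A.K.field_Units by blast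
    then have d: "inv\<^bsub>K\<^esub> c \<in> carrier K" "inv\<^bsub>K\<^esub> c \<otimes>\<^bsub>K\<^esub> c = \<one>\<^bsub>K\<^esub>"
      by (rule A.K.Units_inv_closed, rule A.K.Units_l_inv)
    have "?s (inv\<^bsub>K\<^esub> c) \<otimes>\<^bsub>T\<^esub> ?s c = \<one>\<^bsub>T\<^esub>"
      using mult[OF d(1) that(1)] one unfolding d(2) by (rule trans[OF sym])
    then show ?thesis using d(1) by blast
  qed
  have sI: "?s c \<in> scalars" if "c \<in> carrier K" for c unfolding scalars_def using that by (rule imageI)
  have sE: "\<exists>c \<in> carrier K. U = ?s c" if "U \<in> scalars" for U using that unfolding scalars_def by (rule imageE) blast
  show ?thesis
    unfolding division_subset_def
  proof (intro conjI ballI impI)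
    show "scalars \<subseteq> carrier T" using cl sE by blast
    show "\<zero>\<^bsub>T\<^esub> \<in> scalars" unfolding zero[symmetric] by (rule sI) simp
    show "\<one>\<^bsub>T\<^esub> \<in> scalars" unfolding one[symmetric] by (rule sI) simp
  next
    fix U V assume "U \<in> scalars" "V \<in> scalars"
    then obtain c d where cd: "c \<in> carrier K" "U = ?s c" "d \<in> carrier K" "V = ?s d" using sE by meson
    show "U \<oplus>\<^bsub>T\<^esub> V \<in> scalars" unfolding cd(2,4) add[OF cd(1,3), symmetric]
      by (rule sI) (use cd in simp)
    show "U \<otimes>\<^bsub>T\<^esub> V \<in> scalars" unfolding cd(2,4) mult[OF cd(1,3), symmetric]
      by (rule sI) (use cd in simp)
  next
    fix U assume "U \<in> scalars"
    then obtain c where c: "c \<in> carrier K" "U = ?s c" using sE by meson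
    show "\<ominus>\<^bsub>T\<^esub> U \<in> scalars" unfolding c(2) minus[OF c(1)] by (rule sI) (use c in simp)
    assume "U \<noteq> \<zero>\<^bsub>T\<^esub>"
    then show "\<exists>V\<in>scalars. V \<otimes>\<^bsub>T\<^esub> U = \<one>\<^bsub>T\<^esub>" using inv[OF c(1)] sI unfolding c(2) by meson
  qed
qed

end

section \<open>Bimodules as modules over the enveloping algebra\<close>

text \<open>Equal actions of K from both sides are what turns an R-S-bimodule into a module over R
  \<otimes> S^op. A bimodule record has no action of K of its own, so the condition is phrased
  through the elements c1 of R and of S.\<close>

locale central_bimodule = R: algebra_over K R + S: algebra_over K S + bimodule R S M
  for K :: "('k, 'x) ring_scheme" and R :: "('k, 'a) module" and S :: "('k, 'b) module"
    and M :: "('a, 'b, 'm) bimodule" +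
  assumes central: "\<lbrakk>c \<in> carrier K; x \<in> carrier M\<rbrakk> \<Longrightarrow>
    (c \<odot>\<^bsub>R\<^esub> \<one>\<^bsub>R\<^esub>) \<odot>\<^bsub>M\<^esub> x = x \<odot>r\<^bsub>M\<^esub> (c \<odot>\<^bsub>S\<^esub> \<one>\<^bsub>S\<^esub>)"
begin

sublocale T: tensor_algebras K R "opp S"
  by (intro tensor_algebras.intro R.algebra_over_axioms algebra_over_opp S.algebra_over_axioms)

lemma opp_simps [simp]: "b \<in> carrier (opp S) \<longleftrightarrow> b \<in> carrier S" "\<one>\<^bsub>opp S\<^esub> = \<one>\<^bsub>S\<^esub>"
  by (simp_all add: opp_def)

lemma abelian_M: "abelian_group M"
  by (rule M.abelian_group_axioms)

text \<open>For fixed x, the expression a x b is additive in a and in b and balanced over K, so the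
  universal property applies.\<close>

lemma act_exists:
  assumes x: "x \<in> carrier M"
  shows "\<exists>f. add_hom T.T M f \<and> (\<forall>a \<in> carrier R. \<forall>b \<in> carrier S. f (T.gen (a, b)) = (a \<odot>\<^bsub>M\<^esub> x) \<odot>r\<^bsub>M\<^esub> b)"
proof -
  let ?\<phi> = "\<lambda>(a, b). (a \<odot>\<^bsub>M\<^esub> x) \<odot>r\<^bsub>M\<^esub> b"
  have cl: "(a \<odot>\<^bsub>M\<^esub> x) \<odot>r\<^bsub>M\<^esub> b \<in> carrier M" if "a \<in> carrier R" "b \<in> carrier S" for a b
    using that x by (simp add: rsmult_closed)
  have cancel: "u \<oplus>\<^bsub>M\<^esub> v \<ominus>\<^bsub>M\<^esub> u \<ominus>\<^bsub>M\<^esub> v = \<zero>\<^bsub>M\<^esub>" if uv: "u \<in> carrier M" "v \<in> carrier M" for u v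
  proof -
    have "u \<oplus>\<^bsub>M\<^esub> v \<ominus>\<^bsub>M\<^esub> u = v"
      using uv by (simp add: a_minus_def M.a_comm[of u v] M.a_assoc M.r_neg)
    then show ?thesis using uv by (simp add: M.minus_eq_zero_iff)
  qed
  obtain f where f: "add_hom T.T M f" "\<And>k. k \<in> carrier R \<times> carrier (opp S) \<Longrightarrow> f (T.gen k) = ?\<phi> k"
  proof (rule T.lift[OF abelian_M, of ?\<phi>])
    fix k assume "k \<in> carrier R \<times> carrier (opp S)"
    then show "?\<phi> k \<in> carrier M" using cl by auto
  next
    fix h r
    assume r: "r \<in> tensor_rels K R (opp S)"
      and hd: "\<And>u v. Poly_Mapping.keys u \<subseteq> carrier R \<times> carrier (opp S) \<Longrightarrow>
        Poly_Mapping.keys v \<subseteq> carrier R \<times> carrier (opp S) \<Longrightarrow> h (u - v) = h u \<ominus>\<^bsub>M\<^esub> h v"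
      and hg: "\<And>k. k \<in> carrier R \<times> carrier (opp S) \<Longrightarrow> h (frag_of k) = ?\<phi> k"
    have h2: "h (frag_of k - frag_of l) = h (frag_of k) \<ominus>\<^bsub>M\<^esub> h (frag_of l)"
      if "k \<in> carrier R \<times> carrier (opp S)" "l \<in> carrier R \<times> carrier (opp S)" for k l
      by (rule hd) (use that in simp_all)
    have h3: "h (frag_of k - frag_of l - frag_of m) = h (frag_of k) \<ominus>\<^bsub>M\<^esub> h (frag_of l) \<ominus>\<^bsub>M\<^esub> h (frag_of m)"
      if kl: "k \<in> carrier R \<times> carrier (opp S)" "l \<in> carrier R \<times> carrier (opp S)"
        and m: "m \<in> carrier R \<times> carrier (opp S)" for k l m
      using hd[of "frag_of k - frag_of l" "frag_of m"] keys_frag_diff[OF kl] h2[OF kl] m by simp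
    from r show "h r = \<zero>\<^bsub>M\<^esub>"
    proof (cases rule: tensor_relsE)
      case (1 a a' b)
      then have b: "b \<in> carrier S" by simp
      show ?thesis unfolding 1(1)
        using 1(2,3) b x by (simp add: h3 hg smult_l_distr rsmult_l_distr cancel cl)
    next
      case (2 a b b')
      then have b: "b \<in> carrier S" "b' \<in> carrier S" "b \<oplus>\<^bsub>opp S\<^esub> b' = b \<oplus>\<^bsub>S\<^esub> b'" by (simp_all add: opp_def)
      show ?thesis unfolding 2(1) b(3)
        using 2(2) b x by (simp add: h3 hg rsmult_r_distr cancel cl)
    next
      case (3 c a b)
      then have b: "b \<in> carrier S" "c \<odot>\<^bsub>opp S\<^esub> b = c \<odot>\<^bsub>S\<^esub> b" by (simp_all add: opp_def)
      note c = 3(2) and a = 3(3)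
      \<comment> \<open>Centrality enters with the third relation: c is written as the ring element
        c1, moved past a x from left to right, and absorbed into b.\<close>
      have ca: "c \<odot>\<^bsub>R\<^esub> a = (c \<odot>\<^bsub>R\<^esub> \<one>\<^bsub>R\<^esub>) \<otimes>\<^bsub>R\<^esub> a"
        using R.smult_mult_left[OF c, of "\<one>\<^bsub>R\<^esub>" a] a by simp
      have cb: "c \<odot>\<^bsub>S\<^esub> b = (c \<odot>\<^bsub>S\<^esub> \<one>\<^bsub>S\<^esub>) \<otimes>\<^bsub>S\<^esub> b"
        using S.smult_mult_left[OF c, of "\<one>\<^bsub>S\<^esub>" b] b by simp
      have c1: "c \<odot>\<^bsub>R\<^esub> \<one>\<^bsub>R\<^esub> \<in> carrier R" "c \<odot>\<^bsub>S\<^esub> \<one>\<^bsub>S\<^esub> \<in> carrier S"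
        using c R.V.smult_closed S.V.smult_closed by simp_all
      have ax: "a \<odot>\<^bsub>M\<^esub> x \<in> carrier M" using a x by simp
      have "((c \<odot>\<^bsub>R\<^esub> a) \<odot>\<^bsub>M\<^esub> x) \<odot>r\<^bsub>M\<^esub> b = ((c \<odot>\<^bsub>R\<^esub> \<one>\<^bsub>R\<^esub>) \<odot>\<^bsub>M\<^esub> (a \<odot>\<^bsub>M\<^esub> x)) \<odot>r\<^bsub>M\<^esub> b"
        unfolding ca using smult_assoc1[OF c1(1) a x] by simp
      also have "\<dots> = (a \<odot>\<^bsub>M\<^esub> x) \<odot>r\<^bsub>M\<^esub> (c \<odot>\<^bsub>S\<^esub> b)"
        unfolding central[OF c ax] cb using rsmult_assoc[OF ax c1(2) b(1)] by simp
      finally have e: "((c \<odot>\<^bsub>R\<^esub> a) \<odot>\<^bsub>M\<^esub> x) \<odot>r\<^bsub>M\<^esub> b = (a \<odot>\<^bsub>M\<^esub> x) \<odot>r\<^bsub>M\<^esub> (c \<odot>\<^bsub>S\<^esub> b)" .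
      have "c \<odot>\<^bsub>R\<^esub> a \<in> carrier R" "c \<odot>\<^bsub>S\<^esub> b \<in> carrier S"
        using R.V.smult_closed[OF c a] S.V.smult_closed[OF c b(1)] .
      then show ?thesis unfolding 3(1) b(2)
        using a b(1) e cl by (simp add: h2 hg M.minus_eq_zero_iff)
    qed
  qed (rule that)
  then show ?thesis by (intro exI[of _ f]) simp
qed

text \<open>The universal property gives existence only. The choice does not matter on the carrier
  of T, where an additive map is determined by its values on pure tensors.\<close>

definition act :: "('a \<times> 'b \<Rightarrow>\<^sub>0 int) set \<Rightarrow> 'm \<Rightarrow> 'm" where
  "act U x = (SOME f. add_hom T.T M f \<and>
     (\<forall>a \<in> carrier R. \<forall>b \<in> carrier S. f (T.gen (a, b)) = (a \<odot>\<^bsub>M\<^esub> x) \<odot>r\<^bsub>M\<^esub> b)) U"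

text \<open>Carrier, zero and addition are those of M, as \<open>in_add_map\<close> demands for the
  way back to bimodules.\<close>

definition env_module :: "(('a \<times> 'b \<Rightarrow>\<^sub>0 int) set, 'm) module" where
  "env_module = \<lparr>carrier = carrier M, monoid.mult = undefined, one = undefined,
     ring.zero = \<zero>\<^bsub>M\<^esub>, ring.add = ring.add M, smult = act\<rparr>"

lemma act:
  assumes "x \<in> carrier M"
  shows act_hom: "add_hom T.T M (\<lambda>U. act U x)"
    and act_gen: "\<lbrakk>a \<in> carrier R; b \<in> carrier S\<rbrakk> \<Longrightarrow> act (T.gen (a, b)) x = (a \<odot>\<^bsub>M\<^esub> x) \<odot>r\<^bsub>M\<^esub> b"
proof -
  from someI_ex[OF act_exists[OF assms]]
  have *: "add_hom T.T M (\<lambda>U. act U x) \<and>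
      (\<forall>a \<in> carrier R. \<forall>b \<in> carrier S. act (T.gen (a, b)) x = (a \<odot>\<^bsub>M\<^esub> x) \<odot>r\<^bsub>M\<^esub> b)"
    unfolding act_def .
  from * show "add_hom T.T M (\<lambda>U. act U x)" by (rule conjunct1)
  from * show "\<lbrakk>a \<in> carrier R; b \<in> carrier S\<rbrakk> \<Longrightarrow> act (T.gen (a, b)) x = (a \<odot>\<^bsub>M\<^esub> x) \<odot>r\<^bsub>M\<^esub> b" by simp
qed

lemma act_closed: "U \<in> carrier T.T \<Longrightarrow> x \<in> carrier M \<Longrightarrow> act U x \<in> carrier M"
  by (rule add_hom_closed[OF act_hom])

text \<open>The extensions are chosen for each x separately, so additivity in x is not built in.
  Both sides are additive in U, and on pure tensors the equation is distributivity.\<close>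

lemma act_add:
  assumes x: "x \<in> carrier M" and y: "y \<in> carrier M" and U: "U \<in> carrier T.T"
  shows "act U (x \<oplus>\<^bsub>M\<^esub> y) = act U x \<oplus>\<^bsub>M\<^esub> act U y"
proof (rule T.add_hom_eqI[OF abelian_M _ _ _ U])
  show "add_hom T.T M (\<lambda>U. act U (x \<oplus>\<^bsub>M\<^esub> y))" by (rule act_hom) (simp add: x y)
  show "add_hom T.T M (\<lambda>U. act U x \<oplus>\<^bsub>M\<^esub> act U y)"
  proof (rule add_homI)
    show "act U x \<oplus>\<^bsub>M\<^esub> act U y \<in> carrier M" if "U \<in> carrier T.T" for U
      using that x y by (simp add: act_closed)
    show "act (U \<oplus>\<^bsub>T.T\<^esub> V) x \<oplus>\<^bsub>M\<^esub> act (U \<oplus>\<^bsub>T.T\<^esub> V) y = act U x \<oplus>\<^bsub>M\<^esub> act U y \<oplus>\<^bsub>M\<^esub> (act V x \<oplus>\<^bsub>M\<^esub> act V y)"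
      if "U \<in> carrier T.T" "V \<in> carrier T.T" for U V
      using that x y act_closed add_hom_add[OF act_hom[OF x] that] add_hom_add[OF act_hom[OF y] that]
      by (simp add: M.a_ac)
  qed
  fix k assume "k \<in> carrier R \<times> carrier (opp S)"
  then show "act (T.gen k) (x \<oplus>\<^bsub>M\<^esub> y) = act (T.gen k) x \<oplus>\<^bsub>M\<^esub> act (T.gen k) y"
    using x y by (auto simp: act_gen smult_r_distr rsmult_l_distr)
qed

lemma act_hom_right: "U \<in> carrier T.T \<Longrightarrow> add_hom M M (act U)"
  by (rule add_homI) (simp_all add: act_closed act_add)

lemma act_mult:
  assumes x: "x \<in> carrier M" and U: "U \<in> carrier T.T" and V: "V \<in> carrier T.T"
  shows "act (U \<otimes>\<^bsub>T.T\<^esub> V) x = act U (act V x)"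
proof -
  have 1: "act (T.gen k \<otimes>\<^bsub>T.T\<^esub> V) x = act (T.gen k) (act V x)" if k: "k \<in> carrier R \<times> carrier (opp S)" for k
  proof (rule T.add_hom_eqI[OF abelian_M _ _ _ V])
    show "add_hom T.T M (\<lambda>V. act (T.gen k \<otimes>\<^bsub>T.T\<^esub> V) x)"
      by (rule add_hom_comp[OF T.mult_hom_right act_hom]) (use T.gen_closed k x in simp_all)
    show "add_hom T.T M (\<lambda>V. act (T.gen k) (act V x))"
      by (rule add_hom_comp[OF act_hom act_hom_right]) (use T.gen_closed k x in simp_all)
    fix l assume l: "l \<in> carrier R \<times> carrier (opp S)"
    obtain a b a' b' where ab: "k = (a, b)" "a \<in> carrier R" "b \<in> carrier S"
      "l = (a', b')" "a' \<in> carrier R" "b' \<in> carrier S" using k l by auto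
    \<comment> \<open>The product in \<open>opp S\<close> is b' b, the order in which right
      multiplication by b' followed by b composes.\<close>
    have "T.gen k \<otimes>\<^bsub>T.T\<^esub> T.gen l = T.gen (a \<otimes>\<^bsub>R\<^esub> a', b' \<otimes>\<^bsub>S\<^esub> b)"
      using T.gen_mult[of a b a' b'] ab by (simp add: opp_def)
    then show "act (T.gen k \<otimes>\<^bsub>T.T\<^esub> T.gen l) x = act (T.gen k) (act (T.gen l) x)"
      using ab x rsmult_closed by (simp add: act_gen smult_assoc1 rsmult_assoc smult_rsmult)
  qed
  show ?thesis
  proof (rule T.add_hom_eqI[OF abelian_M _ _ _ U])
    show "add_hom T.T M (\<lambda>U. act (U \<otimes>\<^bsub>T.T\<^esub> V) x)"
      by (rule add_hom_comp[OF T.mult_hom_left[OF V] act_hom[OF x]])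
    show "add_hom T.T M (\<lambda>U. act U (act V x))"
      by (rule act_hom) (rule act_closed[OF V x])
  qed (rule 1)
qed

lemma env_left_module: "left_module T.T env_module"
proof (intro left_module.intro left_module_axioms.intro T.ring_T)
  show "abelian_group env_module"
    by (rule abelian_group_transport[OF abelian_M, of id]) (simp_all add: env_module_def)
next
  fix U V x assume UV: "U \<in> carrier T.T" "V \<in> carrier T.T" and x: "x \<in> carrier env_module"
  have x: "x \<in> carrier M" using x by (simp add: env_module_def)
  show "(U \<oplus>\<^bsub>T.T\<^esub> V) \<odot>\<^bsub>env_module\<^esub> x = U \<odot>\<^bsub>env_module\<^esub> x \<oplus>\<^bsub>env_module\<^esub> V \<odot>\<^bsub>env_module\<^esub> x"
    using add_hom_add[OF act_hom[OF x] UV] by (simp add: env_module_def)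
  show "U \<otimes>\<^bsub>T.T\<^esub> V \<odot>\<^bsub>env_module\<^esub> x = U \<odot>\<^bsub>env_module\<^esub> (V \<odot>\<^bsub>env_module\<^esub> x)"
    using act_mult[OF x UV] by (simp add: env_module_def)
next
  fix x assume "x \<in> carrier env_module"
  then show "\<one>\<^bsub>T.T\<^esub> \<odot>\<^bsub>env_module\<^esub> x = x"
    by (simp add: env_module_def T.one_T act_gen rsmult_one)
qed (simp_all add: env_module_def act_closed act_add)

lemma scalar_act:
  assumes c: "c \<in> carrier K" and x: "x \<in> carrier M"
  shows "T.gen (c \<odot>\<^bsub>R\<^esub> \<one>\<^bsub>R\<^esub>, \<one>\<^bsub>opp S\<^esub>) \<odot>\<^bsub>env_module\<^esub> x = (c \<odot>\<^bsub>R\<^esub> \<one>\<^bsub>R\<^esub>) \<odot>\<^bsub>M\<^esub> x"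
proof -
  have "c \<odot>\<^bsub>R\<^esub> \<one>\<^bsub>R\<^esub> \<in> carrier R" using R.V.smult_closed[OF c] by simp
  then show ?thesis using x by (simp add: env_module_def act_gen rsmult_one)
qed

text \<open>The scalar c1 \<otimes> 1 acts on M as c1 does from the left, so a span over K in M
  becomes a span over \<open>T.scalars\<close>.\<close>

lemma env_fspanned:
  assumes S: "finite Y" "Y \<subseteq> carrier M"
    and sp: "carrier M \<subseteq> fspan ((\<lambda>c. c \<odot>\<^bsub>R\<^esub> \<one>\<^bsub>R\<^esub>) ` carrier K) M Y"
  shows "fspanned T.T T.scalars env_module"
proof -
  let ?F = "(\<lambda>c. c \<odot>\<^bsub>R\<^esub> \<one>\<^bsub>R\<^esub>) ` carrier K"
  have F: "?F \<subseteq> carrier R" by (auto intro: R.V.smult_closed)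
  have "x \<in> fspan T.scalars env_module Y" if "x \<in> fspan ?F M Y" for x
    using that
  proof induction
    case zero
    then show ?case using fspan.zero[of env_module T.scalars Y] by (simp add: env_module_def)
  next
    case (add x y)
    then show ?case using fspan.add[of x T.scalars env_module Y y] by (simp add: env_module_def)
  next
    case (smult s x)
    then obtain c where c: "c \<in> carrier K" "s = c \<odot>\<^bsub>R\<^esub> \<one>\<^bsub>R\<^esub>" by blast
    have x: "x \<in> carrier M" using fspan_closed[OF smult(2) S(2) F] .
    have "T.gen (c \<odot>\<^bsub>R\<^esub> \<one>\<^bsub>R\<^esub>, \<one>\<^bsub>opp S\<^esub>) \<in> T.scalars" unfolding T.scalars_def using c(1) by (rule imageI)
    from fspan.smult[OF this smult(3)] show ?case unfolding scalar_act[OF c(1) x] c(2) .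
  qed (rule fspan.gen)
  moreover have "carrier env_module = carrier M" by (simp add: env_module_def)
  ultimately show ?thesis
    unfolding fspanned_def using env_left_module S sp by (intro conjI exI[of _ Y]) auto
qed

end

text \<open>Setting one factor of a \<otimes> b equal to 1 recovers the two one-sided
  actions.\<close>

lemma env_lin_hom_bi_hom:
  assumes M: "central_bimodule K R S M" and N: "central_bimodule K R S N"
    and f: "lin_hom (tensor_algebra K R (opp S)) (central_bimodule.env_module K R S M)
      (central_bimodule.env_module K R S N) f"
  shows "bi_hom R S M N f"
proof -
  interpret M: central_bimodule K R S M by fact
  interpret N: central_bimodule K R S N by fact
  let ?T = "tensor_algebra K R (opp S)"
  have add: "add_hom M N f"
    using f by (simp add: lin_hom_def add_hom_def M.env_module_def N.env_module_def)
  have act: "f (M.act U x) = N.act U (f x)" if "U \<in> carrier ?T" "x \<in> carrier M" for U x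
    using f that by (simp add: lin_hom_def M.env_module_def N.env_module_def)
  have gen: "f ((a \<odot>\<^bsub>M\<^esub> x) \<odot>r\<^bsub>M\<^esub> b) = (a \<odot>\<^bsub>N\<^esub> f x) \<odot>r\<^bsub>N\<^esub> b"
    if "a \<in> carrier R" "b \<in> carrier S" "x \<in> carrier M" for a b x
    using act[of "M.T.gen (a, b)" x] that M.T.gen_closed[of "(a, b)"] M.act_gen[of x a b] N.act_gen[of "f x" a b]
      add_hom_closed[OF add] by simp
  have "f (a \<odot>\<^bsub>M\<^esub> x) = a \<odot>\<^bsub>N\<^esub> f x" if "a \<in> carrier R" "x \<in> carrier M" for a x
    using gen[of a "\<one>\<^bsub>S\<^esub>" x] that add_hom_closed[OF add that(2)] by (simp add: M.rsmult_one N.rsmult_one)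
  moreover have "f (x \<odot>r\<^bsub>M\<^esub> b) = f x \<odot>r\<^bsub>N\<^esub> b" if "b \<in> carrier S" "x \<in> carrier M" for b x
    using gen[of "\<one>\<^bsub>R\<^esub>" b x] that add_hom_closed[OF add that(2)] by simp
  ultimately show ?thesis using add by (simp add: bi_hom_def lin_hom_def)
qed

lemma bimodule_in_add_chain:
  fixes T :: "nat \<Rightarrow> ('a, 'b, 'm) bimodule"
  assumes T: "\<And>i. central_bimodule K R S (T i)"
    and fin: "\<And>i. \<exists>Y. finite Y \<and> Y \<subseteq> carrier (T i) \<and>
      carrier (T i) \<subseteq> fspan ((\<lambda>c. c \<odot>\<^bsub>R\<^esub> \<one>\<^bsub>R\<^esub>) ` carrier K) (T i) Y"
    and nz: "carrier (T 0) \<noteq> {\<zero>\<^bsub>T 0\<^esub>}"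
    and frt: "finite (indec_classes (tensor_algebra K R (opp S)))"
  shows "\<exists>m < card (indec_classes (tensor_algebra K R (opp S))).
    in_add (bi_hom R S) (T (Suc m)) (T ` {..m})"
proof -
  let ?E = "tensor_algebra K R (opp S)" and ?M = "\<lambda>i. central_bimodule.env_module K R S (T i)"
  interpret T0: central_bimodule K R S "T 0" by (rule T)
  have env: "carrier (?M i) = carrier (T i)" "ring.add (?M i) = ring.add (T i)"
    "ring.zero (?M i) = ring.zero (T i)" for i
    using central_bimodule.env_module_def[OF T] by simp_all
  have "fspanned ?E T0.T.scalars (?M i)" for i
    using central_bimodule.env_fspanned[OF T] fin[of i] by blast
  then obtain m where m: "m < card (indec_classes ?E)" "in_add (lin_hom ?E) (?M (Suc m)) (?M ` {..m})"
    using in_add_chain[OF T0.T.division_subset_scalars, of ?M] nz frt env by auto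
  have "in_add (bi_hom R S) (T (Suc m)) (T ` {..m})"
  proof (rule in_add_map[OF m(2) env])
    fix N' assume "N' \<in> ?M ` {..m}"
    then obtain i where "i \<le> m" "N' = ?M i" by auto
    then show "\<exists>N\<in>T ` {..m}. (\<forall>f. lin_hom ?E (?M (Suc m)) N' f \<longrightarrow> bi_hom R S (T (Suc m)) N f) \<and>
        (\<forall>f. lin_hom ?E N' (?M (Suc m)) f \<longrightarrow> bi_hom R S N (T (Suc m)) f)"
      using env_lin_hom_bi_hom[OF T T] by blast
  qed
  then show ?thesis using m(1) by blast
qed

section \<open>Tensor powers\<close>

lemma add_hom_sum:
  assumes "abelian_group N" "add_hom M N f" "add_hom M N g"
  shows "add_hom M N (\<lambda>x. f x \<oplus>\<^bsub>N\<^esub> g x)"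
proof -
  interpret N: abelian_group N by fact
  note f = add_hom_closed[OF assms(2)] and g = add_hom_closed[OF assms(3)]
  show ?thesis
  proof (rule add_homI)
    show "f x \<oplus>\<^bsub>N\<^esub> g x \<in> carrier N" if "x \<in> carrier M" for x using f g that by simp
    show "f (x \<oplus>\<^bsub>M\<^esub> y) \<oplus>\<^bsub>N\<^esub> g (x \<oplus>\<^bsub>M\<^esub> y) = f x \<oplus>\<^bsub>N\<^esub> g x \<oplus>\<^bsub>N\<^esub> (f y \<oplus>\<^bsub>N\<^esub> g y)"
      if "x \<in> carrier M" "y \<in> carrier M" for x y
      using f[OF that(1)] f[OF that(2)] g[OF that(1)] g[OF that(2)]
        add_hom_add[OF assms(2) that] add_hom_add[OF assms(3) that] by (simp add: N.a_ac)
  qed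
qed

lemma tensor_power_relsE:
  assumes "r \<in> tensor_power_rels A B m"
  obtains us x y vs where
      "r = frag_of (us @ (x \<oplus>\<^bsub>A\<^esub> y) # vs) - frag_of (us @ x # vs) - frag_of (us @ y # vs)"
      "set us \<subseteq> carrier A" "x \<in> carrier A" "y \<in> carrier A" "set vs \<subseteq> carrier A" "m = Suc (length us + length vs)"
  | us x b y vs where
      "r = frag_of (us @ (x \<otimes>\<^bsub>A\<^esub> b) # y # vs) - frag_of (us @ x # (b \<otimes>\<^bsub>A\<^esub> y) # vs)"
      "set us \<subseteq> carrier A" "x \<in> carrier A" "b \<in> B" "y \<in> carrier A" "set vs \<subseteq> carrier A"
      "m = Suc (Suc (length us + length vs))"
  using assms unfolding tensor_power_rels_def by force

lemma tensor_power_rels_add: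
  "\<lbrakk>set us \<subseteq> carrier A; x \<in> carrier A; y \<in> carrier A; set vs \<subseteq> carrier A; m = Suc (length us + length vs)\<rbrakk> \<Longrightarrow>
    frag_of (us @ (x \<oplus>\<^bsub>A\<^esub> y) # vs) - frag_of (us @ x # vs) - frag_of (us @ y # vs) \<in> tensor_power_rels A B m"
  unfolding tensor_power_rels_def by (rule UnI1, rule CollectI, intro exI[of _ us] exI[of _ x] exI[of _ y] exI[of _ vs]) simp

lemma tensor_power_rels_bal:
  "\<lbrakk>set us \<subseteq> carrier A; x \<in> carrier A; b \<in> B; y \<in> carrier A; set vs \<subseteq> carrier A;
    m = Suc (Suc (length us + length vs))\<rbrakk> \<Longrightarrow>
    frag_of (us @ (x \<otimes>\<^bsub>A\<^esub> b) # y # vs) - frag_of (us @ x # (b \<otimes>\<^bsub>A\<^esub> y) # vs) \<in> tensor_power_rels A B m"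
  unfolding tensor_power_rels_def
  by (rule UnI2, rule CollectI, intro exI[of _ us] exI[of _ x] exI[of _ b] exI[of _ y] exI[of _ vs]) simp

text \<open>The bound on m guarantees a first and a last factor, on which the two actions
  operate.\<close>

locale tensor_powers = A: algebra_over K A + B: algebra_over K "A\<lparr>carrier := B\<rparr>"
  for K :: "('k, 'x) ring_scheme" and A :: "('k, 'a) module" and B :: "'a set" +
  fixes m :: nat
  assumes sub: "subring B A" and m: "m \<ge> 1"
begin

abbreviation "L \<equiv> {xs. set xs \<subseteq> carrier A \<and> length xs = m}"
abbreviation "Tm \<equiv> tensor_power A B m"

lemma B_sub: "b \<in> B \<Longrightarrow> b \<in> carrier A"
  using subringE(1)[OF sub] by auto

text \<open>B contains 1 and is closed under K. This lets scalars pass every tensor sign and so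
  makes K act centrally on the tensor powers.\<close>

lemma scalar_in_B: "c \<in> carrier K \<Longrightarrow> c \<odot>\<^bsub>A\<^esub> \<one>\<^bsub>A\<^esub> \<in> B"
  using B.V.smult_closed[of c "\<one>\<^bsub>A\<^esub>"] subringE(3)[OF sub] by simp

lemma scalar_mult:
  assumes "c \<in> carrier K" "x \<in> carrier A"
  shows "(c \<odot>\<^bsub>A\<^esub> \<one>\<^bsub>A\<^esub>) \<otimes>\<^bsub>A\<^esub> x = c \<odot>\<^bsub>A\<^esub> x" "x \<otimes>\<^bsub>A\<^esub> (c \<odot>\<^bsub>A\<^esub> \<one>\<^bsub>A\<^esub>) = c \<odot>\<^bsub>A\<^esub> x"
  using A.smult_mult_left[of c "\<one>\<^bsub>A\<^esub>" x] A.smult_mult_right[of c x "\<one>\<^bsub>A\<^esub>"] assms by simp_all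

sublocale presented_group L "tensor_power_rels A B m" Tm
proof
  fix r assume "r \<in> tensor_power_rels A B m"
  then show "Poly_Mapping.keys r \<subseteq> L"
  proof (cases rule: tensor_power_relsE)
    case (1 us x y vs)
    then show ?thesis by (simp only:) (rule keys_frag_diff3, simp_all)
  next
    case (2 us x b y vs)
    then show ?thesis using B_sub[OF 2(4)] by (simp only:) (rule keys_frag_diff, simp_all)
  qed
qed (simp_all add: tensor_power_def Let_def)

section \<open>Pure tensors and the universal property\<close>

lemma gen_add:
  "\<lbrakk>set us \<subseteq> carrier A; x \<in> carrier A; y \<in> carrier A; set vs \<subseteq> carrier A; m = Suc (length us + length vs)\<rbrakk> \<Longrightarrow>
    gen (us @ (x \<oplus>\<^bsub>A\<^esub> y) # vs) = gen (us @ x # vs) \<oplus>\<^bsub>Tm\<^esub> gen (us @ y # vs)"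
  using H_rel[OF tensor_power_rels_add[of us A x y vs m B]]
  unfolding gen_def cls_add cls_eq by (simp add: diff_diff_eq)

lemma gen_bal:
  "\<lbrakk>set us \<subseteq> carrier A; x \<in> carrier A; b \<in> B; y \<in> carrier A; set vs \<subseteq> carrier A;
    m = Suc (Suc (length us + length vs))\<rbrakk> \<Longrightarrow>
    gen (us @ (x \<otimes>\<^bsub>A\<^esub> b) # y # vs) = gen (us @ x # (b \<otimes>\<^bsub>A\<^esub> y) # vs)"
  using H_rel[OF tensor_power_rels_bal[of us A x b B y vs m]]
  unfolding gen_def cls_eq by blast

text \<open>The universal property of the iterated tensor product over B, stated for maps on
  words.\<close>

lemma lift_list:
  assumes N: "abelian_group N" and cl: "\<And>xs. xs \<in> L \<Longrightarrow> \<phi> xs \<in> carrier N"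
    and add: "\<And>us x y vs. \<lbrakk>set us \<subseteq> carrier A; x \<in> carrier A; y \<in> carrier A; set vs \<subseteq> carrier A;
      m = Suc (length us + length vs)\<rbrakk> \<Longrightarrow> \<phi> (us @ (x \<oplus>\<^bsub>A\<^esub> y) # vs) = \<phi> (us @ x # vs) \<oplus>\<^bsub>N\<^esub> \<phi> (us @ y # vs)"
    and bal: "\<And>us x b y vs. \<lbrakk>set us \<subseteq> carrier A; x \<in> carrier A; b \<in> B; y \<in> carrier A; set vs \<subseteq> carrier A;
      m = Suc (Suc (length us + length vs))\<rbrakk> \<Longrightarrow>
      \<phi> (us @ (x \<otimes>\<^bsub>A\<^esub> b) # y # vs) = \<phi> (us @ x # (b \<otimes>\<^bsub>A\<^esub> y) # vs)"
  obtains f where "add_hom Tm N f" "\<And>xs. xs \<in> L \<Longrightarrow> f (gen xs) = \<phi> xs"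
proof (rule lift[OF N cl])
  interpret N: abelian_group N by fact
  fix h r
  assume r: "r \<in> tensor_power_rels A B m"
    and hd: "\<And>u v. Poly_Mapping.keys u \<subseteq> L \<Longrightarrow> Poly_Mapping.keys v \<subseteq> L \<Longrightarrow> h (u - v) = h u \<ominus>\<^bsub>N\<^esub> h v"
    and hg: "\<And>k. k \<in> L \<Longrightarrow> h (frag_of k) = \<phi> k"
  have h2: "h (frag_of k - frag_of l) = \<phi> k \<ominus>\<^bsub>N\<^esub> \<phi> l" if "k \<in> L" "l \<in> L" for k l
    using hd[of "frag_of k" "frag_of l"] that hg[OF that(1)] hg[OF that(2)] by simp
  have h3: "h (frag_of k - frag_of l - frag_of n) = \<phi> k \<ominus>\<^bsub>N\<^esub> \<phi> l \<ominus>\<^bsub>N\<^esub> \<phi> n"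
    if kl: "k \<in> L" "l \<in> L" and n: "n \<in> L" for k l n
    using hd[OF keys_frag_diff[OF kl], of "frag_of n"] h2[OF kl] hg[OF n] n by simp
  from r show "h r = \<zero>\<^bsub>N\<^esub>"
  proof (cases rule: tensor_power_relsE)
    case (1 us x y vs)
    let ?k = "us @ (x \<oplus>\<^bsub>A\<^esub> y) # vs" and ?u = "us @ x # vs" and ?v = "us @ y # vs"
    have L: "?k \<in> L" "?u \<in> L" "?v \<in> L" using 1 by simp_all
    have "\<phi> ?k \<ominus>\<^bsub>N\<^esub> \<phi> ?u = \<phi> ?v"
      using add[OF 1(2-6)] cl[OF L(2)] cl[OF L(3)]
      by (simp add: a_minus_def N.a_comm[of "\<phi> ?u" "\<phi> ?v"] N.a_assoc N.r_neg)
    then show ?thesis unfolding 1(1) h3[OF L] using cl[OF L(3)] by (simp add: N.minus_eq_zero_iff)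
  next
    case (2 us x b y vs)
    have L: "us @ (x \<otimes>\<^bsub>A\<^esub> b) # y # vs \<in> L" "us @ x # (b \<otimes>\<^bsub>A\<^esub> y) # vs \<in> L"
      using 2 B_sub[OF 2(4)] by simp_all
    show ?thesis unfolding 2(1) h2[OF L] using bal[OF 2(2-7)] cl[OF L(2)] by (simp add: N.minus_eq_zero_iff)
  qed
qed (assumption, rule that)

text \<open>Multiplying the first factor sends relations to relations. If the relation involves the
  first factor (\<open>us\<close> is empty), this is distributivity or associativity in A; otherwise
  only a factor outside the relation changes.\<close>

lemma left_action:
  assumes a: "a \<in> carrier A"
  shows smult_hom: "add_hom Tm Tm (\<lambda>U. a \<odot>\<^bsub>Tm\<^esub> U)"
    and smult_gen: "\<lbrakk>x \<in> carrier A; set ys \<subseteq> carrier A; m = Suc (length ys)\<rbrakk> \<Longrightarrow>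
      a \<odot>\<^bsub>Tm\<^esub> gen (x # ys) = gen ((a \<otimes>\<^bsub>A\<^esub> x) # ys)"
proof -
  let ?F = "\<lambda>xs. frag_of ((a \<otimes>\<^bsub>A\<^esub> hd xs) # tl xs)"
  have r: "frag_extend ?F r \<in> H" if "r \<in> tensor_power_rels A B m" for r
  proof (rule H_rel)
    show "frag_extend ?F r \<in> tensor_power_rels A B m"
      using that
    proof (cases rule: tensor_power_relsE)
      case (1 us x y vs)
      show ?thesis
      proof (cases us)
        case Nil
        then show ?thesis using 1 a tensor_power_rels_add[of "[]" A "a \<otimes>\<^bsub>A\<^esub> x" "a \<otimes>\<^bsub>A\<^esub> y" vs m B]
          by (simp add: frag_extend_diff A.r_distr)
      next
        case (Cons u us')
        then show ?thesis using 1 a tensor_power_rels_add[of "(a \<otimes>\<^bsub>A\<^esub> u) # us'" A x y vs m B]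
          by (simp add: frag_extend_diff)
      qed
    next
      case (2 us x b y vs)
      have b: "b \<in> carrier A" using B_sub 2 by blast
      show ?thesis
      proof (cases us)
        case Nil
        then show ?thesis using 2 a b tensor_power_rels_bal[of "[]" A "a \<otimes>\<^bsub>A\<^esub> x" b B y vs m]
          by (simp add: frag_extend_diff A.m_assoc)
      next
        case (Cons u us')
        then show ?thesis using 2 a tensor_power_rels_bal[of "(a \<otimes>\<^bsub>A\<^esub> u) # us'" A x b B y vs m]
          by (simp add: frag_extend_diff)
      qed
    qed
  qed
  have k: "Poly_Mapping.keys (?F xs) \<subseteq> L" if "xs \<in> L" for xs
    using that a m by (cases xs) auto
  have e: "(\<lambda>U. a \<odot>\<^bsub>Tm\<^esub> U) = coset_map G H (frag_extend ?F)"
    by (simp add: tensor_power_def Let_def)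
  show "add_hom Tm Tm (\<lambda>U. a \<odot>\<^bsub>Tm\<^esub> U)" unfolding e by (rule coset_map_hom(1)[OF r k])
  show "a \<odot>\<^bsub>Tm\<^esub> gen (x # ys) = gen ((a \<otimes>\<^bsub>A\<^esub> x) # ys)"
    if "x \<in> carrier A" "set ys \<subseteq> carrier A" "m = Suc (length ys)"
  proof -
    have "x # ys \<in> L" using that by simp
    from coset_map_hom(2)[OF r k this] show ?thesis unfolding fun_cong[OF e] gen_def by simp
  qed
qed

lemma right_action:
  assumes a: "a \<in> carrier A"
  shows rsmult_hom: "add_hom Tm Tm (\<lambda>U. U \<odot>r\<^bsub>Tm\<^esub> a)"
    and rsmult_gen: "\<lbrakk>x \<in> carrier A; set ys \<subseteq> carrier A; m = Suc (length ys)\<rbrakk> \<Longrightarrow>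
      gen (ys @ [x]) \<odot>r\<^bsub>Tm\<^esub> a = gen (ys @ [x \<otimes>\<^bsub>A\<^esub> a])"
proof -
  let ?F = "\<lambda>xs. frag_of (butlast xs @ [last xs \<otimes>\<^bsub>A\<^esub> a])"
  have r: "frag_extend ?F r \<in> H" if "r \<in> tensor_power_rels A B m" for r
  proof (rule H_rel)
    show "frag_extend ?F r \<in> tensor_power_rels A B m"
      using that
    proof (cases rule: tensor_power_relsE)
      case (1 us x y vs)
      show ?thesis
      proof (cases vs rule: rev_cases)
        case Nil
        then show ?thesis using 1 a tensor_power_rels_add[of us A "x \<otimes>\<^bsub>A\<^esub> a" "y \<otimes>\<^bsub>A\<^esub> a" "[]" m B]
          by (simp add: frag_extend_diff A.l_distr)
      next
        case (snoc vs' v)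
        then show ?thesis using 1 a tensor_power_rels_add[of us A x y "vs' @ [v \<otimes>\<^bsub>A\<^esub> a]" m B]
          by (simp add: frag_extend_diff butlast_append)
      qed
    next
      case (2 us x b y vs)
      have b: "b \<in> carrier A" using B_sub 2 by blast
      show ?thesis
      proof (cases vs rule: rev_cases)
        case Nil
        then show ?thesis using 2 a b tensor_power_rels_bal[of us A x b B "y \<otimes>\<^bsub>A\<^esub> a" "[]" m]
          by (simp add: frag_extend_diff A.m_assoc butlast_append)
      next
        case (snoc vs' v)
        then show ?thesis using 2 a tensor_power_rels_bal[of us A x b B y "vs' @ [v \<otimes>\<^bsub>A\<^esub> a]" m]
          by (simp add: frag_extend_diff butlast_append)
      qed
    qed
  qed
  have k: "Poly_Mapping.keys (?F xs) \<subseteq> L" if "xs \<in> L" for xs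
    using that a m by (cases xs rule: rev_cases) auto
  have e: "(\<lambda>U. U \<odot>r\<^bsub>Tm\<^esub> a) = coset_map G H (frag_extend ?F)"
    by (simp add: tensor_power_def Let_def)
  show "add_hom Tm Tm (\<lambda>U. U \<odot>r\<^bsub>Tm\<^esub> a)" unfolding e by (rule coset_map_hom(1)[OF r k])
  show "gen (ys @ [x]) \<odot>r\<^bsub>Tm\<^esub> a = gen (ys @ [x \<otimes>\<^bsub>A\<^esub> a])"
    if "x \<in> carrier A" "set ys \<subseteq> carrier A" "m = Suc (length ys)"
  proof -
    have "ys @ [x] \<in> L" using that by simp
    from coset_map_hom(2)[OF r k this] show ?thesis unfolding fun_cong[OF e] gen_def by simp
  qed
qed

section \<open>Bimodule axioms on pure tensors\<close>

lemma L_Cons: "xs \<in> L \<Longrightarrow> \<exists>x ys. xs = x # ys \<and> x \<in> carrier A \<and> set ys \<subseteq> carrier A \<and> m = Suc (length ys)"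
  using m by (cases xs) auto

lemma L_snoc: "xs \<in> L \<Longrightarrow> \<exists>ys x. xs = ys @ [x] \<and> x \<in> carrier A \<and> set ys \<subseteq> carrier A \<and> m = Suc (length ys)"
  using m by (cases xs rule: rev_cases) auto

lemma id_hom: "add_hom Tm Tm (\<lambda>U. U)"
  by (simp add: add_hom_def)

lemma left_mod: "left_module A Tm"
proof (intro left_module.intro left_module_axioms.intro A.A.ring_axioms abelian)
  fix a U assume a: "a \<in> carrier A" and U: "U \<in> carrier Tm"
  show "a \<odot>\<^bsub>Tm\<^esub> U \<in> carrier Tm" by (rule add_hom_closed[OF smult_hom[OF a] U])
next
  fix a b U assume a: "a \<in> carrier A" and b: "b \<in> carrier A" and U: "U \<in> carrier Tm"
  show "(a \<oplus>\<^bsub>A\<^esub> b) \<odot>\<^bsub>Tm\<^esub> U = a \<odot>\<^bsub>Tm\<^esub> U \<oplus>\<^bsub>Tm\<^esub> b \<odot>\<^bsub>Tm\<^esub> U"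
  proof (rule add_hom_eqI[OF abelian smult_hom add_hom_sum[OF abelian smult_hom smult_hom] _ U])
    fix xs assume "xs \<in> L"
    then obtain x ys where x: "xs = x # ys" "x \<in> carrier A" "set ys \<subseteq> carrier A" "m = Suc (length ys)"
      using L_Cons by blast
    show "(a \<oplus>\<^bsub>A\<^esub> b) \<odot>\<^bsub>Tm\<^esub> gen xs = a \<odot>\<^bsub>Tm\<^esub> gen xs \<oplus>\<^bsub>Tm\<^esub> b \<odot>\<^bsub>Tm\<^esub> gen xs"
      unfolding x(1) smult_gen[OF a x(2-4)] smult_gen[OF b x(2-4)] smult_gen[OF A.A.a_closed[OF a b] x(2-4)]
      using gen_add[of "[]" "a \<otimes>\<^bsub>A\<^esub> x" "b \<otimes>\<^bsub>A\<^esub> x" ys] a b x by (simp add: A.l_distr)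
  qed (use a b in simp_all)
  show "a \<otimes>\<^bsub>A\<^esub> b \<odot>\<^bsub>Tm\<^esub> U = a \<odot>\<^bsub>Tm\<^esub> (b \<odot>\<^bsub>Tm\<^esub> U)"
  proof (rule add_hom_eqI[OF abelian smult_hom add_hom_comp[OF smult_hom smult_hom] _ U])
    fix xs assume "xs \<in> L"
    then obtain x ys where x: "xs = x # ys" "x \<in> carrier A" "set ys \<subseteq> carrier A" "m = Suc (length ys)"
      using L_Cons by blast
    show "a \<otimes>\<^bsub>A\<^esub> b \<odot>\<^bsub>Tm\<^esub> gen xs = a \<odot>\<^bsub>Tm\<^esub> (b \<odot>\<^bsub>Tm\<^esub> gen xs)"
      unfolding x(1) smult_gen[OF A.A.m_closed[OF a b] x(2-4)] smult_gen[OF b x(2-4)]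
        smult_gen[OF a A.A.m_closed[OF b x(2)] x(3,4)] A.A.m_assoc[OF a b x(2)] by (rule refl)
  qed (use a b in simp_all)
next
  fix a U V assume a: "a \<in> carrier A" and U: "U \<in> carrier Tm" and V: "V \<in> carrier Tm"
  show "a \<odot>\<^bsub>Tm\<^esub> (U \<oplus>\<^bsub>Tm\<^esub> V) = a \<odot>\<^bsub>Tm\<^esub> U \<oplus>\<^bsub>Tm\<^esub> a \<odot>\<^bsub>Tm\<^esub> V"
    by (rule add_hom_add[OF smult_hom[OF a] U V])
next
  fix U assume U: "U \<in> carrier Tm"
  show "\<one>\<^bsub>A\<^esub> \<odot>\<^bsub>Tm\<^esub> U = U"
  proof (rule add_hom_eqI[OF abelian smult_hom id_hom _ U])
    fix xs assume "xs \<in> L"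
    then obtain x ys where x: "xs = x # ys" "x \<in> carrier A" "set ys \<subseteq> carrier A" "m = Suc (length ys)"
      using L_Cons by blast
    show "\<one>\<^bsub>A\<^esub> \<odot>\<^bsub>Tm\<^esub> gen xs = gen xs"
      unfolding x(1) smult_gen[OF A.A.one_closed x(2-4)] A.A.l_one[OF x(2)] by (rule refl)
  qed simp
qed

lemma bimod: "bimodule A A Tm"
proof (intro bimodule.intro bimodule_axioms.intro left_mod A.A.ring_axioms)
  fix a U assume a: "a \<in> carrier A" and U: "U \<in> carrier Tm"
  show "U \<odot>r\<^bsub>Tm\<^esub> a \<in> carrier Tm" by (rule add_hom_closed[OF rsmult_hom[OF a] U])
next
  fix a b U assume a: "a \<in> carrier A" and b: "b \<in> carrier A" and U: "U \<in> carrier Tm"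
  show "U \<odot>r\<^bsub>Tm\<^esub> (a \<oplus>\<^bsub>A\<^esub> b) = U \<odot>r\<^bsub>Tm\<^esub> a \<oplus>\<^bsub>Tm\<^esub> U \<odot>r\<^bsub>Tm\<^esub> b"
  proof (rule add_hom_eqI[OF abelian rsmult_hom add_hom_sum[OF abelian rsmult_hom rsmult_hom] _ U])
    fix xs assume "xs \<in> L"
    then obtain x ys where x: "xs = ys @ [x]" "x \<in> carrier A" "set ys \<subseteq> carrier A" "m = Suc (length ys)"
      using L_snoc by blast
    show "gen xs \<odot>r\<^bsub>Tm\<^esub> (a \<oplus>\<^bsub>A\<^esub> b) = gen xs \<odot>r\<^bsub>Tm\<^esub> a \<oplus>\<^bsub>Tm\<^esub> gen xs \<odot>r\<^bsub>Tm\<^esub> b"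
      unfolding x(1) rsmult_gen[OF a x(2-4)] rsmult_gen[OF b x(2-4)] rsmult_gen[OF A.A.a_closed[OF a b] x(2-4)]
      using gen_add[of ys "x \<otimes>\<^bsub>A\<^esub> a" "x \<otimes>\<^bsub>A\<^esub> b" "[]"] a b x by (simp add: A.r_distr)
  qed (use a b in simp_all)
  show "U \<odot>r\<^bsub>Tm\<^esub> (a \<otimes>\<^bsub>A\<^esub> b) = U \<odot>r\<^bsub>Tm\<^esub> a \<odot>r\<^bsub>Tm\<^esub> b"
  proof (rule add_hom_eqI[OF abelian rsmult_hom add_hom_comp[OF rsmult_hom rsmult_hom] _ U])
    fix xs assume "xs \<in> L"
    then obtain x ys where x: "xs = ys @ [x]" "x \<in> carrier A" "set ys \<subseteq> carrier A" "m = Suc (length ys)"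
      using L_snoc by blast
    show "gen xs \<odot>r\<^bsub>Tm\<^esub> (a \<otimes>\<^bsub>A\<^esub> b) = gen xs \<odot>r\<^bsub>Tm\<^esub> a \<odot>r\<^bsub>Tm\<^esub> b"
      unfolding x(1) rsmult_gen[OF A.A.m_closed[OF a b] x(2-4)] rsmult_gen[OF a x(2-4)]
        rsmult_gen[OF b A.A.m_closed[OF x(2) a] x(3,4)] A.A.m_assoc[OF x(2) a b] by (rule refl)
  qed (use a b in simp_all)
next
  fix a U V assume a: "a \<in> carrier A" and U: "U \<in> carrier Tm" and V: "V \<in> carrier Tm"
  show "(U \<oplus>\<^bsub>Tm\<^esub> V) \<odot>r\<^bsub>Tm\<^esub> a = U \<odot>r\<^bsub>Tm\<^esub> a \<oplus>\<^bsub>Tm\<^esub> V \<odot>r\<^bsub>Tm\<^esub> a"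
    by (rule add_hom_add[OF rsmult_hom[OF a] U V])
next
  fix U assume U: "U \<in> carrier Tm"
  show "U \<odot>r\<^bsub>Tm\<^esub> \<one>\<^bsub>A\<^esub> = U"
  proof (rule add_hom_eqI[OF abelian rsmult_hom id_hom _ U])
    fix xs assume "xs \<in> L"
    then obtain x ys where x: "xs = ys @ [x]" "x \<in> carrier A" "set ys \<subseteq> carrier A" "m = Suc (length ys)"
      using L_snoc by blast
    show "gen xs \<odot>r\<^bsub>Tm\<^esub> \<one>\<^bsub>A\<^esub> = gen xs"
      unfolding x(1) rsmult_gen[OF A.A.one_closed x(2-4)] A.A.r_one[OF x(2)] by (rule refl)
  qed simp
next
  fix a U b assume a: "a \<in> carrier A" and U: "U \<in> carrier Tm" and b: "b \<in> carrier A"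
  show "(a \<odot>\<^bsub>Tm\<^esub> U) \<odot>r\<^bsub>Tm\<^esub> b = a \<odot>\<^bsub>Tm\<^esub> (U \<odot>r\<^bsub>Tm\<^esub> b)"
  proof (rule add_hom_eqI[OF abelian add_hom_comp[OF smult_hom[OF a] rsmult_hom[OF b]]
        add_hom_comp[OF rsmult_hom[OF b] smult_hom[OF a]] _ U])
    fix xs assume "xs \<in> L"
    then obtain x ys where x: "xs = x # ys" "x \<in> carrier A" "set ys \<subseteq> carrier A" "m = Suc (length ys)"
      using L_Cons by blast
    show "(a \<odot>\<^bsub>Tm\<^esub> gen xs) \<odot>r\<^bsub>Tm\<^esub> b = a \<odot>\<^bsub>Tm\<^esub> (gen xs \<odot>r\<^bsub>Tm\<^esub> b)"
    \<comment> \<open>For m = 1 both actions meet in the only factor, and associativity in A is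
      needed; otherwise they operate on different factors.\<close>
    proof (cases ys rule: rev_cases)
      case Nil
      then show ?thesis
        using x a b rsmult_gen[OF b, of "a \<otimes>\<^bsub>A\<^esub> x" "[]"] rsmult_gen[OF b, of x "[]"] smult_gen[OF a, of _ "[]"]
        by (simp add: A.m_assoc)
    next
      case (snoc zs z)
      then show ?thesis
        using x a b rsmult_gen[OF b, of z "(a \<otimes>\<^bsub>A\<^esub> x) # zs"] rsmult_gen[OF b, of z "x # zs"]
          smult_gen[OF a, of x "zs @ [z]"] smult_gen[OF a, of x "zs @ [z \<otimes>\<^bsub>A\<^esub> b]"]
        by simp
    qed
  qed
qed

text \<open>A central scalar lies in \<open>B\<close> and can therefore be moved to the first factor.\<close>

lemma gen_scalar:
  assumes c: "c \<in> carrier K"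
  shows "\<lbrakk>set us \<subseteq> carrier A; x \<in> carrier A; set vs \<subseteq> carrier A; m = Suc (length us + length vs)\<rbrakk> \<Longrightarrow>
    gen (us @ (c \<odot>\<^bsub>A\<^esub> x) # vs) = (c \<odot>\<^bsub>A\<^esub> \<one>\<^bsub>A\<^esub>) \<odot>\<^bsub>Tm\<^esub> gen (us @ x # vs)"
proof (induction us arbitrary: x vs rule: rev_induct)
  case Nil
  then show ?case using smult_gen[of "c \<odot>\<^bsub>A\<^esub> \<one>\<^bsub>A\<^esub>" x vs] c scalar_mult by (simp add: A.V.smult_closed)
next
  case (snoc u us)
  have cB: "c \<odot>\<^bsub>A\<^esub> \<one>\<^bsub>A\<^esub> \<in> B" by (rule scalar_in_B[OF c])
  have "gen (us @ u # (c \<odot>\<^bsub>A\<^esub> x) # vs) = gen (us @ (c \<odot>\<^bsub>A\<^esub> u) # x # vs)"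
    using gen_bal[of us u "c \<odot>\<^bsub>A\<^esub> \<one>\<^bsub>A\<^esub>" x vs] snoc.prems c cB scalar_mult by simp
  then show ?case using snoc.IH[of u "x # vs"] snoc.prems by simp
qed

text \<open>Right multiplication by c1 scales the last factor, and \<open>gen_scalar\<close> carries
  this scalar to the front.\<close>

lemma central_T:
  assumes c: "c \<in> carrier K" and U: "U \<in> carrier Tm"
  shows "(c \<odot>\<^bsub>A\<^esub> \<one>\<^bsub>A\<^esub>) \<odot>\<^bsub>Tm\<^esub> U = U \<odot>r\<^bsub>Tm\<^esub> (c \<odot>\<^bsub>A\<^esub> \<one>\<^bsub>A\<^esub>)"
proof -
  have cA: "c \<odot>\<^bsub>A\<^esub> \<one>\<^bsub>A\<^esub> \<in> carrier A" by (rule B_sub[OF scalar_in_B[OF c]])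
  show ?thesis
  proof (rule add_hom_eqI[OF abelian smult_hom[OF cA] rsmult_hom[OF cA] _ U])
    fix xs assume "xs \<in> L"
    then obtain x ys where x: "xs = ys @ [x]" "x \<in> carrier A" "set ys \<subseteq> carrier A" "m = Suc (length ys)"
      using L_snoc by blast
    show "(c \<odot>\<^bsub>A\<^esub> \<one>\<^bsub>A\<^esub>) \<odot>\<^bsub>Tm\<^esub> gen xs = gen xs \<odot>r\<^bsub>Tm\<^esub> (c \<odot>\<^bsub>A\<^esub> \<one>\<^bsub>A\<^esub>)"
      using gen_scalar[OF c, of ys x "[]"] rsmult_gen[OF cA x(2-4)] x scalar_mult(2)[OF c x(2)] by simp
  qed
qed

section \<open>Restriction of the actions to B\<close>

lemma bimod_AB: "bimodule A (A\<lparr>carrier := B\<rparr>) Tm"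
proof -
  interpret bimodule A A Tm by (rule bimod)
  show ?thesis
    by (intro bimodule.intro bimodule_axioms.intro left_mod B.A.ring_axioms)
      (simp_all add: B_sub rsmult_closed rsmult_r_distr rsmult_l_distr rsmult_assoc rsmult_one smult_rsmult)
qed

lemma bimod_BB: "bimodule (A\<lparr>carrier := B\<rparr>) (A\<lparr>carrier := B\<rparr>) Tm"
proof -
  interpret bimodule A "A\<lparr>carrier := B\<rparr>" Tm by (rule bimod_AB)
  have "left_module (A\<lparr>carrier := B\<rparr>) Tm"
    by (intro left_module.intro left_module_axioms.intro B.A.ring_axioms abelian)
      (simp_all add: B_sub smult_l_distr smult_r_distr smult_assoc1)
  then show ?thesis
    by (intro bimodule.intro bimodule_axioms.intro B.A.ring_axioms)
      (use rsmult_closed rsmult_r_distr rsmult_l_distr rsmult_assoc rsmult_one smult_rsmult B_sub in simp_all)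
qed

lemma central_bimodules:
  shows central_AA: "central_bimodule K A A Tm"
    and central_AB: "central_bimodule K A (A\<lparr>carrier := B\<rparr>) Tm"
    and central_BB: "central_bimodule K (A\<lparr>carrier := B\<rparr>) (A\<lparr>carrier := B\<rparr>) Tm"
  by (intro central_bimodule.intro central_bimodule_axioms.intro A.algebra_over_axioms B.algebra_over_axioms
      bimod bimod_AB bimod_BB; simp add: central_T)+

section \<open>Finite dimension and nonvanishing of tensor powers\<close>

lemma gen_zero:
  assumes "set us \<subseteq> carrier A" "set vs \<subseteq> carrier A" "m = Suc (length us + length vs)"
  shows "gen (us @ \<zero>\<^bsub>A\<^esub> # vs) = \<zero>\<^bsub>Tm\<^esub>"
proof -
  let ?g = "gen (us @ \<zero>\<^bsub>A\<^esub> # vs)"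
  have g: "?g \<in> carrier Tm" by (rule gen_closed) (use assms in simp)
  have "?g \<oplus>\<^bsub>Tm\<^esub> ?g = ?g"
    using gen_add[OF assms(1) A.A.zero_closed A.A.zero_closed assms(2,3)] by simp
  then have "?g \<oplus>\<^bsub>Tm\<^esub> ?g = ?g \<oplus>\<^bsub>Tm\<^esub> \<zero>\<^bsub>Tm\<^esub>" using g by (simp only: M.r_zero)
  then show ?thesis using g M.add.l_cancel M.zero_closed by blast
qed

text \<open>If E spans A over K, the words over E span the tensor power: a coefficient in any place
  is central and can be pulled to the front.\<close>

lemma finitely_spanned:
  assumes "fin_gen K A"
  shows "\<exists>Y. finite Y \<and> Y \<subseteq> carrier Tm \<and>
    carrier Tm \<subseteq> fspan ((\<lambda>c. c \<odot>\<^bsub>A\<^esub> \<one>\<^bsub>A\<^esub>) ` carrier K) Tm Y"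
proof -
  interpret LM: left_module A Tm by (rule left_mod)
  let ?F = "(\<lambda>c. c \<odot>\<^bsub>A\<^esub> \<one>\<^bsub>A\<^esub>) ` carrier K"
  obtain E where E: "finite E" "E \<subseteq> carrier A"
    and gE: "\<And>x. x \<in> carrier A \<Longrightarrow> \<exists>c \<in> E \<rightarrow> carrier K. x = (\<Oplus>\<^bsub>A\<^esub>e\<in>E. c e \<odot>\<^bsub>A\<^esub> e)"
    using assms unfolding fin_gen_def by blast
  let ?Y = "gen ` {xs. set xs \<subseteq> E \<and> length xs = m}"
  let ?W = "fspan ?F Tm ?Y"
  have YT: "?Y \<subseteq> carrier Tm"
  proof
    fix U assume "U \<in> ?Y"
    then obtain xs where "U = gen xs" "set xs \<subseteq> E" "length xs = m" by auto
    then show "U \<in> carrier Tm" using gen_closed[of xs] E(2) by simp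
  qed
  \<comment> \<open>The entries are expanded from right to left: \<open>us\<close> is still
    arbitrary and \<open>vs\<close> is already a word over E. Each step writes the last entry of
    \<open>us\<close> as a combination of E, term by term.\<close>
  have gen_W: "gen (us @ vs) \<in> ?W"
    if "set us \<subseteq> carrier A" "set vs \<subseteq> E" "m = length us + length vs" for us vs
    using that
  proof (induction us arbitrary: vs rule: rev_induct)
    case Nil
    have "gen vs \<in> ?Y" by (rule imageI) (use Nil in simp)
    from fspan.gen[of _ ?Y ?F Tm, OF this] show ?case by simp
  next
    case (snoc u us)
    have u: "u \<in> carrier A" and us: "set us \<subseteq> carrier A" and vs: "set vs \<subseteq> carrier A"
      and len: "m = Suc (length us + length vs)"
      using snoc.prems E(2) by auto
    obtain c where c: "c \<in> E \<rightarrow> carrier K" "u = (\<Oplus>\<^bsub>A\<^esub>e\<in>E. c e \<odot>\<^bsub>A\<^esub> e)" using gE[OF u] by blast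
    have "gen (us @ (\<Oplus>\<^bsub>A\<^esub>e\<in>S. c e \<odot>\<^bsub>A\<^esub> e) # vs) \<in> ?W" if "S \<subseteq> E" for S
      using finite_subset[OF that E(1)] that
    proof (induction S rule: finite_induct)
      case empty
      show ?case unfolding A.A.finsum_empty gen_zero[OF us vs len] by (rule fspan.zero)
    next
      case (insert e S)
      have e: "e \<in> E" "e \<in> carrier A" "c e \<in> carrier K" using insert.prems c(1) E(2) by auto
      have fS: "(\<lambda>e. c e \<odot>\<^bsub>A\<^esub> e) \<in> S \<rightarrow> carrier A"
        using insert.prems c(1) E(2) by (auto intro!: A.V.smult_closed)
      have fe: "c e \<odot>\<^bsub>A\<^esub> e \<in> carrier A" using e A.V.smult_closed by blast
      have "gen (us @ e # vs) \<in> ?W" by (rule snoc.IH) (use us e(1) snoc.prems len in auto)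
      then have "(c e \<odot>\<^bsub>A\<^esub> \<one>\<^bsub>A\<^esub>) \<odot>\<^bsub>Tm\<^esub> gen (us @ e # vs) \<in> ?W"
        using e(3) by (intro fspan.smult) auto
      then have 1: "gen (us @ (c e \<odot>\<^bsub>A\<^esub> e) # vs) \<in> ?W"
        unfolding gen_scalar[OF e(3) us e(2) vs len] .
      have 2: "gen (us @ (\<Oplus>\<^bsub>A\<^esub>e\<in>S. c e \<odot>\<^bsub>A\<^esub> e) # vs) \<in> ?W" by (rule insert.IH) (use insert.prems in simp)
      show ?case
        unfolding A.A.finsum_insert[OF insert(1,2) fS fe] gen_add[OF us fe A.A.finsum_closed[OF fS] vs len]
        by (rule fspan.add[OF 1 2])
    qed
    from this[of E] show ?case unfolding c(2)[symmetric] by simp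
  qed
  have "U \<in> ?W" if "U \<in> carrier Tm" for U
    using that
  proof (induction U rule: induct)
    case zero
    show ?case by (rule fspan.zero)
  next
    case (gen xs)
    then show ?case using gen_W[of xs "[]"] by simp
  next
    case (diff U V)
    \<comment> \<open>\<open>fspan\<close> has no subtraction, so the negative of V is written as
      the scalar -1 times V.\<close>
    have "(\<ominus>\<^bsub>K\<^esub> \<one>\<^bsub>K\<^esub>) \<odot>\<^bsub>A\<^esub> \<one>\<^bsub>A\<^esub> = \<ominus>\<^bsub>A\<^esub> \<one>\<^bsub>A\<^esub>" using A.V.smult_l_minus by simp
    then have "\<ominus>\<^bsub>Tm\<^esub> V = ((\<ominus>\<^bsub>K\<^esub> \<one>\<^bsub>K\<^esub>) \<odot>\<^bsub>A\<^esub> \<one>\<^bsub>A\<^esub>) \<odot>\<^bsub>Tm\<^esub> V"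
      using diff(2) by (simp add: LM.smult_l_minus)
    moreover have "((\<ominus>\<^bsub>K\<^esub> \<one>\<^bsub>K\<^esub>) \<odot>\<^bsub>A\<^esub> \<one>\<^bsub>A\<^esub>) \<odot>\<^bsub>Tm\<^esub> V \<in> ?W"
      by (rule fspan.smult[OF _ diff(4)]) (rule imageI, simp)
    ultimately show ?case unfolding a_minus_def using fspan.add[OF diff(3)] by simp
  qed
  moreover have "finite ?Y" using finite_lists_length_eq[OF E(1)] by simp
  ultimately show ?thesis using YT by blast
qed

text \<open>In length 1 there are no balancing relations, so sending [x] to x gives a well-defined
  map to A, and the class of [1] goes to 1.\<close>

lemma nonzero:
  assumes "m = 1" "\<one>\<^bsub>A\<^esub> \<noteq> \<zero>\<^bsub>A\<^esub>"
  shows "carrier Tm \<noteq> {\<zero>\<^bsub>Tm\<^esub>}"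
proof
  assume triv: "carrier Tm = {\<zero>\<^bsub>Tm\<^esub>}"
  obtain f where f: "add_hom Tm A f" "\<And>xs. xs \<in> L \<Longrightarrow> f (gen xs) = hd xs"
  proof (rule lift_list[OF A.A.abelian_group_axioms, of hd])
    show "hd xs \<in> carrier A" if "xs \<in> L" for xs using L_Cons[OF that] by auto
  qed (use assms(1) in auto)
  have one: "[\<one>\<^bsub>A\<^esub>] \<in> L" using assms(1) by simp
  then have "gen [\<one>\<^bsub>A\<^esub>] = \<zero>\<^bsub>Tm\<^esub>" using gen_closed triv by blast
  then have "\<one>\<^bsub>A\<^esub> = \<zero>\<^bsub>A\<^esub>"
    using f(2)[OF one] add_hom_zero[OF abelian A.A.abelian_group_axioms f(1)] by simp
  then show False using assms(2) by simp
qed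

lemma trivial:
  assumes "m = 1" "\<one>\<^bsub>A\<^esub> = \<zero>\<^bsub>A\<^esub>" and U: "U \<in> carrier Tm"
  shows "U = \<zero>\<^bsub>Tm\<^esub>"
  using U
proof (induction U rule: induct)
  case (gen xs)
  then obtain x where x: "xs = [x]" "x \<in> carrier A" using assms(1) L_Cons[OF gen] by auto
  have "x = \<zero>\<^bsub>A\<^esub>" using x(2) assms(2) A.A.one_zeroD by auto
  then show ?case using gen_zero[of "[]" "[]"] assms(1) x(1) by simp
qed (simp_all add: M.minus_eq_zero_iff)

section \<open>Comparison of consecutive tensor powers\<close>

lemma tensor_powers_Suc: "tensor_powers K A B (Suc m)"
  by (intro tensor_powers.intro tensor_powers_axioms.intro A.algebra_over_axioms B.algebra_over_axioms sub) simp

text \<open>Placed behind the first factor, the new 1 is out of reach of left multiplication by A;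
  on the right, an element of B can cross it by balancing. The generator of the target is spelled
  out as \<open>presented_group.gen\<close> because the next tensor power is interpreted only inside
  the proof.\<close>

lemma insert_one:
  "\<exists>f. bi_hom A (A\<lparr>carrier := B\<rparr>) Tm (tensor_power A B (Suc m)) f \<and>
    (\<forall>x ys. x \<in> carrier A \<longrightarrow> set ys \<subseteq> carrier A \<longrightarrow> m = Suc (length ys) \<longrightarrow>
      f (gen (x # ys)) = presented_group.gen {xs. set xs \<subseteq> carrier A \<and> length xs = Suc m}
        (tensor_power_rels A B (Suc m)) (x # \<one>\<^bsub>A\<^esub> # ys))"
proof -
  interpret N: tensor_powers K A B "Suc m" by (rule tensor_powers_Suc)
  let ?\<phi> = "\<lambda>xs. N.gen (hd xs # \<one>\<^bsub>A\<^esub> # tl xs)"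
  obtain f where f: "add_hom Tm N.Tm f" "\<And>xs. xs \<in> L \<Longrightarrow> f (gen xs) = ?\<phi> xs"
  proof (rule lift_list[OF N.abelian, of ?\<phi>])
    fix xs assume "xs \<in> L"
    then obtain x ys where "xs = x # ys" "x \<in> carrier A" "set ys \<subseteq> carrier A" "m = Suc (length ys)"
      using L_Cons by blast
    then show "?\<phi> xs \<in> carrier N.Tm" by (intro N.gen_closed) simp
  next
    fix us x y vs
    assume *: "set us \<subseteq> carrier A" "x \<in> carrier A" "y \<in> carrier A" "set vs \<subseteq> carrier A" "m = Suc (length us + length vs)"
    show "?\<phi> (us @ (x \<oplus>\<^bsub>A\<^esub> y) # vs) = ?\<phi> (us @ x # vs) \<oplus>\<^bsub>N.Tm\<^esub> ?\<phi> (us @ y # vs)"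
    proof (cases us)
      case Nil
      have "N.gen ([] @ (x \<oplus>\<^bsub>A\<^esub> y) # \<one>\<^bsub>A\<^esub> # vs) = N.gen ([] @ x # \<one>\<^bsub>A\<^esub> # vs) \<oplus>\<^bsub>N.Tm\<^esub> N.gen ([] @ y # \<one>\<^bsub>A\<^esub> # vs)"
        by (rule N.gen_add) (use * Nil in simp_all)
      then show ?thesis using Nil by simp
    next
      case (Cons u us')
      have "N.gen ((u # \<one>\<^bsub>A\<^esub> # us') @ (x \<oplus>\<^bsub>A\<^esub> y) # vs) =
        N.gen ((u # \<one>\<^bsub>A\<^esub> # us') @ x # vs) \<oplus>\<^bsub>N.Tm\<^esub> N.gen ((u # \<one>\<^bsub>A\<^esub> # us') @ y # vs)"
        by (rule N.gen_add) (use * Cons in simp_all)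
      then show ?thesis using Cons by simp
    qed
  next
    fix us x b y vs
    assume *: "set us \<subseteq> carrier A" "x \<in> carrier A" "b \<in> B" "y \<in> carrier A" "set vs \<subseteq> carrier A"
      "m = Suc (Suc (length us + length vs))"
    show "?\<phi> (us @ (x \<otimes>\<^bsub>A\<^esub> b) # y # vs) = ?\<phi> (us @ x # (b \<otimes>\<^bsub>A\<^esub> y) # vs)"
    proof (cases us)
      \<comment> \<open>The element b crosses the inserted 1 in two moves: x b \<otimes> 1 \<otimes>
        y = x \<otimes> b \<otimes> y = x \<otimes> 1 \<otimes> b y.\<close>
      case Nil
      have b: "b \<otimes>\<^bsub>A\<^esub> \<one>\<^bsub>A\<^esub> = \<one>\<^bsub>A\<^esub> \<otimes>\<^bsub>A\<^esub> b" using B_sub[OF *(3)] by simp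
      have "N.gen ([] @ (x \<otimes>\<^bsub>A\<^esub> b) # \<one>\<^bsub>A\<^esub> # y # vs) = N.gen ([] @ x # (b \<otimes>\<^bsub>A\<^esub> \<one>\<^bsub>A\<^esub>) # y # vs)"
        by (rule N.gen_bal) (use * Nil in simp_all)
      moreover have "N.gen ([x] @ (\<one>\<^bsub>A\<^esub> \<otimes>\<^bsub>A\<^esub> b) # y # vs) = N.gen ([x] @ \<one>\<^bsub>A\<^esub> # (b \<otimes>\<^bsub>A\<^esub> y) # vs)"
        by (rule N.gen_bal) (use * Nil in simp_all)
      ultimately show ?thesis using Nil unfolding b by simp
    next
      case (Cons u us')
      have "N.gen ((u # \<one>\<^bsub>A\<^esub> # us') @ (x \<otimes>\<^bsub>A\<^esub> b) # y # vs) = N.gen ((u # \<one>\<^bsub>A\<^esub> # us') @ x # (b \<otimes>\<^bsub>A\<^esub> y) # vs)"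
        by (rule N.gen_bal) (use * Cons in simp_all)
      then show ?thesis using Cons by simp
    qed
  qed (rule that)
  have fx: "f (gen (x # ys)) = N.gen (x # \<one>\<^bsub>A\<^esub> # ys)"
    if "x \<in> carrier A" "set ys \<subseteq> carrier A" "m = Suc (length ys)" for x ys
    using f(2)[of "x # ys"] that by simp
  have "f (a \<odot>\<^bsub>Tm\<^esub> U) = a \<odot>\<^bsub>N.Tm\<^esub> f U" if a: "a \<in> carrier A" and U: "U \<in> carrier Tm" for a U
  proof (rule add_hom_eqI[OF N.abelian add_hom_comp[OF smult_hom[OF a] f(1)] add_hom_comp[OF f(1) N.smult_hom[OF a]] _ U])
    fix xs assume "xs \<in> L"
    then obtain x ys where x: "xs = x # ys" "x \<in> carrier A" "set ys \<subseteq> carrier A" "m = Suc (length ys)"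
      using L_Cons by blast
    have o: "set (\<one>\<^bsub>A\<^esub> # ys) \<subseteq> carrier A" "Suc m = Suc (length (\<one>\<^bsub>A\<^esub> # ys))" using x by simp_all
    show "f (a \<odot>\<^bsub>Tm\<^esub> gen xs) = a \<odot>\<^bsub>N.Tm\<^esub> f (gen xs)"
      unfolding x(1) smult_gen[OF a x(2-4)] fx[OF x(2-4)] fx[OF A.A.m_closed[OF a x(2)] x(3,4)]
        N.smult_gen[OF a x(2) o] by (rule refl)
  qed
  moreover have "f (U \<odot>r\<^bsub>Tm\<^esub> b) = f U \<odot>r\<^bsub>N.Tm\<^esub> b" if bB: "b \<in> B" and U: "U \<in> carrier Tm" for b U
  proof -
    have b: "b \<in> carrier A" by (rule B_sub[OF bB])
    show ?thesis
    proof (rule add_hom_eqI[OF N.abelian add_hom_comp[OF rsmult_hom[OF b] f(1)] add_hom_comp[OF f(1) N.rsmult_hom[OF b]] _ U])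
      fix xs assume "xs \<in> L"
      then obtain x ys where x: "xs = x # ys" "x \<in> carrier A" "set ys \<subseteq> carrier A" "m = Suc (length ys)"
        using L_Cons by blast
      show "f (gen xs \<odot>r\<^bsub>Tm\<^esub> b) = f (gen xs) \<odot>r\<^bsub>N.Tm\<^esub> b"
      proof (cases ys rule: rev_cases)
        \<comment> \<open>For m = 1 the right action in the target hits the inserted 1. This is
          where b has to lie in B, so that x b \<otimes> 1 = x \<otimes> b.\<close>
        case Nil
        have m1: "m = Suc (length ([] :: 'a list))" using x(4) Nil by simp
        have "f (gen ([] @ [x]) \<odot>r\<^bsub>Tm\<^esub> b) = f (gen [x \<otimes>\<^bsub>A\<^esub> b])"
          using rsmult_gen[OF b x(2) _ m1] by simp
        also have "\<dots> = N.gen ([] @ (x \<otimes>\<^bsub>A\<^esub> b) # \<one>\<^bsub>A\<^esub> # [])"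
          using fx[OF A.A.m_closed[OF x(2) b] _ m1] by simp
        also have "\<dots> = N.gen ([] @ x # (b \<otimes>\<^bsub>A\<^esub> \<one>\<^bsub>A\<^esub>) # [])"
          by (rule N.gen_bal) (use x(2) bB m1 in simp_all)
        also have "\<dots> = N.gen ([x] @ [\<one>\<^bsub>A\<^esub> \<otimes>\<^bsub>A\<^esub> b])" using b by simp
        also have "\<dots> = N.gen ([x] @ [\<one>\<^bsub>A\<^esub>]) \<odot>r\<^bsub>N.Tm\<^esub> b"
          by (rule N.rsmult_gen[OF b, symmetric]) (use x(2) m1 in simp_all)
        also have "N.gen ([x] @ [\<one>\<^bsub>A\<^esub>]) = f (gen [x])"
          using fx[OF x(2) _ m1] by simp
        finally show ?thesis using x(1) Nil by simp
      next
        case (snoc zs z)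
        have z: "z \<in> carrier A" "set zs \<subseteq> carrier A" "m = Suc (length (x # zs))"
          and z': "set (zs @ [z]) \<subseteq> carrier A" "m = Suc (length (zs @ [z]))"
          and z'': "set (zs @ [z \<otimes>\<^bsub>A\<^esub> b]) \<subseteq> carrier A" "m = Suc (length (zs @ [z \<otimes>\<^bsub>A\<^esub> b]))"
          using x snoc b by simp_all
        have "f (gen ((x # zs) @ [z]) \<odot>r\<^bsub>Tm\<^esub> b) = f (gen (x # zs @ [z \<otimes>\<^bsub>A\<^esub> b]))"
          using rsmult_gen[OF b z(1) _ z(3)] x(2) z(2) by simp
        also have "\<dots> = N.gen ((x # \<one>\<^bsub>A\<^esub> # zs) @ [z \<otimes>\<^bsub>A\<^esub> b])" using fx[OF x(2) z''] by simp
        also have "\<dots> = N.gen ((x # \<one>\<^bsub>A\<^esub> # zs) @ [z]) \<odot>r\<^bsub>N.Tm\<^esub> b"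
          by (rule N.rsmult_gen[OF b, symmetric]) (use x(2) z in simp_all)
        also have "N.gen ((x # \<one>\<^bsub>A\<^esub> # zs) @ [z]) = f (gen (x # zs @ [z]))" using fx[OF x(2) z'] by simp
        finally show ?thesis using x(1) snoc by simp
      qed
    qed
  qed
  ultimately have "bi_hom A (A\<lparr>carrier := B\<rparr>) Tm N.Tm f" using f(1) by (simp add: bi_hom_def lin_hom_def)
  then show ?thesis using fx by blast
qed

text \<open>The left inverse of the insertion of 1. Well-definedness depends on whether a relation
  involves the first factor, the second or only later ones, since the first two are merged.\<close>

lemma multiply_first:
  "\<exists>g. bi_hom A (A\<lparr>carrier := B\<rparr>) (tensor_power A B (Suc m)) Tm g \<and>
    (\<forall>x y ys. x \<in> carrier A \<longrightarrow> y \<in> carrier A \<longrightarrow> set ys \<subseteq> carrier A \<longrightarrow> m = Suc (length ys) \<longrightarrow>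
      g (presented_group.gen {xs. set xs \<subseteq> carrier A \<and> length xs = Suc m}
        (tensor_power_rels A B (Suc m)) (x # y # ys)) = gen ((x \<otimes>\<^bsub>A\<^esub> y) # ys))"
proof -
  interpret N: tensor_powers K A B "Suc m" by (rule tensor_powers_Suc)
  let ?\<phi> = "\<lambda>xs. gen ((hd xs \<otimes>\<^bsub>A\<^esub> hd (tl xs)) # tl (tl xs))"
  have LN: "\<exists>x y ys. xs = x # y # ys \<and> x \<in> carrier A \<and> y \<in> carrier A \<and> set ys \<subseteq> carrier A \<and> m = Suc (length ys)"
    if xs: "xs \<in> {xs. set xs \<subseteq> carrier A \<and> length xs = Suc m}" for xs
  proof -
    obtain x zs where x: "xs = x # zs" "x \<in> carrier A" "set zs \<subseteq> carrier A" "Suc m = Suc (length zs)"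
      using N.L_Cons[OF xs] by blast
    then have "zs \<in> L" by simp
    from L_Cons[OF this] show ?thesis using x by blast
  qed
  obtain f where f: "add_hom N.Tm Tm f" "\<And>xs. xs \<in> {xs. set xs \<subseteq> carrier A \<and> length xs = Suc m} \<Longrightarrow> f (N.gen xs) = ?\<phi> xs"
  proof (rule N.lift_list[OF abelian, of ?\<phi>])
    fix xs assume "xs \<in> {xs. set xs \<subseteq> carrier A \<and> length xs = Suc m}"
    from LN[OF this] show "?\<phi> xs \<in> carrier Tm" by (intro gen_closed) auto
  next
    fix us x y vs
    assume *: "set us \<subseteq> carrier A" "x \<in> carrier A" "y \<in> carrier A" "set vs \<subseteq> carrier A" "Suc m = Suc (length us + length vs)"
    show "?\<phi> (us @ (x \<oplus>\<^bsub>A\<^esub> y) # vs) = ?\<phi> (us @ x # vs) \<oplus>\<^bsub>Tm\<^esub> ?\<phi> (us @ y # vs)"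
    \<comment> \<open>Additivity in one of the first two entries becomes additivity of their
      product, by distributivity in A; a later entry is left as it is.\<close>
    proof (cases us)
      case Nil
      then obtain v ws where v: "vs = v # ws" using * m by (cases vs) auto
      have "gen ([] @ ((x \<otimes>\<^bsub>A\<^esub> v) \<oplus>\<^bsub>A\<^esub> (y \<otimes>\<^bsub>A\<^esub> v)) # ws) = gen ([] @ (x \<otimes>\<^bsub>A\<^esub> v) # ws) \<oplus>\<^bsub>Tm\<^esub> gen ([] @ (y \<otimes>\<^bsub>A\<^esub> v) # ws)"
        by (rule gen_add) (use * Nil v in simp_all)
      then show ?thesis using Nil v * by (simp add: A.l_distr)
    next
      case (Cons u us')
      show ?thesis
      proof (cases us')
        case Nil
        have "gen ([] @ ((u \<otimes>\<^bsub>A\<^esub> x) \<oplus>\<^bsub>A\<^esub> (u \<otimes>\<^bsub>A\<^esub> y)) # vs) = gen ([] @ (u \<otimes>\<^bsub>A\<^esub> x) # vs) \<oplus>\<^bsub>Tm\<^esub> gen ([] @ (u \<otimes>\<^bsub>A\<^esub> y) # vs)"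
          by (rule gen_add) (use * Cons Nil in simp_all)
        then show ?thesis using Cons Nil * by (simp add: A.r_distr)
      next
        case (Cons w ws)
        have "gen (((u \<otimes>\<^bsub>A\<^esub> w) # ws) @ (x \<oplus>\<^bsub>A\<^esub> y) # vs) =
          gen (((u \<otimes>\<^bsub>A\<^esub> w) # ws) @ x # vs) \<oplus>\<^bsub>Tm\<^esub> gen (((u \<otimes>\<^bsub>A\<^esub> w) # ws) @ y # vs)"
          by (rule gen_add) (use * \<open>us = u # us'\<close> Cons in simp_all)
        then show ?thesis using \<open>us = u # us'\<close> Cons by simp
      qed
    qed
  next
    fix us x b y vs
    assume *: "set us \<subseteq> carrier A" "x \<in> carrier A" "b \<in> B" "y \<in> carrier A" "set vs \<subseteq> carrier A"
      "Suc m = Suc (Suc (length us + length vs))"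
    have b: "b \<in> carrier A" by (rule B_sub[OF *(3)])
    show "?\<phi> (us @ (x \<otimes>\<^bsub>A\<^esub> b) # y # vs) = ?\<phi> (us @ x # (b \<otimes>\<^bsub>A\<^esub> y) # vs)"
    proof (cases us)
      \<comment> \<open>Balancing between the two merged factors is associativity in A.\<close>
      case Nil
      then show ?thesis using * b by (simp add: A.m_assoc)
    next
      case (Cons u us')
      show ?thesis
      proof (cases us')
        case Nil
        have "gen ([] @ ((u \<otimes>\<^bsub>A\<^esub> x) \<otimes>\<^bsub>A\<^esub> b) # y # vs) = gen ([] @ (u \<otimes>\<^bsub>A\<^esub> x) # (b \<otimes>\<^bsub>A\<^esub> y) # vs)"
          by (rule gen_bal) (use * Cons Nil in simp_all)
        then show ?thesis using Cons Nil * b by (simp add: A.m_assoc)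
      next
        case (Cons w ws)
        have "gen (((u \<otimes>\<^bsub>A\<^esub> w) # ws) @ (x \<otimes>\<^bsub>A\<^esub> b) # y # vs) = gen (((u \<otimes>\<^bsub>A\<^esub> w) # ws) @ x # (b \<otimes>\<^bsub>A\<^esub> y) # vs)"
          by (rule gen_bal) (use * \<open>us = u # us'\<close> Cons in simp_all)
        then show ?thesis using \<open>us = u # us'\<close> Cons by simp
      qed
    qed
  qed (rule that)
  have fx: "f (N.gen (x # y # ys)) = gen ((x \<otimes>\<^bsub>A\<^esub> y) # ys)"
    if "x \<in> carrier A" "y \<in> carrier A" "set ys \<subseteq> carrier A" "m = Suc (length ys)" for x y ys
    using f(2)[of "x # y # ys"] that by simp
  have "f (a \<odot>\<^bsub>N.Tm\<^esub> U) = a \<odot>\<^bsub>Tm\<^esub> f U" if a: "a \<in> carrier A" and U: "U \<in> carrier N.Tm" for a U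
  proof (rule N.add_hom_eqI[OF abelian add_hom_comp[OF N.smult_hom[OF a] f(1)] add_hom_comp[OF f(1) smult_hom[OF a]] _ U])
    fix xs assume "xs \<in> {xs. set xs \<subseteq> carrier A \<and> length xs = Suc m}"
    then obtain x y ys where x: "xs = x # y # ys" "x \<in> carrier A" "y \<in> carrier A" "set ys \<subseteq> carrier A" "m = Suc (length ys)"
      using LN by blast
    have o: "set (y # ys) \<subseteq> carrier A" "Suc m = Suc (length (y # ys))" using x by simp_all
    show "f (a \<odot>\<^bsub>N.Tm\<^esub> N.gen xs) = a \<odot>\<^bsub>Tm\<^esub> f (N.gen xs)"
      unfolding x(1) N.smult_gen[OF a x(2) o] fx[OF x(2-5)] fx[OF A.A.m_closed[OF a x(2)] x(3-5)]
        smult_gen[OF a A.A.m_closed[OF x(2,3)] x(4,5)] A.A.m_assoc[OF a x(2,3)] by (rule refl)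
  qed
  moreover have "f (U \<odot>r\<^bsub>N.Tm\<^esub> b) = f U \<odot>r\<^bsub>Tm\<^esub> b" if bB: "b \<in> B" and U: "U \<in> carrier N.Tm" for b U
  proof -
    have b: "b \<in> carrier A" by (rule B_sub[OF bB])
    show ?thesis
    proof (rule N.add_hom_eqI[OF abelian add_hom_comp[OF N.rsmult_hom[OF b] f(1)] add_hom_comp[OF f(1) rsmult_hom[OF b]] _ U])
      fix xs assume "xs \<in> {xs. set xs \<subseteq> carrier A \<and> length xs = Suc m}"
      then obtain x y ys where x: "xs = x # y # ys" "x \<in> carrier A" "y \<in> carrier A" "set ys \<subseteq> carrier A" "m = Suc (length ys)"
        using LN by blast
      show "f (N.gen xs \<odot>r\<^bsub>N.Tm\<^esub> b) = f (N.gen xs) \<odot>r\<^bsub>Tm\<^esub> b"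
      proof (cases ys rule: rev_cases)
        case Nil
        have m1: "m = Suc (length ([] :: 'a list))" using x(5) Nil by simp
        have "f (N.gen ([x] @ [y]) \<odot>r\<^bsub>N.Tm\<^esub> b) = f (N.gen ([x] @ [y \<otimes>\<^bsub>A\<^esub> b]))"
          by (rule arg_cong[where f = f], rule N.rsmult_gen[OF b]) (use x m1 in simp_all)
        also have "\<dots> = gen ([] @ [(x \<otimes>\<^bsub>A\<^esub> y) \<otimes>\<^bsub>A\<^esub> b])"
          using fx[OF x(2) A.A.m_closed[OF x(3) b] _ m1] A.A.m_assoc[OF x(2,3) b] by simp
        also have "\<dots> = gen ([] @ [x \<otimes>\<^bsub>A\<^esub> y]) \<odot>r\<^bsub>Tm\<^esub> b"
          by (rule rsmult_gen[OF b, symmetric]) (use x(2,3) m1 in simp_all)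
        also have "gen ([] @ [x \<otimes>\<^bsub>A\<^esub> y]) = f (N.gen [x, y])"
          using fx[OF x(2,3) _ m1] by simp
        finally show ?thesis using x(1) Nil by simp
      next
        case (snoc zs z)
        have z: "z \<in> carrier A" "set zs \<subseteq> carrier A" "m = Suc (Suc (length zs))"
          and z': "set (zs @ [z]) \<subseteq> carrier A" "m = Suc (length (zs @ [z]))"
          and z'': "set (zs @ [z \<otimes>\<^bsub>A\<^esub> b]) \<subseteq> carrier A" "m = Suc (length (zs @ [z \<otimes>\<^bsub>A\<^esub> b]))"
          using x snoc b by simp_all
        have "f (N.gen ((x # y # zs) @ [z]) \<odot>r\<^bsub>N.Tm\<^esub> b) = f (N.gen ((x # y # zs) @ [z \<otimes>\<^bsub>A\<^esub> b]))"
          by (rule arg_cong[where f = f], rule N.rsmult_gen[OF b]) (use x z in simp_all)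
        also have "\<dots> = gen (((x \<otimes>\<^bsub>A\<^esub> y) # zs) @ [z \<otimes>\<^bsub>A\<^esub> b])" using fx[OF x(2,3) z''] by simp
        also have "\<dots> = gen (((x \<otimes>\<^bsub>A\<^esub> y) # zs) @ [z]) \<odot>r\<^bsub>Tm\<^esub> b"
          by (rule rsmult_gen[OF b, symmetric]) (use x z in simp_all)
        also have "gen (((x \<otimes>\<^bsub>A\<^esub> y) # zs) @ [z]) = f (N.gen (x # y # zs @ [z]))" using fx[OF x(2,3) z'] by simp
        finally show ?thesis using x(1) snoc by simp
      qed
    qed
  qed
  ultimately have "bi_hom A (A\<lparr>carrier := B\<rparr>) N.Tm Tm f" using f(1) by (simp add: bi_hom_def lin_hom_def)
  then show ?thesis using fx by blast
qed

lemma in_add_Suc: "in_add (bi_hom A (A\<lparr>carrier := B\<rparr>)) Tm {tensor_power A B (Suc m)}"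
proof -
  interpret N: tensor_powers K A B "Suc m" by (rule tensor_powers_Suc)
  interpret H: additive_homs "bimodule A (A\<lparr>carrier := B\<rparr>)" "bi_hom A (A\<lparr>carrier := B\<rparr>)" by (rule additive_homs_bi)
  obtain f where f: "bi_hom A (A\<lparr>carrier := B\<rparr>) Tm N.Tm f"
    "\<And>x ys. \<lbrakk>x \<in> carrier A; set ys \<subseteq> carrier A; m = Suc (length ys)\<rbrakk> \<Longrightarrow>
      f (gen (x # ys)) = N.gen (x # \<one>\<^bsub>A\<^esub> # ys)"
    using insert_one by blast
  obtain g where g: "bi_hom A (A\<lparr>carrier := B\<rparr>) N.Tm Tm g"
    "\<And>x y ys. \<lbrakk>x \<in> carrier A; y \<in> carrier A; set ys \<subseteq> carrier A; m = Suc (length ys)\<rbrakk> \<Longrightarrow>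
      g (N.gen (x # y # ys)) = gen ((x \<otimes>\<^bsub>A\<^esub> y) # ys)"
    using multiply_first by blast
  have "g (f U) = U" if U: "U \<in> carrier Tm" for U
  proof (rule add_hom_eqI[OF abelian add_hom_comp[OF H.hom_add[OF f(1)] H.hom_add[OF g(1)]] id_hom _ U])
    fix xs assume "xs \<in> L"
    then obtain x ys where x: "xs = x # ys" "x \<in> carrier A" "set ys \<subseteq> carrier A" "m = Suc (length ys)"
      using L_Cons by blast
    show "g (f (gen xs)) = gen xs"
      unfolding x(1) f(2)[OF x(2-4)] g(2)[OF x(2) A.A.one_closed x(3,4)] A.A.r_one[OF x(2)] by (rule refl)
  qed
  then show ?thesis by (intro H.in_add_retract[OF bimod_AB _ f(1) g(1)]) simp_all
qed

end

section \<open>From sums of composites to H-equivalence\<close>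

lemma bi_homI:
  assumes "\<And>x. x \<in> carrier M \<Longrightarrow> f x \<in> carrier N"
    and "\<And>x y. x \<in> carrier M \<Longrightarrow> y \<in> carrier M \<Longrightarrow> f (x \<oplus>\<^bsub>M\<^esub> y) = f x \<oplus>\<^bsub>N\<^esub> f y"
    and "\<And>a x. a \<in> carrier R \<Longrightarrow> x \<in> carrier M \<Longrightarrow> f (a \<odot>\<^bsub>M\<^esub> x) = a \<odot>\<^bsub>N\<^esub> f x"
    and "\<And>a x. a \<in> carrier S \<Longrightarrow> x \<in> carrier M \<Longrightarrow> f (x \<odot>r\<^bsub>M\<^esub> a) = f x \<odot>r\<^bsub>N\<^esub> a"
  shows "bi_hom R S M N f"
  using assms by (simp add: bi_hom_def lin_hom_def add_hom_def)

lemma bi_homD: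
  assumes "bi_hom R S M N f"
  shows "x \<in> carrier M \<Longrightarrow> f x \<in> carrier N"
    and "x \<in> carrier M \<Longrightarrow> y \<in> carrier M \<Longrightarrow> f (x \<oplus>\<^bsub>M\<^esub> y) = f x \<oplus>\<^bsub>N\<^esub> f y"
    and "a \<in> carrier R \<Longrightarrow> x \<in> carrier M \<Longrightarrow> f (a \<odot>\<^bsub>M\<^esub> x) = a \<odot>\<^bsub>N\<^esub> f x"
    and "b \<in> carrier S \<Longrightarrow> x \<in> carrier M \<Longrightarrow> f (x \<odot>r\<^bsub>M\<^esub> b) = f x \<odot>r\<^bsub>N\<^esub> b"
    and "add_hom M N f"
  using assms by (auto simp: bi_hom_def lin_hom_def add_hom_def)

lemma (in bimodule) rsmult_zero: "b \<in> carrier S \<Longrightarrow> \<zero>\<^bsub>M\<^esub> \<odot>r\<^bsub>M\<^esub> b = \<zero>\<^bsub>M\<^esub>"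
  by (rule add_hom_zero[OF M.abelian_group_axioms M.abelian_group_axioms, of "\<lambda>x. x \<odot>r\<^bsub>M\<^esub> b"])
    (simp add: add_hom_def rsmult_closed rsmult_l_distr)

lemma (in bimodule) rsmult_minus:
  "b \<in> carrier S \<Longrightarrow> x \<in> carrier M \<Longrightarrow> (\<ominus>\<^bsub>M\<^esub> x) \<odot>r\<^bsub>M\<^esub> b = \<ominus>\<^bsub>M\<^esub> (x \<odot>r\<^bsub>M\<^esub> b)"
  by (rule add_hom_minus[OF M.abelian_group_axioms M.abelian_group_axioms, of "\<lambda>x. x \<odot>r\<^bsub>M\<^esub> b"])
    (simp_all add: add_hom_def rsmult_closed rsmult_l_distr)

lemma (in left_module) smult_r_minus:
  "a \<in> carrier R \<Longrightarrow> x \<in> carrier M \<Longrightarrow> a \<odot>\<^bsub>M\<^esub> (\<ominus>\<^bsub>M\<^esub> x) = \<ominus>\<^bsub>M\<^esub> (a \<odot>\<^bsub>M\<^esub> x)"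
  by (rule add_hom_minus[OF M.abelian_group_axioms M.abelian_group_axioms, of "\<lambda>x. a \<odot>\<^bsub>M\<^esub> x"])
    (simp_all add: add_hom_def smult_r_distr)

lemma bi_hom_zero:
  assumes "bimodule R S M" "bimodule R S N"
  shows "bi_hom R S M N (\<lambda>x. \<zero>\<^bsub>N\<^esub>)"
proof -
  interpret N: bimodule R S N by fact
  show ?thesis by (rule bi_homI) (simp_all add: N.rsmult_zero)
qed

text \<open>Since f splits g, P is the sum of M and the kernel of g, by p -> (g p, p - f (g p)) with
  inverse (x, y) -> f x + y. The kernel is P with a smaller carrier and so has the element type that
  \<open>bimodule_divides\<close> prescribes for the complement.\<close>

lemma retract_divides:
  fixes M :: "('r, 's, 'm) bimodule" and P :: "('r, 's, 'n) bimodule"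
  assumes M: "bimodule R S M" and P: "bimodule R S P"
    and f: "bi_hom R S M P f" and g: "bi_hom R S P M g"
    and gf: "\<And>x. x \<in> carrier M \<Longrightarrow> g (f x) = x"
  shows "bimodule_divides R S M P"
proof -
  interpret M: bimodule R S M by fact
  interpret P: bimodule R S P by fact
  note f' = bi_homD[OF f] and g' = bi_homD[OF g]
  have g0: "g \<zero>\<^bsub>P\<^esub> = \<zero>\<^bsub>M\<^esub>" by (rule add_hom_zero[OF P.M.abelian_group_axioms M.M.abelian_group_axioms g'(5)])
  have gm: "g (\<ominus>\<^bsub>P\<^esub> x) = \<ominus>\<^bsub>M\<^esub> g x" if "x \<in> carrier P" for x
    by (rule add_hom_minus[OF P.M.abelian_group_axioms M.M.abelian_group_axioms g'(5) that])
  let ?K = "{p \<in> carrier P. g p = \<zero>\<^bsub>M\<^esub>}"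
  let ?N = "P\<lparr>carrier := ?K\<rparr>"
  have "submodule ?K R P"
    by (rule P.submoduleI) (auto simp: g0 g'(2) g'(3))
  then have lN: "left_module R ?N" by (rule P.submodule_left_module)
  have N: "bimodule R S ?N"
    by (intro bimodule.intro bimodule_axioms.intro lN M.S.ring_axioms)
      (auto simp: P.rsmult_closed P.rsmult_r_distr P.rsmult_l_distr P.rsmult_assoc P.rsmult_one P.smult_rsmult
        g'(4) M.rsmult_zero)
  define e where "e p = p \<oplus>\<^bsub>P\<^esub> \<ominus>\<^bsub>P\<^esub> f (g p)" for p
  have fg: "f (g p) \<in> carrier P" if "p \<in> carrier P" for p using f'(1) g'(1) that by simp
  have ec: "e p \<in> carrier P" if "p \<in> carrier P" for p using that fg by (simp add: e_def)
  have eK: "e p \<in> ?K" if p: "p \<in> carrier P" for p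
  proof -
    have "g (e p) = g p \<oplus>\<^bsub>M\<^esub> \<ominus>\<^bsub>M\<^esub> g (f (g p))" using p fg by (simp add: e_def g'(2) gm)
    also have "\<dots> = \<zero>\<^bsub>M\<^esub>" using gf[OF g'(1)[OF p]] g'(1)[OF p] by (simp add: M.M.r_neg)
    finally show ?thesis using ec p by simp
  qed
  have e_add: "e (p \<oplus>\<^bsub>P\<^esub> q) = e p \<oplus>\<^bsub>P\<^esub> e q" if p: "p \<in> carrier P" and q: "q \<in> carrier P" for p q
    using p q fg[OF p] fg[OF q] by (simp add: e_def g'(1) g'(2) f'(2) P.M.minus_add P.M.a_ac)
  have e_smult: "e (a \<odot>\<^bsub>P\<^esub> p) = a \<odot>\<^bsub>P\<^esub> e p" if "a \<in> carrier R" and p: "p \<in> carrier P" for a p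
    using that fg[OF p] by (simp add: e_def g'(1) g'(3) f'(3) P.smult_r_distr P.smult_r_minus)
  have e_rsmult: "e (p \<odot>r\<^bsub>P\<^esub> a) = e p \<odot>r\<^bsub>P\<^esub> a" if "a \<in> carrier S" and p: "p \<in> carrier P" for a p
    using that fg[OF p] by (simp add: e_def g'(1) g'(4) f'(4) P.rsmult_l_distr P.rsmult_minus)
  have "bij_betw (\<lambda>p. (g p, e p)) (carrier P) (carrier M \<times> ?K)"
  proof (rule bij_betwI[where g = "\<lambda>(x, y). f x \<oplus>\<^bsub>P\<^esub> y"])
    show "(\<lambda>p. (g p, e p)) \<in> carrier P \<rightarrow> carrier M \<times> ?K" using eK g'(1) by blast
    show "(\<lambda>(x, y). f x \<oplus>\<^bsub>P\<^esub> y) \<in> carrier M \<times> ?K \<rightarrow> carrier P" using f'(1) by auto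
    show "(case (g p, e p) of (x, y) \<Rightarrow> f x \<oplus>\<^bsub>P\<^esub> y) = p" if p: "p \<in> carrier P" for p
    proof -
      have "f (g p) \<oplus>\<^bsub>P\<^esub> (p \<oplus>\<^bsub>P\<^esub> \<ominus>\<^bsub>P\<^esub> f (g p)) = (f (g p) \<oplus>\<^bsub>P\<^esub> \<ominus>\<^bsub>P\<^esub> f (g p)) \<oplus>\<^bsub>P\<^esub> p"
        using p fg[OF p] P.M.a_inv_closed[OF fg[OF p]] by (simp only: P.M.a_ac P.M.a_closed)
      then show ?thesis using p fg[OF p] by (simp add: e_def P.M.r_neg)
    qed
    fix z assume "z \<in> carrier M \<times> ?K"
    then obtain x y where z: "z = (x, y)" "x \<in> carrier M" "y \<in> carrier P" "g y = \<zero>\<^bsub>M\<^esub>" by auto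
    have fx: "f x \<in> carrier P" by (rule f'(1)[OF z(2)])
    have gx: "g (f x \<oplus>\<^bsub>P\<^esub> y) = x" using z fx gf by (simp add: g'(2))
    have "f x \<oplus>\<^bsub>P\<^esub> y \<oplus>\<^bsub>P\<^esub> \<ominus>\<^bsub>P\<^esub> f x = (f x \<oplus>\<^bsub>P\<^esub> \<ominus>\<^bsub>P\<^esub> f x) \<oplus>\<^bsub>P\<^esub> y"
      using z(3) fx P.M.a_inv_closed[OF fx] by (simp only: P.M.a_ac P.M.a_closed)
    then have "e (f x \<oplus>\<^bsub>P\<^esub> y) = y" unfolding e_def gx using z(3) fx by (simp add: P.M.r_neg)
    then show "(g (case z of (x, y) \<Rightarrow> f x \<oplus>\<^bsub>P\<^esub> y), e (case z of (x, y) \<Rightarrow> f x \<oplus>\<^bsub>P\<^esub> y)) = z"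
      using z(1) gx by simp
  qed
  then have "bimodule_iso R S P (bimodule_sum M ?N)"
    unfolding bimodule_iso_def
    by (intro exI[of _ "\<lambda>p. (g p, e p)"]) (simp add: bimodule_sum_def e_add e_smult e_rsmult g'(2-4))
  then show ?thesis unfolding bimodule_divides_def using N by blast
qed

lemma bimodule_power:
  assumes "bimodule R S M"
  shows "bimodule R S (bimodule_power n M)"
proof -
  interpret M: bimodule R S M by fact
  have ab: "abelian_group (bimodule_power n M)"
  proof (rule abelian_groupI)
    fix u assume u: "u \<in> carrier (bimodule_power n M)"
    have "(\<lambda>i\<in>{..<n}. \<ominus>\<^bsub>M\<^esub> u i) \<in> carrier (bimodule_power n M)"
      using u by (auto simp: bimodule_power_def)
    moreover have "(\<lambda>i\<in>{..<n}. \<ominus>\<^bsub>M\<^esub> u i) \<oplus>\<^bsub>bimodule_power n M\<^esub> u = \<zero>\<^bsub>bimodule_power n M\<^esub>"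
      using u by (auto simp: bimodule_power_def M.M.l_neg PiE_iff intro!: restrict_ext)
    ultimately show "\<exists>v\<in>carrier (bimodule_power n M). v \<oplus>\<^bsub>bimodule_power n M\<^esub> u = \<zero>\<^bsub>bimodule_power n M\<^esub>" by blast
    show "\<zero>\<^bsub>bimodule_power n M\<^esub> \<oplus>\<^bsub>bimodule_power n M\<^esub> u = u"
      using u by (intro extensionalityI[of _ "{..<n}"]) (auto simp: bimodule_power_def PiE_iff)
  qed (auto simp: bimodule_power_def PiE_iff M.M.a_ac intro!: restrict_ext)
  have "left_module R (bimodule_power n M)"
  proof (intro left_module.intro left_module_axioms.intro M.R.ring_axioms ab)
    fix u assume u: "u \<in> carrier (bimodule_power n M)"
    show "\<one>\<^bsub>R\<^esub> \<odot>\<^bsub>bimodule_power n M\<^esub> u = u"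
      using u by (intro extensionalityI[of _ "{..<n}"]) (auto simp: bimodule_power_def PiE_iff)
  qed (auto simp: bimodule_power_def PiE_iff M.smult_l_distr M.smult_r_distr M.smult_assoc1 intro!: restrict_ext)
  then show ?thesis
  proof (intro bimodule.intro bimodule_axioms.intro M.S.ring_axioms)
    fix u assume u: "u \<in> carrier (bimodule_power n M)"
    show "u \<odot>r\<^bsub>bimodule_power n M\<^esub> \<one>\<^bsub>S\<^esub> = u"
      using u by (intro extensionalityI[of _ "{..<n}"]) (auto simp: bimodule_power_def PiE_iff M.rsmult_one)
  qed (auto simp: bimodule_power_def PiE_iff M.rsmult_closed M.rsmult_r_distr M.rsmult_l_distr M.rsmult_assoc
      M.smult_rsmult intro!: restrict_ext)
qed

text \<open>Here the direct sum that was avoided so far is built: r composites through N form one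
  composite through its r-th power, with the first maps as coordinates and the values of the second
  maps added up.\<close>

lemma comp_sum_power:
  assumes M: "bimodule R S M" and N: "bimodule R S N" and u: "comp_sum (bi_hom R S) M {N} u"
  shows "\<exists>r f g. r \<ge> 1 \<and> bi_hom R S M (bimodule_power r N) f \<and> bi_hom R S (bimodule_power r N) M g \<and>
    (\<forall>x \<in> carrier M. g (f x) = u x)"
  using u
proof induction
  case zero
  \<comment> \<open>H-equivalence asks for at least one copy, so the empty sum is sent through one
    copy of N by zero maps.\<close>
  have P: "bimodule R S (bimodule_power 1 N)" by (rule bimodule_power[OF N])
  show ?case
  proof (intro exI conjI)
    show "bi_hom R S M (bimodule_power 1 N) (\<lambda>x. \<zero>\<^bsub>bimodule_power 1 N\<^esub>)" by (rule bi_hom_zero[OF M P])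
    show "bi_hom R S (bimodule_power 1 N) M (\<lambda>x. \<zero>\<^bsub>M\<^esub>)" by (rule bi_hom_zero[OF P M])
  qed simp_all
next
  case (step u N' p q)
  interpret M: bimodule R S M by fact
  interpret N: bimodule R S N by fact
  have p: "bi_hom R S M N p" and q: "bi_hom R S N M q" using step by simp_all
  obtain r f g where r: "r \<ge> 1" and f: "bi_hom R S M (bimodule_power r N) f"
    and g: "bi_hom R S (bimodule_power r N) M g" and gf: "\<forall>x \<in> carrier M. g (f x) = u x"
    using step.IH by (elim exE conjE)
  note p' = bi_homD[OF p] and q' = bi_homD[OF q] and f' = bi_homD[OF f] and g' = bi_homD[OF g]
  let ?P = "bimodule_power r N" and ?P' = "bimodule_power (Suc r) N"
  \<comment> \<open>The new composite occupies the additional coordinate r.\<close>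
  define f2 where "f2 x = (\<lambda>i\<in>{..<Suc r}. if i < r then f x i else p x)" for x
  define g2 where "g2 v = g (restrict v {..<r}) \<oplus>\<^bsub>M\<^esub> q (v r)" for v
  have fP: "f x \<in> {..<r} \<rightarrow>\<^sub>E carrier N" if "x \<in> carrier M" for x
    using f'(1)[OF that] by (simp add: bimodule_power_def)
  have "bi_hom R S M ?P' f2"
  proof (rule bi_homI)
    fix x assume x: "x \<in> carrier M"
    have "(if i < r then f x i else p x) \<in> carrier N" for i
      using PiE_mem[OF fP[OF x], of i] p'(1)[OF x] by (cases "i < r") simp_all
    then have "f2 x \<in> {..<Suc r} \<rightarrow>\<^sub>E carrier N" unfolding f2_def by (intro restrict_PiE_iff[THEN iffD2] ballI)
    then show "f2 x \<in> carrier ?P'" by (simp add: bimodule_power_def)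
    fix a assume a: "a \<in> carrier R"
    show "f2 (a \<odot>\<^bsub>M\<^esub> x) = a \<odot>\<^bsub>?P'\<^esub> f2 x"
      unfolding f2_def f'(3)[OF a x] p'(3)[OF a x] by (auto simp: bimodule_power_def f2_def intro!: restrict_ext)
  next
    fix x a assume x: "x \<in> carrier M" and a: "a \<in> carrier S"
    show "f2 (x \<odot>r\<^bsub>M\<^esub> a) = f2 x \<odot>r\<^bsub>?P'\<^esub> a"
      unfolding f2_def f'(4)[OF a x] p'(4)[OF a x] by (auto simp: bimodule_power_def f2_def intro!: restrict_ext)
  next
    fix x y assume x: "x \<in> carrier M" and y: "y \<in> carrier M"
    show "f2 (x \<oplus>\<^bsub>M\<^esub> y) = f2 x \<oplus>\<^bsub>?P'\<^esub> f2 y"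
      unfolding f2_def f'(2)[OF x y] p'(2)[OF x y] by (auto simp: bimodule_power_def f2_def intro!: restrict_ext)
  qed
  moreover have "bi_hom R S ?P' M g2"
  proof -
    have rc: "restrict v {..<r} \<in> carrier ?P" "v r \<in> carrier N" if "v \<in> carrier ?P'" for v
      using that by (auto simp: bimodule_power_def PiE_iff)
    have radd: "restrict (v \<oplus>\<^bsub>?P'\<^esub> w) {..<r} = restrict v {..<r} \<oplus>\<^bsub>?P\<^esub> restrict w {..<r}"
      "(v \<oplus>\<^bsub>?P'\<^esub> w) r = v r \<oplus>\<^bsub>N\<^esub> w r" for v w
      by (auto simp: bimodule_power_def intro!: restrict_ext)
    have rsm: "restrict (a \<odot>\<^bsub>?P'\<^esub> v) {..<r} = a \<odot>\<^bsub>?P\<^esub> restrict v {..<r}"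
      "(a \<odot>\<^bsub>?P'\<^esub> v) r = a \<odot>\<^bsub>N\<^esub> v r" for v a
      by (auto simp: bimodule_power_def intro!: restrict_ext)
    have rrs: "restrict (v \<odot>r\<^bsub>?P'\<^esub> a) {..<r} = restrict v {..<r} \<odot>r\<^bsub>?P\<^esub> a"
      "(v \<odot>r\<^bsub>?P'\<^esub> a) r = v r \<odot>r\<^bsub>N\<^esub> a" for v a
      by (auto simp: bimodule_power_def intro!: restrict_ext)
    show ?thesis
    proof (rule bi_homI)
      fix v assume v: "v \<in> carrier ?P'"
      note v' = g'(1)[OF rc(1)[OF v]] q'(1)[OF rc(2)[OF v]]
      show "g2 v \<in> carrier M" using v' by (simp add: g2_def)
      show "g2 (a \<odot>\<^bsub>?P'\<^esub> v) = a \<odot>\<^bsub>M\<^esub> g2 v" if a: "a \<in> carrier R" for a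
        unfolding g2_def rsm g'(3)[OF a rc(1)[OF v]] q'(3)[OF a rc(2)[OF v]] using v' a by (simp add: M.smult_r_distr)
      show "g2 (v \<odot>r\<^bsub>?P'\<^esub> a) = g2 v \<odot>r\<^bsub>M\<^esub> a" if a: "a \<in> carrier S" for a
        unfolding g2_def rrs g'(4)[OF a rc(1)[OF v]] q'(4)[OF a rc(2)[OF v]] using v' a by (simp add: M.rsmult_l_distr)
      fix w assume w: "w \<in> carrier ?P'"
      show "g2 (v \<oplus>\<^bsub>?P'\<^esub> w) = g2 v \<oplus>\<^bsub>M\<^esub> g2 w"
        unfolding g2_def radd g'(2)[OF rc(1)[OF v] rc(1)[OF w]] q'(2)[OF rc(2)[OF v] rc(2)[OF w]]
        using v' g'(1)[OF rc(1)[OF w]] q'(1)[OF rc(2)[OF w]] by (simp add: M.M.a_ac)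
    qed
  qed
  moreover have "g2 (f2 x) = u x \<oplus>\<^bsub>M\<^esub> q (p x)" if x: "x \<in> carrier M" for x
  proof -
    have "restrict (f2 x) {..<r} = f x"
      using fP[OF x] by (intro extensionalityI[of _ "{..<r}"]) (auto simp: PiE_iff f2_def)
    moreover have "f2 x r = p x" by (simp add: f2_def)
    ultimately show ?thesis using gf x by (simp add: g2_def)
  qed
  ultimately show ?case
    by (intro exI[of _ "Suc r"] exI[of _ f2] exI[of _ g2] conjI ballI) simp_all
qed

lemma in_add_divides:
  assumes M: "bimodule R S M" and N: "bimodule R S N" and "in_add (bi_hom R S) M {N}"
  shows "\<exists>r \<ge> 1. bimodule_divides R S M (bimodule_power r N)"
proof -
  obtain u where u: "comp_sum (bi_hom R S) M {N} u" "\<forall>x \<in> carrier M. u x = x"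
    using assms(3) by (auto simp: in_add_def)
  obtain r f g where r: "r \<ge> 1" and f: "bi_hom R S M (bimodule_power r N) f"
    and g: "bi_hom R S (bimodule_power r N) M g" and gf: "\<forall>x \<in> carrier M. g (f x) = u x"
    using comp_sum_power[OF M N u(1)] by blast
  have "bimodule_divides R S M (bimodule_power r N)"
    by (rule retract_divides[OF M bimodule_power[OF N] f g]) (use gf u(2) in simp)
  then show ?thesis using r by blast
qed

lemma in_add_H_equivalent:
  assumes "bimodule R S M" "bimodule R S N" "in_add (bi_hom R S) M {N}" "in_add (bi_hom R S) N {M}"
  shows "H_equivalent R S M N"
  unfolding H_equivalent_def using in_add_divides[OF assms(1-3)] in_add_divides[OF assms(2,1,4)] by blast

text \<open>For a zero module the zero maps in both directions form a retraction. This serves the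
  case A = 0.\<close>

lemma trivial_divides:
  assumes M: "bimodule R S M" and N: "bimodule R S N" and triv: "\<And>x. x \<in> carrier M \<Longrightarrow> x = \<zero>\<^bsub>M\<^esub>"
  shows "bimodule_divides R S M (bimodule_power 1 N)"
proof -
  have P: "bimodule R S (bimodule_power 1 N)" by (rule bimodule_power[OF N])
  show ?thesis
    by (rule retract_divides[OF M P bi_hom_zero[OF M P] bi_hom_zero[OF P M]]) (use triv in metis)
qed

section \<open>Minimum depth\<close>

lemma min_depth_le_odd: "odd_depth A B m \<Longrightarrow> min_depth B A \<le> enat (2 * m + 1)"
  unfolding min_depth_def by (intro Inf_lower imageI) auto

lemma min_depth_le_right: "right_even_depth A B m \<Longrightarrow> m \<ge> 1 \<Longrightarrow> min_depth B A \<le> enat (2 * m)"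
  unfolding min_depth_def by (intro Inf_lower imageI) auto

locale fin_dim_subalgebra =
  fixes K :: "'k ring" and A :: "('k, 'a) module" and B :: "'a set"
  assumes A: "fin_dim_algebra K A" and sub: "subring B A" and B: "fin_dim_algebra K (A\<lparr>carrier := B\<rparr>)"
begin

abbreviation "AB \<equiv> A\<lparr>carrier := B\<rparr>"
text \<open>The shift lets the chain start at index 0 with C_1; the elements of C_0 have another
  type.\<close>

abbreviation "P i \<equiv> tensor_power A B (Suc i)"

lemma powers: "tensor_powers K A B (Suc i)"
  by (intro tensor_powers.intro tensor_powers_axioms.intro fin_dim_algebra_over A B sub) simp

lemma B_sub: "B \<subseteq> carrier A"
  using subringE(1)[OF sub] .

lemma in_add_later:
  assumes "i \<le> j"
  shows "in_add (bi_hom A AB) (P i) {P j}"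
proof -
  interpret H: additive_homs "bimodule A AB" "bi_hom A AB" by (rule additive_homs_bi)
  show ?thesis using assms
  proof (induction j rule: dec_induct)
    case base
    have id: "bi_hom A AB (P i) (P i) (\<lambda>x. x)" by (rule bi_homI) simp_all
    show ?case
      by (rule H.in_add_retract[OF tensor_powers.bimod_AB[OF powers] _ id id]) simp_all
  next
    case (step j)
    show ?case
      by (rule H.in_add_trans[OF tensor_powers.bimod_AB[OF powers] _ step.IH])
        (auto simp: tensor_powers.bimod_AB[OF powers] intro: tensor_powers.in_add_Suc[OF powers])
  qed
qed

lemma chain:
  assumes cb: "\<And>i. central_bimodule K R S (P i)" and RS: "R = A \<or> R = AB"
    and nz: "\<one>\<^bsub>A\<^esub> \<noteq> \<zero>\<^bsub>A\<^esub>" and frt: "finite_rep_type (tensor_algebra K R (opp S))"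
  shows "\<exists>m n. num_indec (tensor_algebra K R (opp S)) = enat n \<and> m < n \<and>
    in_add (bi_hom R S) (P (Suc m)) (P ` {..m})"
proof -
  let ?E = "tensor_algebra K R (opp S)"
  have fin: "finite (indec_classes ?E)" and n: "num_indec ?E = enat (card (indec_classes ?E))"
    using frt by (auto simp: finite_rep_type_def num_indec_def split: if_splits)
  have "fin_gen K A" using A by (simp add: fin_dim_algebra_def fin_dim_algebra_axioms_def)
  \<comment> \<open>B has the unit and the scalar multiplication of A, so the scalars c1 are the
    same elements for R = A and for R = B.\<close>
  then have sp: "\<exists>Y. finite Y \<and> Y \<subseteq> carrier (P i) \<and>
      carrier (P i) \<subseteq> fspan ((\<lambda>c. c \<odot>\<^bsub>R\<^esub> \<one>\<^bsub>R\<^esub>) ` carrier K) (P i) Y" for i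
    using tensor_powers.finitely_spanned[OF powers] RS by auto
  have "carrier (P 0) \<noteq> {\<zero>\<^bsub>P 0\<^esub>}"
    by (rule tensor_powers.nonzero[OF powers _ nz]) simp
  from bimodule_in_add_chain[where T = P, OF cb sp this fin] show ?thesis using n by blast
qed

text \<open>Two relations are combined: the one assumed over R and S, and the relation of P i to P m
  for i \<le> m, which holds over A and B. The rings R' and S' therefore have to lie below both
  pairs.\<close>

lemma in_add_restrict:
  assumes "in_add (bi_hom R S) (P (Suc m)) (P ` {..m})"
    and "carrier R' \<subseteq> carrier R" "carrier S' \<subseteq> carrier S" "carrier R' \<subseteq> carrier A" "carrier S' \<subseteq> B"
    and bm: "\<And>i. bimodule R' S' (P i)"
  shows "H_equivalent R' S' (P (Suc m)) (P m)"
proof -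
  interpret H: additive_homs "bimodule R' S'" "bi_hom R' S'" by (rule additive_homs_bi)
  have S': "carrier S' \<subseteq> carrier AB" using assms(5) by simp
  have later: "in_add (bi_hom R' S') (P i) {P j}" if "i \<le> j" for i j
    by (rule in_add_map[OF in_add_later[OF that]]) (auto intro: bi_hom_mono[OF _ assms(4) S'])
  have "in_add (bi_hom R' S') (P (Suc m)) (P ` {..m})"
    by (rule in_add_map[OF assms(1)]) (auto intro: bi_hom_mono[OF _ assms(2,3)])
  then have "in_add (bi_hom R' S') (P (Suc m)) {P m}"
    using H.in_add_trans[of "P (Suc m)" "P ` {..m}" "{P m}"] bm later by blast
  \<comment> \<open>The converse relation is \<open>later\<close> from m to m + 1.\<close>
  then show ?thesis by (rule in_add_H_equivalent[OF bm bm]) (rule later, simp)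
qed

text \<open>One argument for both even bounds: S = A gives A^e, and S = B gives A \<otimes> B^op.
  Either way the relation is restricted to A-B-bimodules, which is right depth.\<close>

lemma right_even_bound:
  assumes cb: "\<And>i. central_bimodule K A S (P i)" and S: "B \<subseteq> carrier S"
    and nz: "\<one>\<^bsub>A\<^esub> \<noteq> \<zero>\<^bsub>A\<^esub>" and frt: "finite_rep_type (tensor_algebra K A (opp S))"
  shows "min_depth B A \<le> 2 * num_indec (tensor_algebra K A (opp S))"
proof -
  obtain m n where n: "num_indec (tensor_algebra K A (opp S)) = enat n" "m < n"
    and "in_add (bi_hom A S) (P (Suc m)) (P ` {..m})"
    using chain[OF cb _ nz frt] by blast
  from in_add_restrict[OF this(3), of A AB] have "right_even_depth A B (Suc m)"
    using S tensor_powers.bimod_AB[OF powers] by (simp add: right_even_depth_def)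
  \<comment> \<open>P (Suc m) is C_{m+2} and P m is C_{m+1}, so this is right depth 2(m + 1), and m
    < n.\<close>
  then have "min_depth B A \<le> enat (2 * Suc m)" by (rule min_depth_le_right) simp
  also have "\<dots> \<le> enat (2 * n)" using n(2) by simp
  also have "\<dots> = 2 * num_indec (tensor_algebra K A (opp S))"
    unfolding n(1) numeral_eq_enat times_enat_simps ..
  finally show ?thesis .
qed

lemma odd_bound:
  assumes nz: "\<one>\<^bsub>A\<^esub> \<noteq> \<zero>\<^bsub>A\<^esub>" and frt: "finite_rep_type (tensor_algebra K AB (opp AB))"
  shows "min_depth B A \<le> 1 + 2 * num_indec (tensor_algebra K AB (opp AB))"
proof -
  obtain m n where n: "num_indec (tensor_algebra K AB (opp AB)) = enat n" "m < n"
    and "in_add (bi_hom AB AB) (P (Suc m)) (P ` {..m})"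
    using chain[OF tensor_powers.central_BB[OF powers] _ nz frt] by blast
  from in_add_restrict[OF this(3), of AB AB] have "odd_depth A B (Suc m)"
    using B_sub tensor_powers.bimod_BB[OF powers] by (simp add: odd_depth_def)
  \<comment> \<open>As in the even case the comparison is of C_{m+2} with C_{m+1}, now giving depth
    2(m + 1) + 1 with m < n.\<close>
  then have "min_depth B A \<le> enat (2 * Suc m + 1)" by (rule min_depth_le_odd)
  also have "\<dots> \<le> enat (1 + 2 * n)" using n(2) by simp
  also have "\<dots> = 1 + 2 * num_indec (tensor_algebra K AB (opp AB))"
    unfolding n(1) numeral_eq_enat one_enat_def times_enat_simps plus_enat_simps ..
  finally show ?thesis .
qed

text \<open>The chain argument starts from a nonzero C_1. For A = 0 both C_1 and C_0 vanish, so they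
  are H-equivalent, which is depth 1.\<close>

lemma zero_algebra:
  assumes z: "\<one>\<^bsub>A\<^esub> = \<zero>\<^bsub>A\<^esub>"
  shows "min_depth B A \<le> 1"
proof -
  interpret A: algebra_over K A by (rule fin_dim_algebra_over[OF A])
  interpret AB: algebra_over K AB by (rule fin_dim_algebra_over[OF B])
  have lm: "left_module AB (base_bimodule A B)"
    by (intro left_module.intro left_module_axioms.intro AB.A.ring_axioms
        abelian_group_transport[OF AB.A.abelian_group_axioms, of id])
      (use AB.A.l_distr AB.A.r_distr AB.A.m_assoc AB.A.m_closed AB.A.l_one in \<open>auto simp: base_bimodule_def\<close>)
  have base: "bimodule AB AB (base_bimodule A B)"
    by (intro bimodule.intro bimodule_axioms.intro AB.A.ring_axioms lm)
      (use AB.A.l_distr AB.A.r_distr AB.A.m_assoc AB.A.m_closed AB.A.r_one in \<open>auto simp: base_bimodule_def\<close>)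
  have P0: "bimodule AB AB (P 0)" by (rule tensor_powers.bimod_BB[OF powers])
  have "x = \<zero>\<^bsub>P 0\<^esub>" if "x \<in> carrier (P 0)" for x
    by (rule tensor_powers.trivial[OF powers _ z that]) simp
  moreover have "x = \<zero>\<^bsub>base_bimodule A B\<^esub>" if "x \<in> carrier (base_bimodule A B)" for x
    using that A.A.one_zeroD[OF z] B_sub by (auto simp: base_bimodule_def)
  ultimately have "H_equivalent AB AB (P 0) (base_bimodule A B)"
    unfolding H_equivalent_def using trivial_divides[OF P0 base] trivial_divides[OF base P0] by blast
  then have "odd_depth A B 0" by (simp add: odd_depth_def)
  then show ?thesis using min_depth_le_odd[of A B 0] by (simp add: one_enat_def)
qed

end

theorem proposition2p1:
  fixes K :: "'k ring" and A :: "('k, 'a) module" and B :: "'a set"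
  assumes "fin_dim_algebra K A"
    and "subring B A"
    and "fin_dim_algebra K (A\<lparr>carrier := B\<rparr>)"
  shows "(finite_rep_type (tensor_algebra K (A\<lparr>carrier := B\<rparr>) (opp (A\<lparr>carrier := B\<rparr>))) \<longrightarrow>
        min_depth B A \<le> 1 + 2 * num_indec (tensor_algebra K (A\<lparr>carrier := B\<rparr>) (opp (A\<lparr>carrier := B\<rparr>)))) \<and>
      (\<one>\<^bsub>A\<^esub> \<noteq> \<zero>\<^bsub>A\<^esub> \<and> finite_rep_type (tensor_algebra K A (opp A)) \<longrightarrow>
        min_depth B A \<le> 2 * num_indec (tensor_algebra K A (opp A))) \<and>
      (\<one>\<^bsub>A\<^esub> \<noteq> \<zero>\<^bsub>A\<^esub> \<and> finite_rep_type (tensor_algebra K A (opp (A\<lparr>carrier := B\<rparr>))) \<longrightarrow>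
        min_depth B A \<le> 2 * num_indec (tensor_algebra K A (opp (A\<lparr>carrier := B\<rparr>))))"
proof -
  interpret fin_dim_subalgebra K A B by (rule fin_dim_subalgebra.intro[OF assms])
  have "min_depth B A \<le> 1 + 2 * num_indec (tensor_algebra K AB (opp AB))"
    if "finite_rep_type (tensor_algebra K AB (opp AB))"
  \<comment> \<open>The odd bound is at least 1 whatever n is, so it also covers A = 0.\<close>
  proof (cases "\<one>\<^bsub>A\<^esub> = \<zero>\<^bsub>A\<^esub>")
    case True
    show ?thesis by (rule order_trans[OF zero_algebra[OF True]]) simp
  next
    case False
    then show ?thesis using odd_bound that by blast
  qed
  moreover have "min_depth B A \<le> 2 * num_indec (tensor_algebra K A (opp A))"
    if "\<one>\<^bsub>A\<^esub> \<noteq> \<zero>\<^bsub>A\<^esub>" "finite_rep_type (tensor_algebra K A (opp A))"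
    by (rule right_even_bound[OF tensor_powers.central_AA[OF powers] B_sub that])
  moreover have "min_depth B A \<le> 2 * num_indec (tensor_algebra K A (opp AB))"
    if "\<one>\<^bsub>A\<^esub> \<noteq> \<zero>\<^bsub>A\<^esub>" "finite_rep_type (tensor_algebra K A (opp AB))"
    by (rule right_even_bound[OF tensor_powers.central_AB[OF powers] _ that]) simp
  ultimately show ?thesis by blast
qed

end
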